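(* Let $X,Y$ be Borel spaces, $\mu\in\mathcal P(X)$, $n\in\mathbb N_0$, $f_1,\dots,f_n\colon Y\to\overline{\mathbb R}$ Borel measurable, $c_1,\dots,c_n\in\mathbb R$, and $$\mathcal M=\Big\{\vartheta\in\mathcal P(Y)\colon \int_Y|f_i|\,\mathrm d\vartheta<\infty\text{ and }\int_Y f_i(y)\,\vartheta(\mathrm dy)\le c_i\text{ for }1\le i\le n\Big\}.$$ Let $(\tau_x)_{x\in X}$ be a family of bijections $Y\to Y$ such that $(x,y)\mapsto\tau_x(y)$ and $(x,y)\mapsto\tau_x^{-1}(y)$ are Borel measurable maps $X\times Y\to Y$, let $c\colon X\times Y\to[0,\infty]$ be Borel measurable, and let $$C(x,\vartheta)=\begin{cases}\int_Y c(x,y)\,\vartheta(\mathrm dy),&\text{if }\tau_x^{-1}(\vartheta)\in\mathcal M,\\ \infty,&\text{otherwise}\end{cases}\qquad (x\in X,\ \vartheta\in\mathcal P(Y)).$$ Assume that there exists $\kappa_0\in\ker(X,Y)$ with $C(x,\kappa_0(x))=0$ for $\mu$-almost all $x\in X$, and let $\rho$ and $\mathcal L$ be defined from $\mu,C,\kappa_0$ as in the context. Put $$\Theta:=\Big\{(a,y)\in[0,1]^{n+1}\times Y^{n+1}\colon\sum_{i=1}^{n+1}a_i\delta_{y_i}\in\mathcal M\Big\},$$ and let $\mathrm B(X,\Theta)$ be the set of Borel measurable maps $(a,y)\colon X\to\Theta$. Then, for all $f\in\mathcal L$, \begin{align*}\rho(f)&=\sup_{(a,y)\in\mathrm B(X,\Theta)}\int_X\sum_{i=1}^{n+1}a_i(x)\Big(f\big(\tau_x(y_i(x))\big)-c\big(x,\tau_x(y_i(x))\big)\Big)\,\mu(\mathrm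 dx)\\&=\int_X\sup_{(a,y)\in\Theta}\sum_{i=1}^{n+1}a_i\Big(f\big(\tau_x(y_i)\big)-c\big(x,\tau_x(y_i)\big)\Big)\,\overline\mu(\mathrm dx).\end{align*}
   Context: A Borel space is a topological space homeomorphic to a Borel subset of a Polish space. $\mathcal P(\Omega)$ is the set of Borel probability measures on $\Omega$ with the weak topology. $\overline{\mathbb R}=\mathbb R\cup\{\pm\infty\}$, and $\mathrm B(Y)$ is the set of Borel measurable functions $Y\to\overline{\mathbb R}$. $\overline\mu$ is the unique extension of $\mu$ to the $\sigma$-algebra of universally measurable sets. Conventions: $\infty-\infty=-\infty$, $\inf\emptyset=\infty$, and the usual measure-theoretic $0\cdot(\pm\infty)=0$. For a measure $\vartheta$ and measurable $\overline{\mathbb R}$-valued $g$, $\vartheta g:=\int g\,\mathrm d\vartheta:=\int g^+\,\mathrm d\vartheta-\int g^-\,\mathrm d\vartheta$ (with the conventions above); similarly for universally measurable functions and $\overline\mu$. $\delta_y$ is the Dirac measure at $y$. $\ker(X,Y)$ is the set of Borel measurable stochastic kernels $\kappa$ from $X$ to $Y$, with $\kappa(x)=\kappa(x,\cdot)\in\mathcal P(Y)$; $(\mu\kappa)(B):=\int_X\kappa(x,B)\,\mu(\mathrm dx)$; $\ker(\mu,\nu):=\{\kappa\in\ker(X,Y)\colon\mu\kappa=\nu\}$. $\tau_x^{-1}(\vartheta)$ is the push-forward of $\vartheta\in\mathcal P(Y)$ under the inverse map $\tau_x^{-1}$. For $f\in\mathrm B(Y)$ define $$\rho(f):=\sup_{\nu\in\mathcal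 P(Y)}\bigg(\int_Y f\,\mathrm d\nu-\inf_{\kappa\in\ker(\mu,\nu)}\int_X C\big(x,\kappa(x)\big)\,\mu(\mathrm dx)\bigg),\qquad f^C(x):=\sup_{\vartheta\in\mathcal P(Y)}\big(\vartheta f-C(x,\vartheta)\big),$$ where $f^C$ is universally measurable, and $$\mathcal L:=\Big\{f\in\mathrm B(Y)\colon-\infty<\int_Y f\,\mathrm d(\mu\kappa_0)\ \text{ and }\ \int_X f^C\,\mathrm d\overline\mu<\infty\Big\}.$$ *)

theory Defs
  imports "HOL-Probability.Probability"
begin

section \<open>Spaces\<close>

text \<open>
  The ambient Polish space ranges over types, which a HOL formula cannot quantify
  existentially.  It is therefore a type parameter \<open>'p\<close>: the hypothesis
  ``\<open>'a\<close> is a Borel space'' is \<open>is_Borel_space TYPE('a) TYPE('p)\<close>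
  with \<open>'p\<close> universally quantified at the level of the theorem.  The underlying set of
  the Borel space is the whole type \<open>'a\<close>.
\<close>

definition is_Borel_space :: "'a::topological_space itself \<Rightarrow> 'p::polish_space itself \<Rightarrow> bool" where
  "is_Borel_space _ _ \<longleftrightarrow>
     (\<exists>B \<in> sets (borel :: 'p measure). (UNIV :: 'a set) homeomorphic B)"

abbreviation prob_measures :: "'a::topological_space measure set" where
  "prob_measures \<equiv> space (prob_algebra borel)"

definition univ_borel :: "'a::topological_space measure" where
  "univ_borel = sigma UNIV {A. \<forall>\<nu> \<in> prob_measures. A \<in> sets (completion \<nu>)}"

text \<open>The extension of \<open>\<mu>\<close> to the universally measurable sets.\<close>

definition univ_ext :: "'a::topological_space measure \<Rightarrow> 'a measure" where
  "univ_ext \<mu> = restr_to_subalg (completion \<mu>) univ_borel"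


section \<open>Extended real arithmetic and integrals\<close>

text \<open>
  In the library \<open>\<infinity> + (-\<infinity>) = \<infinity>\<close> and \<open>\<infinity> - \<infinity> = \<infinity>\<close> on \<^typ>\<open>ereal\<close>.
  The operations below implement the opposite convention \<open>\<infinity> - \<infinity> = -\<infinity>\<close>;
  in all other cases they agree with the library operations.
\<close>

definition ereal_lminus :: "ereal \<Rightarrow> ereal \<Rightarrow> ereal" (infixl \<open>\<ominus>\<^sub>l\<close> 65) where
  "a \<ominus>\<^sub>l b = (if a = -\<infinity> \<or> b = \<infinity> then -\<infinity> else a - b)"

definition ereal_lsum :: "('i \<Rightarrow> ereal) \<Rightarrow> 'i set \<Rightarrow> ereal" where
  "ereal_lsum g I = (if \<exists>i\<in>I. g i = -\<infinity> then -\<infinity> else (\<Sum>i\<in>I. g i))"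

text \<open>\<^const>\<open>e2ennreal\<close> truncates negative values to \<open>0\<close>, so the two integrands are
  the positive and the negative part of \<open>g\<close>.\<close>

definition eint :: "'a measure \<Rightarrow> ('a \<Rightarrow> ereal) \<Rightarrow> ereal" where
  "eint M g = enn2ereal (\<integral>\<^sup>+ x. e2ennreal (g x) \<partial>M) \<ominus>\<^sub>l enn2ereal (\<integral>\<^sup>+ x. e2ennreal (- g x) \<partial>M)"


section \<open>Kernels and the functionals\<close>

definition kernels_between ::
  "'x::topological_space measure \<Rightarrow> 'y::topological_space measure \<Rightarrow> ('x \<Rightarrow> 'y measure) set" where
  "kernels_between \<mu> \<nu> = {\<kappa> \<in> borel \<rightarrow>\<^sub>M prob_algebra borel. \<mu> \<bind> \<kappa> = \<nu>}"

definition rho ::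
  "'x::topological_space measure \<Rightarrow> ('x \<Rightarrow> 'y::topological_space measure \<Rightarrow> ennreal) \<Rightarrow> ('y \<Rightarrow> ereal) \<Rightarrow> ereal" where
  "rho \<mu> C f = (SUP \<nu> \<in> prob_measures.
     eint \<nu> f \<ominus>\<^sub>l enn2ereal (INF \<kappa> \<in> kernels_between \<mu> \<nu>. \<integral>\<^sup>+ x. C x (\<kappa> x) \<partial>\<mu>))"

definition C_transform ::
  "('x \<Rightarrow> 'y::topological_space measure \<Rightarrow> ennreal) \<Rightarrow> ('y \<Rightarrow> ereal) \<Rightarrow> 'x \<Rightarrow> ereal" where
  "C_transform C f x = (SUP \<theta> \<in> prob_measures. eint \<theta> f \<ominus>\<^sub>l enn2ereal (C x \<theta>))"

definition calL ::
  "'x::topological_space measure \<Rightarrow> ('x \<Rightarrow> 'y::topological_space measure \<Rightarrow> ennreal)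
    \<Rightarrow> ('x \<Rightarrow> 'y measure) \<Rightarrow> ('y \<Rightarrow> ereal) set" where
  "calL \<mu> C \<kappa>0 = {f \<in> borel_measurable borel.
     -\<infinity> < eint (\<mu> \<bind> \<kappa>0) f \<and> eint (univ_ext \<mu>) (C_transform C f) < \<infinity>}"


section \<open>Moment constraints and the cost function\<close>

definition moment_set :: "nat \<Rightarrow> (nat \<Rightarrow> 'y::topological_space \<Rightarrow> ereal) \<Rightarrow> (nat \<Rightarrow> real) \<Rightarrow> 'y measure set" where
  "moment_set n fs cs = {\<theta> \<in> prob_measures. \<forall>i\<in>{1..n}.
     (\<integral>\<^sup>+ y. e2ennreal \<bar>fs i y\<bar> \<partial>\<theta>) < \<infinity> \<and> eint \<theta> (fs i) \<le> ereal (cs i)}"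

definition moment_cost ::
  "('x \<Rightarrow> 'y::topological_space \<Rightarrow> 'y) \<Rightarrow> ('x \<times> 'y \<Rightarrow> ennreal) \<Rightarrow> 'y measure set
    \<Rightarrow> 'x \<Rightarrow> 'y measure \<Rightarrow> ennreal" where
  "moment_cost \<tau> c \<M> x \<theta> =
     (if distr \<theta> borel (inv (\<tau> x)) \<in> \<M> then \<integral>\<^sup>+ y. c (x, y) \<partial>\<theta> else \<infinity>)"

definition dirac_comb :: "nat set \<Rightarrow> (nat \<Rightarrow> real) \<Rightarrow> (nat \<Rightarrow> 'y::topological_space) \<Rightarrow> 'y measure" where
  "dirac_comb I a y =
     measure_of UNIV (sets borel) (\<lambda>B. \<Sum>i\<in>I. ennreal (a i) * emeasure (return borel (y i)) B)"

text \<open>A tuple indexed by \<open>1, \<dots>, n + 1\<close> is an extensional function on \<open>{1..n+1}\<close>.\<close>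

definition Theta :: "nat \<Rightarrow> 'y::topological_space measure set \<Rightarrow> ((nat \<Rightarrow> real) \<times> (nat \<Rightarrow> 'y)) set" where
  "Theta n \<M> = {(a, y) \<in> ({1..n+1} \<rightarrow>\<^sub>E {0..1}) \<times> ({1..n+1} \<rightarrow>\<^sub>E UNIV).
     dirac_comb {1..n+1} a y \<in> \<M>}"

text \<open>Borel spaces are second countable, so the product \<open>\<sigma>\<close>-algebra on the tuples is the Borel
  \<open>\<sigma>\<close>-algebra of the product topology; \<open>Theta\<close> carries its trace.\<close>

definition Theta_algebra ::
  "nat \<Rightarrow> 'y::topological_space measure set \<Rightarrow> ((nat \<Rightarrow> real) \<times> (nat \<Rightarrow> 'y)) measure" where
  "Theta_algebra n \<M> =
     restrict_space (PiM {1..n+1} (\<lambda>_. borel) \<Otimes>\<^sub>M PiM {1..n+1} (\<lambda>_. borel)) (Theta n \<M>)"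

definition comb_value ::
  "nat \<Rightarrow> ('x \<Rightarrow> 'y \<Rightarrow> 'y) \<Rightarrow> ('x \<times> 'y \<Rightarrow> ennreal) \<Rightarrow> ('y \<Rightarrow> ereal)
    \<Rightarrow> 'x \<Rightarrow> (nat \<Rightarrow> real) \<times> (nat \<Rightarrow> 'y) \<Rightarrow> ereal" where
  "comb_value n \<tau> c f x = (\<lambda>(a, y).
     ereal_lsum (\<lambda>i. ereal (a i) * (f (\<tau> x (y i)) \<ominus>\<^sub>l enn2ereal (c (x, \<tau> x (y i))))) {1..n+1})"

end

theory Submission
  imports Defs
begin

text \<open>
  Write \<open>V(x)\<close> for the supremum over \<^const>\<open>Theta\<close>.  Pulling measures back along \<open>\<tau>\<^sub>x\<close>, the supremum
  \<open>f\<^sup>C(x)\<close> is one of \<open>\<integral>g d\<eta>\<close> over \<open>\<eta> \<in> \<M>\<close>, and it equals \<open>V(x)\<close>: an integral of finitely many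
  functions is also attained by a finitely supported measure (by separation of convex sets and induction on
  the number of functions), and a simplex step reduces the support to \<open>n + 1\<close> points without
  decreasing \<open>g\<close>; unbounded \<open>g\<close> is reached by truncation.  The bound \<open>\<rho>(f) \<le> \<integral>V\<close> is the
  pointwise inequality between \<open>f\<close>, \<open>C\<close> and \<open>f\<^sup>C\<close>, integrated.  For the converse, the set where
  \<open>\<theta> \<in> \<Theta>\<close> is \<open>\<epsilon>\<close>-optimal at \<open>x\<close> is Borel, hence Souslin; its projection is measurable for
  every completed measure and has a Borel selector off a null set.  Since \<open>f \<in> \<L>\<close>, \<open>V\<close> is
  integrable, so the selector yields both suprema up to \<open>\<epsilon>\<close>.
\<close>

section \<open>Measurable selection\<close>

text \<open>The supremum over \<open>Theta\<close> is uncountable, so V is in general only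
  universally measurable; this is why analytic sets enter and why a Borel selector is near-optimal
  only off a null set. The count n + 1: to reproduce n moments, the total mass and the objective
  exactly costs n + 2 points. Allowing the objective to grow saves one of them. Infinite values are
  the other obstacle. Membership of f in \<open>calL\<close> controls V from both sides: \<kappa>0
  has cost 0 and f has an integrable negative part under it, which bounds V from below, while the
  integral of the transform of f bounds it from above. A near-optimal selector enjoys less: its
  value is finite almost everywhere, but the positive and negative parts of this value need not be
  integrable separately, and \<open>rho\<close> sees the parts. So \<kappa>0 is used a second time,
  as the fallback wherever those parts are large.\<close>

definition souslin :: "(nat list \<Rightarrow> 'a set) \<Rightarrow> 'a set" where
  "souslin A = {x. \<exists>\<sigma>. \<forall>m. x \<in> A (map \<sigma> [0..<m])}"

text \<open>For decreasing \<open>A\<close>, by Koenig's lemma, this says that \<open>s\<close> starts a branch through \<open>x\<close> that is bounded by \<open>k\<close>,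
  but unlike an existential statement about branches it is visibly measurable in \<open>x\<close>.\<close>

definition extendible :: "(nat \<Rightarrow> nat) \<Rightarrow> (nat list \<Rightarrow> 'a set) \<Rightarrow> nat list \<Rightarrow> 'a \<Rightarrow> bool" where
  "extendible k A s x \<longleftrightarrow>
     (\<forall>j. \<exists>t. length t = j \<and> (\<forall>i<length (s @ t). (s @ t) ! i \<le> k i) \<and> x \<in> A (s @ t))"

text \<open>Always taking the least admissible value makes the branch a function of x that inherits
  measurability from \<open>extendible\<close>.\<close>

primrec leftmost :: "(nat \<Rightarrow> nat) \<Rightarrow> (nat list \<Rightarrow> 'a set) \<Rightarrow> 'a \<Rightarrow> nat \<Rightarrow> nat list" where
  "leftmost k A x 0 = []"
| "leftmost k A x (Suc m) = leftmost k A x m @ [LEAST v. extendible k A (leftmost k A x m @ [v]) x]"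

text \<open>Koenig's lemma: if every value v failed at some depth \<open>J v\<close>, one bounded
  extension deeper than all these depths would begin with some v and contradict the failure of that
  v.\<close>

lemma extendible_step:
  assumes dec: "\<And>s t. A (s @ t) \<subseteq> A s" and ext: "extendible k A s x"
  shows "\<exists>v. extendible k A (s @ [v]) x"
proof (rule ccontr)
  assume "\<nexists>v. extendible k A (s @ [v]) x"
  then have "\<forall>v. \<exists>j. \<forall>t. \<not> (length t = j \<and> (\<forall>i<length ((s @ [v]) @ t). ((s @ [v]) @ t) ! i \<le> k i)
      \<and> x \<in> A ((s @ [v]) @ t))"
    unfolding extendible_def by blast
  then obtain J where "\<forall>v. \<forall>t. \<not> (length t = J v \<and> (\<forall>i<length ((s @ [v]) @ t). ((s @ [v]) @ t) ! i \<le> k i)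
      \<and> x \<in> A ((s @ [v]) @ t))"
    unfolding choice_iff by (elim exE)
  then have J: "\<And>v t. length t = J v \<Longrightarrow> (\<forall>i<length ((s @ [v]) @ t). ((s @ [v]) @ t) ! i \<le> k i)
      \<Longrightarrow> x \<notin> A ((s @ [v]) @ t)"
    by blast
  \<comment> \<open>The bound k leaves finitely many candidates for v, so a common depth exists. The
    extension is taken one longer, to hold v itself.\<close>
  define N where "N = Max (J ` {..k (length s)})"
  obtain t where t: "length t = Suc N" "\<forall>i<length (s @ t). (s @ t) ! i \<le> k i" "x \<in> A (s @ t)"
    using ext unfolding extendible_def by blast
  obtain v t' where vt: "t = v # t'" using t(1) by (cases t) auto
  have "(s @ t) ! length s \<le> k (length s)" using t(1,2) by auto
  then have v: "v \<le> k (length s)" using vt by simp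
  then have JN: "J v \<le> N" unfolding N_def by (intro Max_ge) auto
  have eq: "s @ t = ((s @ [v]) @ take (J v) t') @ drop (J v) t'" using vt by simp
  have "x \<notin> A ((s @ [v]) @ take (J v) t')"
  proof (rule J)
    show "length (take (J v) t') = J v" using vt t(1) JN by simp
    show "\<forall>i<length ((s @ [v]) @ take (J v) t'). ((s @ [v]) @ take (J v) t') ! i \<le> k i"
    proof (intro allI impI)
      fix i assume i: "i < length ((s @ [v]) @ take (J v) t')"
      then have "(((s @ [v]) @ take (J v) t') @ drop (J v) t') ! i \<le> k i"
        using t(2) unfolding eq by (auto simp del: append_assoc append_take_drop_id)
      then show "((s @ [v]) @ take (J v) t') ! i \<le> k i"
        using i by (simp add: nth_append del: append_assoc append_take_drop_id)
    qed
  qed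
  moreover have "x \<in> A ((s @ [v]) @ take (J v) t')"
    using t(3) dec unfolding eq by blast
  ultimately show False by blast
qed

lemma extendible_leftmost:
  assumes "\<And>s t. A (s @ t) \<subseteq> A s" and "extendible k A [] x"
  shows "extendible k A (leftmost k A x m) x"
proof (induction m)
  case (Suc m)
  show ?case
    using LeastI_ex[OF extendible_step[OF assms(1) Suc]] by simp
qed (use assms in simp)

text \<open>Exhibits the nodes as initial segments of one infinite branch, the form in which
  \<open>souslin\<close> asks for it.\<close>

lemma leftmost_eq_map:
  "leftmost k A x m = map (\<lambda>m. LEAST v. extendible k A (leftmost k A x m @ [v]) x) [0..<m]"
  by (induction m) auto

lemma extendible_mem:
  assumes "extendible k A s x" shows "x \<in> A s"
proof -
  obtain t where "length t = 0" "x \<in> A (s @ t)" using assms unfolding extendible_def by blast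
  then show ?thesis by simp
qed

lemma measurable_extendible:
  assumes A[measurable]: "\<And>s. A s \<in> sets M"
  shows "Measurable.pred M (extendible k A s)"
  unfolding extendible_def by measurable

text \<open>A node takes countably many values, so the next entry may be measured separately for
  each fixed node.\<close>

lemma measurable_leftmost:
  assumes A: "\<And>s. A s \<in> sets M"
  shows "(\<lambda>x. leftmost k A x m) \<in> M \<rightarrow>\<^sub>M count_space UNIV"
proof (induction m)
  case (Suc m)
  note [measurable] = measurable_extendible[OF A]
  have "(\<lambda>x. (\<lambda>s x. s @ [LEAST v. extendible k A (s @ [v]) x]) (leftmost k A x m) x)
      \<in> M \<rightarrow>\<^sub>M count_space UNIV"
    by (rule measurable_compose_countable[OF _ Suc]) measurable
  then show ?case by simp
qed simp

text \<open>The bounds are chosen one at a time: outer measure is continuous along the increasing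
  union over the bound of the next coordinate.\<close>

lemma ex_bounded_branches:
  assumes A: "\<And>s. A s \<in> sets M"
    and r: "r < outer_measure_of M (souslin A)"
  shows "\<exists>k. \<forall>m. r < outer_measure_of M
     {x. \<exists>\<sigma>. (\<forall>i<m. \<sigma> i \<le> k i) \<and> (\<forall>j. x \<in> A (map \<sigma> [0..<j]))}"
proof -
  define S where "S k m = {x. \<exists>\<sigma>. (\<forall>i<m. \<sigma> i \<le> (k i :: nat)) \<and> (\<forall>j. x \<in> A (map \<sigma> [0..<j]))}" for k m
  have sub: "S k m \<subseteq> space M" for k m
    proof
    fix x assume "x \<in> S k m"
    then obtain \<sigma> where "\<forall>j. x \<in> A (map \<sigma> [0..<j])" unfolding S_def by blast
    then have "x \<in> A (map \<sigma> [0..<0])" ..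
    then show "x \<in> space M" using sets.sets_into_space[OF A] by blast
  qed
  have S_cong: "S k m = S k' m" if "\<And>i. i < m \<Longrightarrow> k i = k' i" for k k' m
    unfolding S_def using that by auto
  have "\<exists>k. \<forall>n. r < outer_measure_of M (S (k n) n) \<and> (\<exists>N. k (Suc n) = (k n)(n := N))"
  proof (rule dependent_nat_choice)
    show "\<exists>k. r < outer_measure_of M (S k 0)"
      using r by (auto simp: S_def souslin_def)
  next
    fix k m assume *: "r < outer_measure_of M (S k m)"
    have inc: "incseq (\<lambda>N. S (k(m := N)) (Suc m))"
      unfolding incseq_def S_def
    proof (intro allI impI subsetI CollectI, elim CollectE exE conjE)
      fix N N' x \<sigma> assume "N \<le> N'" and \<sigma>: "\<forall>i<Suc m. \<sigma> i \<le> (k(m := N)) i" "\<forall>j. x \<in> A (map \<sigma> [0..<j])"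
      then have "\<forall>i<Suc m. \<sigma> i \<le> (k(m := N')) i" by (auto split: if_splits intro: order_trans)
      with \<sigma>(2) show "\<exists>\<sigma>. (\<forall>i<Suc m. \<sigma> i \<le> (k(m := N')) i) \<and> (\<forall>j. x \<in> A (map \<sigma> [0..<j]))"
        by blast
    qed
    have "S k m = (\<Union>N. S (k(m := N)) (Suc m))"
    proof (intro equalityI subsetI)
      fix x assume "x \<in> S k m"
      then obtain \<sigma> where \<sigma>: "\<forall>i<m. \<sigma> i \<le> k i" "\<forall>j. x \<in> A (map \<sigma> [0..<j])" unfolding S_def by blast
      then have "x \<in> S (k(m := \<sigma> m)) (Suc m)" unfolding S_def by (auto simp: less_Suc_eq)
      then show "x \<in> (\<Union>N. S (k(m := N)) (Suc m))" by blast
    next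
      fix x assume "x \<in> (\<Union>N. S (k(m := N)) (Suc m))"
      then obtain N \<sigma> where "\<forall>i<Suc m. \<sigma> i \<le> (k(m := N)) i" and s: "\<forall>j. x \<in> A (map \<sigma> [0..<j])"
        unfolding S_def by blast
      then have "\<forall>i<m. \<sigma> i \<le> k i" by (metis fun_upd_other less_SucI nat_neq_iff)
      with s show "x \<in> S k m" unfolding S_def by blast
    qed
    then have "outer_measure_of M (S k m) = (SUP N. outer_measure_of M (S (k(m := N)) (Suc m)))"
      using SUP_outer_measure_of_incseq[OF sub inc] by simp
    with * obtain N where "r < outer_measure_of M (S (k(m := N)) (Suc m))"
      by (auto simp: less_SUP_iff)
    then show "\<exists>k'. r < outer_measure_of M (S k' (Suc m)) \<and> (\<exists>N. k' = k(m := N))" by blast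
  qed
  then obtain k where k': "\<forall>n. r < outer_measure_of M (S (k n) n) \<and> (\<exists>N. k (Suc n) = (k n)(n := N))"
    by (elim exE)
  have k: "r < outer_measure_of M (S (k n) n)" and step: "\<exists>N. k (Suc n) = (k n)(n := N)" for n
    using k' by simp_all
  \<comment> \<open>Coordinate i is altered only in passing to \<open>k (Suc i)\<close>, so the
    diagonal agrees with \<open>k n\<close> below n.\<close>
  define K where "K i = k (Suc i) i" for i
  have kK: "k n i = K i" if "i < n" for i n
    using that
  proof (induction n)
    case (Suc n)
    obtain N where "k (Suc n) = (k n)(n := N)" using step by blast
    with Suc show ?case by (cases "i = n") (auto simp: K_def)
  qed simp
  have "S (k n) n = S K n" for n by (rule S_cong) (rule kK)
  then have "\<forall>m. r < outer_measure_of M (S K m)" using k by metis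
  then show ?thesis unfolding S_def by (intro exI[of _ K])
qed

text \<open>The sets \<open>E m\<close> ask only for a bounded node of length m. They are
  measurable, contain all points having a branch that is bounded up to m, and decrease to the set of
  extendible points; continuity from above turns the strict bound r into a weak one.\<close>

lemma (in finite_measure) extendible_large:
  assumes A[measurable]: "\<And>s. A s \<in> sets M" and dec: "\<And>s t. A (s @ t) \<subseteq> A s"
    and r: "r < outer_measure_of M (souslin A)"
  shows "\<exists>k. r \<le> emeasure M {x\<in>space M. extendible k A [] x}"
proof -
  obtain k where k: "\<And>m. r < outer_measure_of M
     {x. \<exists>\<sigma>. (\<forall>i<m. \<sigma> i \<le> k i) \<and> (\<forall>j. x \<in> A (map \<sigma> [0..<j]))}" (is "\<And>m. r < outer_measure_of M (?S m)")
    using ex_bounded_branches[OF A r] by blast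
  define E where "E m = {x\<in>space M. \<exists>t. length t = m \<and> (\<forall>i<m. t ! i \<le> k i) \<and> x \<in> A t}" for m
  have E[measurable]: "E m \<in> sets M" for m unfolding E_def by measurable
  have dE: "decseq E"
  proof (intro decseq_SucI subsetI)
    fix m x assume "x \<in> E (Suc m)"
    then obtain t where x: "x \<in> space M" and t: "length t = Suc m" "\<forall>i<Suc m. t ! i \<le> k i" "x \<in> A t"
      unfolding E_def by blast
    have "x \<in> A (take m t)" using t(3) dec[of "take m t" "drop m t"] by auto
    with t x show "x \<in> E m" unfolding E_def by (intro CollectI conjI exI[of _ "take m t"]) auto
  qed
  have "?S m \<subseteq> E m" for m
  proof (intro subsetI, elim CollectE exE conjE)
    fix x \<sigma> assume \<sigma>: "\<forall>i<m. \<sigma> i \<le> k i" "\<forall>j. x \<in> A (map \<sigma> [0..<j])"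
    then have "x \<in> space M" using sets.sets_into_space[OF A[of "map \<sigma> [0..<0]"]] by blast
    with \<sigma> show "x \<in> E m" unfolding E_def by (intro CollectI conjI exI[of _ "map \<sigma> [0..<m]"]) auto
  qed
  then have "r < emeasure M (E m)" for m
    using less_le_trans[OF k outer_measure_of_mono[of "?S m" "E m" M]] E by auto
  then have "r \<le> (INF m. emeasure M (E m))" by (intro INF_greatest) (simp add: less_imp_le)
  also have "\<dots> = emeasure M (\<Inter>m. E m)"
    using dE by (intro INF_emeasure_decseq) auto
  also have "(\<Inter>m. E m) = {x\<in>space M. extendible k A [] x}"
    unfolding E_def extendible_def by auto
  finally show ?thesis by blast
qed

text \<open>Points with a bounded branch form measurable subsets of \<open>souslin A\<close> whose
  measures come arbitrarily close to its outer measure. Countably many bounds therefore exhaust it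
  up to a null set, and on the exhausted part a leftmost branch is the selector.\<close>

lemma (in finite_measure) souslin_selection_decreasing:
  assumes A: "\<And>s. A s \<in> sets M" and dec: "\<And>s t. A (s @ t) \<subseteq> A s"
  shows "\<exists>B\<in>sets M. \<exists>Z\<in>null_sets M. \<exists>h\<in>M \<rightarrow>\<^sub>M PiM UNIV (\<lambda>_. count_space UNIV).
     souslin A \<subseteq> B \<union> Z \<and> (\<forall>x\<in>B. \<forall>m. x \<in> A (map (h x) [0..<m]))"
proof -
  have sub: "souslin A \<subseteq> space M"
    proof
    fix x assume "x \<in> souslin A"
    then obtain \<sigma> where "\<forall>j. x \<in> A (map \<sigma> [0..<j])" unfolding souslin_def by blast
    then have "x \<in> A (map \<sigma> [0..<0])" ..
    then show "x \<in> space M" using sets.sets_into_space[OF A] by blast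
  qed
  define \<beta> where "\<beta> = outer_measure_of M (souslin A)"
  \<comment> \<open>A measurable hull: it has measure \<beta>, so filling it from inside leaves a
    null gap.\<close>
  obtain G where G: "G \<in> sets M" "souslin A \<subseteq> G" "\<beta> = emeasure M G"
    using outer_measure_of_attain[OF sub] unfolding \<beta>_def by metis
  have ex: "\<exists>k. r \<le> emeasure M {x\<in>space M. extendible k A [] x}" if "r < \<beta>" for r
    using extendible_large[OF A dec that[unfolded \<beta>_def]] .
  have "\<exists>k :: nat \<Rightarrow> nat \<Rightarrow> nat. \<forall>r<\<beta>. \<exists>n. r < emeasure M {x\<in>space M. extendible (k n) A [] x}"
  proof (cases "\<beta> = 0")
    case False
    then obtain u :: "nat \<Rightarrow> ennreal" where u: "\<And>n. u n < \<beta>" "u \<longlonglongrightarrow> \<beta>"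
      using approx_from_below_dense_linorder[of 0 \<beta>] unfolding zero_less_iff_neq_zero by blast
    obtain k where k: "\<And>n. u n \<le> emeasure M {x\<in>space M. extendible (k n) A [] x}"
      using ex[OF u(1)] by metis
    have "\<exists>n. r < emeasure M {x\<in>space M. extendible (k n) A [] x}" if "r < \<beta>" for r
    proof -
      have "\<forall>\<^sub>F n in sequentially. r < u n" using order_tendstoD(1)[OF u(2) that] .
      then obtain n where "r < u n" using eventually_happens'[OF sequentially_bot] by blast
      then show ?thesis using k[of n] by (intro exI[of _ n]) auto
    qed
    then show ?thesis by blast
  qed auto
  then obtain k :: "nat \<Rightarrow> nat \<Rightarrow> nat"
    where k: "\<And>r. r < \<beta> \<Longrightarrow> \<exists>n. r < emeasure M {x\<in>space M. extendible (k n) A [] x}" by blast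
  define P where "P n x = extendible (k n) A [] x" for n x
  have P[measurable]: "Measurable.pred M (P n)" for n
    unfolding P_def using measurable_extendible[OF A] .
  define B where "B = {x\<in>space M. \<exists>n. P n x}"
  have B[measurable]: "B \<in> sets M" unfolding B_def by measurable
  define g where "g n x m = (LEAST v. extendible (k n) A (leftmost (k n) A x m @ [v]) x)" for n x m
  \<comment> \<open>Different bounds may lead to different branches; the first bound that works is
    used, and its index depends measurably on x.\<close>
  define h where "h x = g (LEAST n. P n x) x" for x
  have map_g: "map (g n x) [0..<m] = leftmost (k n) A x m" for n x m
    unfolding g_def leftmost_eq_map[of "k n" A x m] ..
  have hA: "x \<in> A (map (h x) [0..<m])" if "x \<in> B" for x m
  proof -
    have "P (LEAST n. P n x) x" using that unfolding B_def by (auto intro: LeastI_ex)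
    then show ?thesis
      unfolding h_def map_g P_def by (rule extendible_mem[OF extendible_leftmost[OF dec]])
  qed
  have BS: "B \<subseteq> souslin A" using hA unfolding souslin_def by blast
  have "\<beta> \<le> emeasure M B"
  proof (rule dense_le)
    fix r assume "r < \<beta>"
    then obtain n where "r < emeasure M {x\<in>space M. P n x}" using k unfolding P_def by blast
    also have "\<dots> \<le> emeasure M B" by (intro emeasure_mono) (auto simp: B_def)
    finally show "r \<le> emeasure M B" by simp
  qed
  then have "emeasure M (G - B) = 0"
    using G B BS by (subst emeasure_Diff) (auto simp: diff_eq_0_iff_ennreal less_top[symmetric])
  then have "G - B \<in> null_sets M" using G B by auto
  moreover have "h \<in> M \<rightarrow>\<^sub>M PiM UNIV (\<lambda>_. count_space UNIV)"
  proof (rule measurable_abs_UNIV)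
    fix m
    note [measurable] = measurable_extendible[OF A] measurable_leftmost[OF A]
    have g: "(\<lambda>x. g n x m) \<in> M \<rightarrow>\<^sub>M count_space UNIV" for n
    proof -
      have "(\<lambda>x. (\<lambda>s x. LEAST v. extendible (k n) A (s @ [v]) x) (leftmost (k n) A x m) x)
          \<in> M \<rightarrow>\<^sub>M count_space UNIV"
        by (rule measurable_compose_countable) measurable
      then show ?thesis unfolding g_def by simp
    qed
    show "(\<lambda>x. h x m) \<in> M \<rightarrow>\<^sub>M count_space UNIV"
      unfolding h_def by (rule measurable_compose_countable[OF g]) measurable
  qed
  moreover have "souslin A \<subseteq> B \<union> (G - B)" using G by auto
  ultimately show ?thesis using B BS hA by blast
qed

section \<open>Souslin relations between points and sequences\<close>

definition finitary :: "((nat \<Rightarrow> nat) \<Rightarrow> (nat \<Rightarrow> nat) \<Rightarrow> 'b) \<Rightarrow> bool" where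
  "finitary P \<longleftrightarrow> (\<exists>l. \<forall>\<sigma> \<sigma>' \<tau> \<tau>'. (\<forall>i<l. \<sigma> i = \<sigma>' i \<and> \<tau> i = \<tau>' i) \<longrightarrow> P \<sigma> \<tau> = P \<sigma>' \<tau>')"

text \<open>The Souslin operation with a parameter \<sigma>, where \<tau> is the witness. The
  conditions \<open>P j\<close> are written on whole sequences but read finitely many coordinates:
  recoding a witness is then plain composition, and a scheme over finite sequences can still be
  recovered.\<close>

definition souslin_rep :: "'a measure \<Rightarrow> ('a \<times> (nat \<Rightarrow> nat)) set \<Rightarrow>
    (nat \<Rightarrow> (nat \<Rightarrow> nat) \<Rightarrow> (nat \<Rightarrow> nat) \<Rightarrow> 'a set) \<Rightarrow> bool" where
  "souslin_rep M D P \<longleftrightarrow> (\<forall>j \<sigma> \<tau>. P j \<sigma> \<tau> \<in> sets M) \<and> (\<forall>j. finitary (P j)) \<and>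
     (\<forall>x \<sigma>. (x, \<sigma>) \<in> D \<longleftrightarrow> (\<exists>\<tau>. \<forall>j. x \<in> P j \<sigma> \<tau>))"

definition souslin_rel :: "'a measure \<Rightarrow> ('a \<times> (nat \<Rightarrow> nat)) set \<Rightarrow> bool" where
  "souslin_rel M D \<longleftrightarrow> (\<exists>P. souslin_rep M D P)"

lemma finitary_single:
  assumes "\<And>\<sigma> \<sigma>' \<tau> \<tau>'. \<sigma> k = \<sigma>' k \<Longrightarrow> P \<sigma> \<tau> = P \<sigma>' \<tau>'"
  shows "finitary P"
  unfolding finitary_def using assms by (intro exI[of _ "Suc k"]) blast

lemma finitary_reindex:
  assumes "finitary P"
  shows "finitary (\<lambda>\<sigma> \<tau>. P \<sigma> (\<lambda>i. \<tau> (g i)))"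
proof -
  obtain l where l: "\<And>\<sigma> \<sigma>' \<tau> \<tau>'. (\<forall>i<l. \<sigma> i = \<sigma>' i \<and> \<tau> i = \<tau>' i) \<Longrightarrow> P \<sigma> \<tau> = P \<sigma>' \<tau>'"
    using assms unfolding finitary_def by blast
  obtain L where L: "\<And>i. i < l \<Longrightarrow> g i < L"
    using finite_nat_set_iff_bounded[of "g ` {..<l}"] by auto
  show ?thesis unfolding finitary_def
    by (rule exI[of _ "max l L"], intro allI impI, rule l) (use L in \<open>auto simp: less_max_iff_disj\<close>)
qed

lemma souslin_relI:
  assumes "\<And>j \<sigma> \<tau>. P j \<sigma> \<tau> \<in> sets M" "\<And>j::nat. finitary (P j)"
    and "\<And>x \<sigma>. (x, \<sigma>) \<in> D \<longleftrightarrow> (\<exists>\<tau>. \<forall>j. x \<in> P j \<sigma> \<tau>)"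
  shows "souslin_rel M D"
  unfolding souslin_rel_def souslin_rep_def by (rule exI[of _ P]) (simp add: assms)

text \<open>The witnesses for all i are packed into one sequence by the pairing function, and the
  index k of a condition codes both i and j.\<close>

lemma souslin_rel_Int:
  fixes D :: "nat \<Rightarrow> _"
  assumes "\<And>i. souslin_rel M (D i)"
  shows "souslin_rel M (\<Inter>i. D i)"
proof -
  have "\<forall>i. \<exists>P. souslin_rep M (D i) P" using assms unfolding souslin_rel_def ..
  then obtain P where rep: "\<forall>i. souslin_rep M (D i) (P i)" by (rule choice[THEN exE])
  have P: "P i j \<sigma> \<tau> \<in> sets M" "finitary (P i j)"
    and D: "(x, \<sigma>) \<in> D i \<longleftrightarrow> (\<exists>\<tau>. \<forall>j. x \<in> P i j \<sigma> \<tau>)" for i j x \<sigma> \<tau>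
    using rep unfolding souslin_rep_def by simp_all
  define Q where "Q k \<sigma> \<tau> = P (fst (prod_decode k)) (snd (prod_decode k)) \<sigma>
     (\<lambda>m. \<tau> (prod_encode (fst (prod_decode k), m)))" for k \<sigma> \<tau>
  show ?thesis
  proof (rule souslin_relI[of Q])
    show "Q k \<sigma> \<tau> \<in> sets M" for k \<sigma> \<tau> unfolding Q_def by (rule P)
    show "finitary (Q k)" for k unfolding Q_def by (rule finitary_reindex) (rule P)
    fix x \<sigma>
    show "(x, \<sigma>) \<in> (\<Inter>i. D i) \<longleftrightarrow> (\<exists>\<tau>. \<forall>k. x \<in> Q k \<sigma> \<tau>)"
    proof
      assume "(x, \<sigma>) \<in> (\<Inter>i. D i)"
      then have "\<forall>i. \<exists>\<tau>. \<forall>j. x \<in> P i j \<sigma> \<tau>" by (simp add: D)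
      then obtain T where T: "\<forall>i j. x \<in> P i j \<sigma> (T i)" by (rule choice[THEN exE])
      then have "\<forall>k. x \<in> Q k \<sigma> (\<lambda>n. T (fst (prod_decode n)) (snd (prod_decode n)))"
        unfolding Q_def by simp
      then show "\<exists>\<tau>. \<forall>k. x \<in> Q k \<sigma> \<tau>" by blast
    next
      assume "\<exists>\<tau>. \<forall>k. x \<in> Q k \<sigma> \<tau>"
      then obtain \<tau> where t: "\<And>k. x \<in> Q k \<sigma> \<tau>" by blast
      have "x \<in> P i j \<sigma> (\<lambda>m. \<tau> (prod_encode (i, m)))" for i j
        using t[of "prod_encode (i, j)"] unfolding Q_def by simp
      then have "(x, \<sigma>) \<in> D i" for i unfolding D by blast
      then show "(x, \<sigma>) \<in> (\<Inter>i. D i)" by simp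
    qed
  qed
qed

text \<open>The first entry of the witness names the relation that holds, and the rest is a witness
  for it. Conditions belonging to any other i are relaxed to \<open>space M\<close>.\<close>

lemma souslin_rel_Un:
  fixes D :: "nat \<Rightarrow> _"
  assumes "\<And>i. souslin_rel M (D i)"
  shows "souslin_rel M (\<Union>i. D i)"
proof -
  have "\<forall>i. \<exists>P. souslin_rep M (D i) P" using assms unfolding souslin_rel_def ..
  then obtain P where rep: "\<forall>i. souslin_rep M (D i) (P i)" by (rule choice[THEN exE])
  have P: "P i j \<sigma> \<tau> \<in> sets M" "finitary (P i j)"
    and D: "(x, \<sigma>) \<in> D i \<longleftrightarrow> (\<exists>\<tau>. \<forall>j. x \<in> P i j \<sigma> \<tau>)" for i j x \<sigma> \<tau>
    using rep unfolding souslin_rep_def by simp_all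
  define R where "R i j \<sigma> \<tau> = (if \<tau> 0 = i then P i j \<sigma> (\<lambda>m. \<tau> (Suc m)) else space M)"
    for i j \<sigma> and \<tau> :: "nat \<Rightarrow> nat"
  define Q where "Q k = R (fst (prod_decode k)) (snd (prod_decode k))" for k
  have fin: "finitary (R i j)" for i j
  proof -
    obtain l where l: "\<And>\<sigma> \<sigma>' \<tau> \<tau>'. (\<forall>i<l. \<sigma> i = \<sigma>' i \<and> \<tau> i = \<tau>' i) \<Longrightarrow>
        P i j \<sigma> (\<lambda>m. \<tau> (Suc m)) = P i j \<sigma>' (\<lambda>m. \<tau>' (Suc m))"
      using finitary_reindex[OF P(2), of i j Suc] unfolding finitary_def by blast
    show ?thesis unfolding finitary_def
    proof (rule exI[of _ "Suc l"], intro allI impI)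
      fix \<sigma> \<sigma>' \<tau> \<tau>' :: "nat \<Rightarrow> nat" assume *: "\<forall>i<Suc l. \<sigma> i = \<sigma>' i \<and> \<tau> i = \<tau>' i"
      then have "P i j \<sigma> (\<lambda>m. \<tau> (Suc m)) = P i j \<sigma>' (\<lambda>m. \<tau>' (Suc m))" by (intro l) auto
      then show "R i j \<sigma> \<tau> = R i j \<sigma>' \<tau>'" using * unfolding R_def by simp
    qed
  qed
  show ?thesis
  proof (rule souslin_relI[of Q])
    show "Q k \<sigma> \<tau> \<in> sets M" for k \<sigma> \<tau> unfolding Q_def R_def using P by simp
    show "finitary (Q k)" for k unfolding Q_def by (rule fin)
    fix x \<sigma>
    show "(x, \<sigma>) \<in> (\<Union>i. D i) \<longleftrightarrow> (\<exists>\<tau>. \<forall>k. x \<in> Q k \<sigma> \<tau>)"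
    proof
      assume "(x, \<sigma>) \<in> (\<Union>i. D i)"
      then obtain i where "(x, \<sigma>) \<in> D i" by blast
      then obtain \<tau> where T: "\<forall>j. x \<in> P i j \<sigma> \<tau>" unfolding D by blast
      then have "x \<in> space M" using sets.sets_into_space[OF P(1)] by blast
      with T have "\<forall>k. x \<in> Q k \<sigma> (case_nat i \<tau>)"
        unfolding Q_def R_def by auto
      then show "\<exists>\<tau>. \<forall>k. x \<in> Q k \<sigma> \<tau>" by blast
    next
      assume "\<exists>\<tau>. \<forall>k. x \<in> Q k \<sigma> \<tau>"
      then obtain \<tau> where t: "\<And>k. x \<in> Q k \<sigma> \<tau>" by blast
      have "x \<in> P (\<tau> 0) j \<sigma> (\<lambda>m. \<tau> (Suc m))" for j
        using t[of "prod_encode (\<tau> 0, j)"] unfolding Q_def R_def by simp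
      then have "(x, \<sigma>) \<in> D (\<tau> 0)" unfolding D by blast
      then show "(x, \<sigma>) \<in> (\<Union>i. D i)" by blast
    qed
  qed
qed

abbreviation baire :: "(nat \<Rightarrow> nat) measure" where
  "baire \<equiv> PiM UNIV (\<lambda>_. count_space UNIV)"

text \<open>Souslin relations whose complement is Souslin form a \<open>\<sigma>\<close>-algebra for which both projections
  are measurable.\<close>

lemma souslin_rel_sets:
  assumes D: "D \<in> sets (M \<Otimes>\<^sub>M baire)"
  shows "souslin_rel M D"
proof -
  define \<Omega> :: "('a \<times> (nat \<Rightarrow> nat)) set" where "\<Omega> = space M \<times> UNIV"
  define \<A> where "\<A> = {D \<in> Pow \<Omega>. souslin_rel M D \<and> souslin_rel M (\<Omega> - D)}"
  have const: "souslin_rel M {(x, \<sigma>). x \<in> A \<and> \<sigma> i \<in> N}" if "A \<in> sets M" for A i N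
    by (rule souslin_relI[of "\<lambda>_ \<sigma> _. if \<sigma> i \<in> N then A else {}"])
      (use that in \<open>auto intro!: finitary_single[of i] split: if_splits\<close>)
  have "sigma_algebra \<Omega> \<A>"
    unfolding sigma_algebra_iff2
  proof (intro conjI ballI allI impI)
    show "{} \<in> \<A>"
    proof -
      have "{} = {(x, \<sigma>). x \<in> ({} :: 'a set) \<and> \<sigma> (0::nat) \<in> (UNIV :: nat set)}" by auto
      moreover have "\<Omega> - {} = {(x, \<sigma>). x \<in> space M \<and> \<sigma> 0 \<in> UNIV}" unfolding \<Omega>_def by auto
      ultimately show ?thesis
        using const[of "{}" 0 UNIV] const[of "space M" 0 UNIV] unfolding \<A>_def by simp
    qed
    show "\<Omega> - D \<in> \<A>" if "D \<in> \<A>" for D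
      using that unfolding \<A>_def by (auto simp: double_diff)
    fix D :: "nat \<Rightarrow> _" assume "range D \<subseteq> \<A>"
    then have D: "\<And>i. D i \<subseteq> \<Omega>" "\<And>i. souslin_rel M (D i)" "\<And>i. souslin_rel M (\<Omega> - D i)"
      unfolding \<A>_def by auto
    have "souslin_rel M (\<Inter>i. \<Omega> - D i)" by (rule souslin_rel_Int) (rule D)
    then have "souslin_rel M (\<Omega> - (\<Union>i. D i))" by simp
    moreover have "souslin_rel M (\<Union>i. D i)" by (rule souslin_rel_Un) (rule D)
    ultimately show "(\<Union>i. D i) \<in> \<A>"
      unfolding \<A>_def using D(1) by auto
  qed (auto simp: \<A>_def)
  then interpret \<A>: sigma_algebra \<Omega> \<A> .
  define S where "S = sigma \<Omega> \<A>"
  have S: "space S = \<Omega>" "sets S = \<A>" unfolding S_def by simp_all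
  \<comment> \<open>The complement of a generator consists of two generators: either x leaves A or
    the entry at i leaves N. The union over n merely writes the two as a sequence.\<close>
  have rect: "{(x, \<sigma>). x \<in> A \<and> \<sigma> i \<in> N} \<in> \<A>" if A: "A \<in> sets M" for A i N
  proof -
    have "\<Omega> - {(x, \<sigma>). x \<in> A \<and> \<sigma> i \<in> N} =
       (\<Union>n::nat. if n = 0 then {(x, \<sigma>). x \<in> space M - A \<and> \<sigma> i \<in> UNIV} else {(x, \<sigma>). x \<in> space M \<and> \<sigma> i \<in> - N})"
      using sets.sets_into_space[OF A] unfolding \<Omega>_def by (auto split: if_splits)
    moreover have "souslin_rel M \<dots>"
    proof (rule souslin_rel_Un)
      fix n :: nat
      show "souslin_rel M (if n = 0 then {(x, \<sigma>). x \<in> space M - A \<and> \<sigma> i \<in> UNIV} else {(x, \<sigma>). x \<in> space M \<and> \<sigma> i \<in> - N})"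
        using const[OF sets.compl_sets[OF A], of i UNIV] const[OF sets.top, of i "- N"]
        by (cases "n = 0") simp_all
    qed
    ultimately show ?thesis
      using const[OF A] sets.sets_into_space[OF A] unfolding \<A>_def \<Omega>_def by auto
  qed
  have "fst \<in> S \<rightarrow>\<^sub>M M"
  proof (rule measurableI)
    show "fst -` A \<inter> space S \<in> sets S" if "A \<in> sets M" for A
    proof -
      have "fst -` A \<inter> space S = {(x, \<sigma>). x \<in> A \<and> \<sigma> 0 \<in> UNIV}"
        using sets.sets_into_space[OF that] unfolding S \<Omega>_def by auto
      then show ?thesis using rect[OF that, of 0 UNIV] S by simp
    qed
  qed (auto simp: S \<Omega>_def)
  moreover have "snd \<in> S \<rightarrow>\<^sub>M baire"
  proof (rule measurable_PiM_single')
    fix i :: nat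
    show "(\<lambda>z. snd z i) \<in> S \<rightarrow>\<^sub>M count_space UNIV"
    proof (rule measurableI)
      fix N
      have "(\<lambda>z. snd z i) -` N \<inter> space S = {(x, \<sigma>). x \<in> space M \<and> \<sigma> i \<in> N}"
        unfolding S \<Omega>_def by auto
      then show "(\<lambda>z. snd z i) -` N \<inter> space S \<in> sets S" using rect[OF sets.top, of i N] S by simp
    qed simp
  qed auto
  \<comment> \<open>Measurability of the identity from S is the inclusion of the product
    \<sigma>-algebra in \<A>.\<close>
  ultimately have "(\<lambda>z. (fst z, snd z)) \<in> S \<rightarrow>\<^sub>M M \<Otimes>\<^sub>M baire" by (rule measurable_Pair)
  then have "(\<lambda>z. z) -` D \<inter> space S \<in> sets S" using D by (auto dest: measurable_sets)
  moreover have "D \<subseteq> \<Omega>" using sets.sets_into_space[OF D] unfolding \<Omega>_def by (auto simp: space_pair_measure)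
  ultimately have "D \<in> \<A>" using S by (simp add: Int_absorb2)
  then show ?thesis unfolding \<A>_def by blast
qed

text \<open>Parameter and witness are interleaved into one branch \<rho>, even entries for \<sigma>
  and odd ones for \<tau>. The projection of D then lies in \<open>souslin A\<close>, and the even
  half of a selected branch is the selector.\<close>

lemma (in finite_measure) baire_selection:
  assumes D: "D \<in> sets (M \<Otimes>\<^sub>M baire)"
  shows "\<exists>B\<in>sets M. \<exists>Z\<in>null_sets M. \<exists>h\<in>M \<rightarrow>\<^sub>M baire.
     fst ` D \<subseteq> B \<union> Z \<and> (\<forall>x\<in>B. (x, h x) \<in> D)"
proof -
  obtain P where "souslin_rep M D P" using souslin_rel_sets[OF D] unfolding souslin_rel_def by blast
  then have P: "P j \<sigma> \<tau> \<in> sets M" and fin: "\<forall>j. finitary (P j)"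
    and D_iff: "(x, \<sigma>) \<in> D \<longleftrightarrow> (\<exists>\<tau>. \<forall>j. x \<in> P j \<sigma> \<tau>)" for j x \<sigma> \<tau>
    unfolding souslin_rep_def by simp_all
  obtain l where l': "\<forall>j. \<forall>\<sigma> \<sigma>' \<tau> \<tau>'. (\<forall>i<l j. \<sigma> i = \<sigma>' i \<and> \<tau> i = \<tau>' i) \<longrightarrow> P j \<sigma> \<tau> = P j \<sigma>' \<tau>'"
    using choice[OF fin[unfolded finitary_def]] ..
  have l: "P j \<sigma> \<tau> = P j \<sigma>' \<tau>'" if "\<forall>i<l j. \<sigma> i = \<sigma>' i \<and> \<tau> i = \<tau>' i" for j \<sigma> \<sigma>' \<tau> \<tau>'
    using l' that by blast
  define Q where "Q j \<rho> = P j (\<lambda>i. \<rho> (2 * i)) (\<lambda>i. \<rho> (2 * i + 1))" for j \<rho>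
  have Q: "Q j \<rho> = Q j \<rho>'" if "\<And>i. i < 2 * l j \<Longrightarrow> \<rho> i = \<rho>' i" for j \<rho> \<rho>'
    unfolding Q_def using that by (intro l) auto
  \<comment> \<open>A node s is tested against exactly those conditions that read no further than
    its length, so the padding by 0 is never consulted. The factor 2 below comes from the
    interleaving. Longer nodes face more conditions, hence \<open>A\<close> decreases.\<close>
  define pad where "pad s i = (if i < length s then s ! i else 0)" for s :: "nat list" and i
  define A where "A s = {x\<in>space M. \<forall>j. 2 * l j \<le> length s \<longrightarrow> x \<in> Q j (pad s)}" for s
  have [measurable]: "Q j \<rho> \<in> sets M" for j \<rho> unfolding Q_def by (rule P)
  have A: "A s \<in> sets M" for s unfolding A_def by measurable
  have dec: "A (s @ t) \<subseteq> A s" for s t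
  proof -
    have "Q j (pad (s @ t)) = Q j (pad s)" if "2 * l j \<le> length s" for j
      using that by (intro Q) (auto simp: pad_def nth_append)
    then show ?thesis unfolding A_def by (fastforce simp: trans_le_add1)
  qed
  have A_iff: "(\<forall>m. x \<in> A (map \<rho> [0..<m])) \<longleftrightarrow> (\<forall>j. x \<in> Q j \<rho>)" for x \<rho>
  proof -
    have eq: "Q j (pad (map \<rho> [0..<m])) = Q j \<rho>" if "2 * l j \<le> m" for j m
      using that by (intro Q) (auto simp: pad_def)
    have "Q 0 \<rho> \<subseteq> space M" by (rule sets.sets_into_space) measurable
    then have sp: "x \<in> space M" if "x \<in> Q 0 \<rho>" using that by blast
    show ?thesis
    proof (intro iffI allI)
      fix j assume "\<forall>m. x \<in> A (map \<rho> [0..<m])"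
      then have "x \<in> A (map \<rho> [0..<2 * l j])" by blast
      then show "x \<in> Q j \<rho>" using eq[of j "2 * l j"] unfolding A_def by auto
    next
      fix m assume *: "\<forall>j. x \<in> Q j \<rho>"
      then show "x \<in> A (map \<rho> [0..<m])" using eq[of _ m] sp unfolding A_def by simp
    qed
  qed
  obtain B Z h where B: "B \<in> sets M" and Z: "Z \<in> null_sets M" and h: "h \<in> M \<rightarrow>\<^sub>M baire"
    and cover: "souslin A \<subseteq> B \<union> Z" and sel: "\<forall>x\<in>B. \<forall>m. x \<in> A (map (h x) [0..<m])"
    using souslin_selection_decreasing[OF A dec] by blast
  have "fst ` D \<subseteq> souslin A"
  proof safe
    fix x \<sigma> assume "(x, \<sigma>) \<in> D"
    then obtain \<tau> where t: "\<forall>j. x \<in> P j \<sigma> \<tau>" unfolding D_iff by blast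
    define \<rho> where "\<rho> i = (if even i then \<sigma> (i div 2) else \<tau> (i div 2))" for i
    have "\<forall>j. x \<in> Q j \<rho>" using t unfolding Q_def \<rho>_def by simp
    then show "fst (x, \<sigma>) \<in> souslin A" using A_iff unfolding souslin_def by auto
  qed
  then have cover_D: "fst ` D \<subseteq> B \<union> Z" using cover by blast
  have "(x, \<lambda>i. h x (2 * i)) \<in> D" if "x \<in> B" for x
    using sel that A_iff[of x "h x"] unfolding D_iff Q_def by blast
  moreover have h': "(\<lambda>x i. h x (2 * i)) \<in> M \<rightarrow>\<^sub>M baire"
    by (rule measurable_abs_UNIV, rule measurable_compose[OF h measurable_component_singleton]) simp
  ultimately show ?thesis
    using cover_D by (intro bexI[OF _ B] bexI[OF _ Z] bexI[OF _ h']) blast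
qed

lemma (in finite_measure) measurable_selection:
  assumes s: "s \<in> baire \<rightarrow>\<^sub>M N" and surj: "space N \<subseteq> range s" and D: "D \<in> sets (M \<Otimes>\<^sub>M N)"
  shows "\<exists>B\<in>sets M. \<exists>Z\<in>null_sets M. \<exists>h\<in>M \<rightarrow>\<^sub>M N.
     fst ` D \<subseteq> B \<union> Z \<and> (\<forall>x\<in>B. (x, h x) \<in> D)"
proof -
  define D' where "D' = (\<lambda>(x, \<sigma>). (x, s \<sigma>)) -` D \<inter> space (M \<Otimes>\<^sub>M baire)"
  have "(\<lambda>(x, \<sigma>). (x, s \<sigma>)) \<in> M \<Otimes>\<^sub>M baire \<rightarrow>\<^sub>M M \<Otimes>\<^sub>M N" using s by measurable
  then have "D' \<in> sets (M \<Otimes>\<^sub>M baire)" unfolding D'_def using D by (rule measurable_sets)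
  from baire_selection[OF this] obtain B Z h where B: "B \<in> sets M" and Z: "Z \<in> null_sets M"
    and h: "h \<in> M \<rightarrow>\<^sub>M baire" and cover: "fst ` D' \<subseteq> B \<union> Z" and sel: "\<forall>x\<in>B. (x, h x) \<in> D'"
    by (elim bexE conjE)
  have "fst ` D \<subseteq> fst ` D'"
  proof
    fix x assume "x \<in> fst ` D"
    then obtain y where *: "(x, y) \<in> D" by auto
    then have xy: "x \<in> space M" "y \<in> space N"
      using sets.sets_into_space[OF D] by (auto simp: space_pair_measure)
    then obtain \<sigma> where "y = s \<sigma>" using surj by blast
    with * xy have "(x, \<sigma>) \<in> D'" unfolding D'_def by (simp add: space_pair_measure space_PiM)
    then show "x \<in> fst ` D'" by (rule image_eqI[rotated]) simp
  qed
  with cover have "fst ` D \<subseteq> B \<union> Z" by (rule order_trans[rotated])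
  moreover have "\<forall>x\<in>B. (x, s (h x)) \<in> D" using sel unfolding D'_def by simp
  moreover have h': "(\<lambda>x. s (h x)) \<in> M \<rightarrow>\<^sub>M N" using h s by (rule measurable_compose)
  ultimately show ?thesis
    by (intro bexI[OF _ B] bexI[OF _ Z] bexI[OF _ h'] conjI)
qed

section \<open>Discrete representation of moments\<close>

text \<open>Finite-dimensional separation of the origin from a convex cone that avoids it on the
  coordinates in I. The induction removes a coordinate i: a functional for the slice
  \<open>v i = 0\<close> is extended by a coefficient squeezed between two families of slopes. The
  cone need not be closed, so the inequality is weak.\<close>

lemma cone_separation:
  fixes K :: "('i \<Rightarrow> real) set"
  assumes "finite I" and "K \<noteq> {}"
    and "\<And>u v a b. u \<in> K \<Longrightarrow> v \<in> K \<Longrightarrow> 0 < a \<Longrightarrow> 0 < b \<Longrightarrow> (\<lambda>i. a * u i + b * v i) \<in> K"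
    and "\<And>v. v \<in> K \<Longrightarrow> \<exists>i\<in>I. v i \<noteq> 0"
  shows "\<exists>l. (\<exists>i\<in>I. l i \<noteq> 0) \<and> (\<forall>v\<in>K. 0 \<le> (\<Sum>i\<in>I. l i * v i))"
  using assms
proof (induction I arbitrary: K rule: finite_induct)
  case (insert i I K)
  note cone = insert.prems(2)
  define s where "s l v = (\<Sum>j\<in>I. l j * v j)" for l v :: "'i \<Rightarrow> real"
  have sum_upd: "(\<Sum>j\<in>insert i I. (l(i := \<beta>)) j * v j) = s l v + \<beta> * v i" for l \<beta> v
    using insert.hyps unfolding s_def by (auto intro!: sum.cong)
  \<comment> \<open>If coordinate i does not change sign on K, plus or minus this coordinate already
    separates.\<close>
  have one_sided: ?case if "\<beta> \<noteq> 0" "\<And>v. v \<in> K \<Longrightarrow> 0 \<le> \<beta> * v i" for \<beta>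
    using sum_upd[of "\<lambda>_. 0" \<beta>] that by (intro exI[of _ "(\<lambda>_. 0)(i := \<beta>)"]) (simp add: s_def)
  define K0 where "K0 = {v\<in>K. v i = 0}"
  have mix: "(\<lambda>j. - q i * p j + p i * q j) \<in> K0" if "p \<in> K" "q \<in> K" "0 < p i" "q i < 0" for p q
    using cone[of p q "- q i" "p i"] that unfolding K0_def by simp
  show ?case
  proof (cases "(\<exists>p\<in>K. 0 < p i) \<and> (\<exists>q\<in>K. q i < 0)")
    case False
    then show ?thesis using one_sided[of 1] one_sided[of "-1"] by (auto simp: not_less)
  next
    case True
    then obtain p0 q0 where p0: "p0 \<in> K" "0 < p0 i" and q0: "q0 \<in> K" "q0 i < 0" by blast
    have "K0 \<noteq> {}" using mix[OF p0(1) q0(1) p0(2) q0(2)] by blast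
    moreover have "(\<lambda>i. a * u i + b * v i) \<in> K0" if "u \<in> K0" "v \<in> K0" "0 < a" "0 < b" for u v a b
      using that cone[of u v a b] unfolding K0_def by simp
    moreover have "\<exists>j\<in>I. v j \<noteq> 0" if "v \<in> K0" for v
      using that insert.prems(3)[of v] unfolding K0_def by auto
    ultimately obtain l where l: "\<exists>j\<in>I. l j \<noteq> 0" and nonneg: "\<And>v. v \<in> K0 \<Longrightarrow> 0 \<le> s l v"
      using insert.IH[of K0] unfolding s_def by blast
    have slope: "s l q / q i \<le> s l p / p i" if "p \<in> K" "q \<in> K" "0 < p i" "q i < 0" for p q
    proof -
      have "0 \<le> s l (\<lambda>j. - q i * p j + p i * q j)" using nonneg[OF mix[OF that]] .
      also have "\<dots> = - q i * s l p + p i * s l q"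
        unfolding s_def by (simp add: sum_distrib_left sum.distrib[symmetric] algebra_simps)
      finally show ?thesis using that by (simp add: field_simps)
    qed
    \<comment> \<open>The infimum of the slopes over \<open>0 < p i\<close> still dominates every
      slope over \<open>q i < 0\<close>, so the coefficient \<open>- m\<close> works on both
      sides.\<close>
    define m where "m = (INF p\<in>{p\<in>K. 0 < p i}. s l p / p i)"
    have lower: "m \<le> s l p / p i" if "p \<in> K" "0 < p i" for p
      unfolding m_def using that slope[OF _ q0(1) _ q0(2)] by (intro cINF_lower bdd_belowI2) auto
    have upper: "s l q / q i \<le> m" if "q \<in> K" "q i < 0" for q
      unfolding m_def using that slope p0 by (intro cINF_greatest) auto
    have "0 \<le> s l v + - m * v i" if "v \<in> K" for v
    proof -
      consider "0 < v i" | "v i < 0" | "v i = 0" by linarith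
      then show ?thesis
      proof cases
        case 1 then show ?thesis using lower[OF that] by (simp add: field_simps)
      next
        case 2 then show ?thesis using upper[OF that] by (simp add: field_simps)
      next
        case 3 then show ?thesis using nonneg[of v] that unfolding K0_def by simp
      qed
    qed
    then have "\<forall>v\<in>K. 0 \<le> (\<Sum>j\<in>insert i I. (l(i := - m)) j * v j)" unfolding sum_upd by blast
    moreover have "\<exists>j\<in>insert i I. (l(i := - m)) j \<noteq> 0" using l insert.hyps by fastforce
    ultimately show ?thesis by blast
  qed
qed auto

text \<open>If the moments were not attained, a linear combination of the centred functions would be
  nonnegative on \<open>S\<close> with integral \<open>0\<close>, hence vanish almost everywhere, and one function
  could be eliminated.\<close>

lemma (in prob_space) finite_moment_representation:
  fixes F :: "'i \<Rightarrow> 'a \<Rightarrow> real"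
  assumes "finite I" and "AE y in M. y \<in> S" and "\<And>i. i \<in> I \<Longrightarrow> integrable M (F i)"
  shows "\<exists>T w. finite T \<and> T \<subseteq> S \<and> (\<forall>y\<in>T. 0 < w y) \<and> sum w T = 1
     \<and> (\<forall>i\<in>I. (\<Sum>y\<in>T. w y * F i y) = integral\<^sup>L M (F i))"
  using assms
proof (induction I arbitrary: S rule: finite_psubset_induct)
  case (psubset I)
  define G where "G i y = F i y - integral\<^sup>L M (F i)" for i y
  have G: "integrable M (G i)" "integral\<^sup>L M (G i) = 0" if "i \<in> I" for i
    using psubset.prems(2)[OF that] unfolding G_def by (auto simp: prob_space)
  have sum_G: "(\<Sum>y\<in>T. w y * G i y) = (\<Sum>y\<in>T. w y * F i y) - sum w T * integral\<^sup>L M (F i)" for T w i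
    unfolding G_def by (simp add: right_diff_distrib sum_subtractf sum_distrib_right)
  \<comment> \<open>The cone generated by the centred moment vectors of points of S. With nonempty T
    and strictly positive weights, a vector of K that vanishes on I is, after normalisation, a
    representation of the moments.\<close>
  define K where "K = {v. \<exists>T w. finite T \<and> T \<noteq> {} \<and> T \<subseteq> S \<and> (\<forall>y\<in>T. 0 < w y) \<and> v = (\<lambda>i. \<Sum>y\<in>T. w y * G i y)}"
  show ?case
  proof (cases "\<exists>v\<in>K. \<forall>i\<in>I. v i = 0")
    case True
    then obtain T w where T: "finite T" "T \<noteq> {}" "T \<subseteq> S" "\<forall>y\<in>T. 0 < w y"
      and zero: "\<forall>i\<in>I. (\<Sum>y\<in>T. w y * G i y) = 0" unfolding K_def by auto
    have pos: "0 < sum w T" using T by (intro sum_pos) auto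
    have "sum (\<lambda>y. w y / sum w T) T = 1" using pos by (simp add: sum_divide_distrib[symmetric])
    moreover have "(\<Sum>y\<in>T. w y / sum w T * F i y) = integral\<^sup>L M (F i)" if "i \<in> I" for i
      using zero that pos unfolding sum_G by (simp add: sum_divide_distrib[symmetric] field_simps)
    ultimately show ?thesis
      using T pos by (intro exI[of _ T] exI[of _ "\<lambda>y. w y / sum w T"]) auto
  next
    case False
    have point: "G' \<in> K" if "y \<in> S" "G' = (\<lambda>i. G i y)" for y G'
      unfolding K_def using that by (intro CollectI exI[of _ "{y}"] exI[of _ "\<lambda>_. 1"]) auto
    have "S \<noteq> {}" using psubset.prems(1) AE_contr by (auto simp: eventually_False ae_filter_eq_bot_iff emeasure_space_1)
    then have "K \<noteq> {}" using point by blast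
    moreover have "(\<lambda>i. a * u i + b * v i) \<in> K" if u: "u \<in> K" and v: "v \<in> K" and ab: "0 < a" "0 < b" for u v a b
    proof -
      obtain T w where T: "finite T" "T \<noteq> {}" "T \<subseteq> S" "\<forall>y\<in>T. 0 < w y" "u = (\<lambda>i. \<Sum>y\<in>T. w y * G i y)"
        using u unfolding K_def by blast
      obtain T' w' where T': "finite T'" "T' \<noteq> {}" "T' \<subseteq> S" "\<forall>y\<in>T'. 0 < w' y" "v = (\<lambda>i. \<Sum>y\<in>T'. w' y * G i y)"
        using v unfolding K_def by blast
      define W where "W y = a * (if y \<in> T then w y else 0) + b * (if y \<in> T' then w' y else 0)" for y
      have "u i = (\<Sum>y\<in>T \<union> T'. (if y \<in> T then w y else 0) * G i y)" for i
        unfolding T(5) using T(1) T'(1) by (intro sum.mono_neutral_cong_left) auto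
      moreover have "v i = (\<Sum>y\<in>T \<union> T'. (if y \<in> T' then w' y else 0) * G i y)" for i
        unfolding T'(5) using T(1) T'(1) by (intro sum.mono_neutral_cong_left) auto
      ultimately have "(\<lambda>i. a * u i + b * v i) = (\<lambda>i. \<Sum>y\<in>T \<union> T'. W y * G i y)"
        unfolding W_def by (simp add: sum_distrib_left sum.distrib[symmetric] algebra_simps)
      moreover have "\<forall>y\<in>T \<union> T'. 0 < W y"
        using T(4) T'(4) ab unfolding W_def by (auto intro: add_pos_pos)
      ultimately show ?thesis unfolding K_def using T T' by (intro CollectI exI[of _ "T \<union> T'"] exI[of _ W]) auto
    qed
    moreover have "\<exists>i\<in>I. v i \<noteq> 0" if "v \<in> K" for v using False that by blast
    ultimately obtain l where l: "\<exists>i\<in>I. l i \<noteq> 0" and nonneg: "\<forall>v\<in>K. 0 \<le> (\<Sum>i\<in>I. l i * v i)"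
      using cone_separation[OF psubset.hyps(1)] by blast
    obtain j where j: "j \<in> I" "l j \<noteq> 0" using l by blast
    define L where "L y = (\<Sum>i\<in>I. l i * G i y)" for y
    have L: "integrable M L" "integral\<^sup>L M L = 0"
      using G unfolding L_def by (auto simp: Bochner_Integration.integral_sum)
    have "AE y in M. 0 \<le> L y"
      using psubset.prems(1) point nonneg unfolding L_def by (auto elim!: eventually_mono)
    then have "AE y in M. L y = 0" using L integral_nonneg_eq_0_iff_AE by blast
    with psubset.prems(1) have "AE y in M. y \<in> {y\<in>S. L y = 0}" by eventually_elim simp
    moreover have "I - {j} \<subset> I" using j by blast
    \<comment> \<open>The induction hypothesis is applied with S cut down to the zeros of L; on this
      set the linear relation L = 0 returns the moment of the omitted index j.\<close>
    ultimately obtain T w where T: "finite T" "T \<subseteq> {y\<in>S. L y = 0}" "\<forall>y\<in>T. 0 < w y" "sum w T = 1"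
      and eq: "\<forall>i\<in>I - {j}. (\<Sum>y\<in>T. w y * F i y) = integral\<^sup>L M (F i)"
      using psubset.IH[of "I - {j}" "{y\<in>S. L y = 0}"] psubset.prems(2) by blast
    have zero: "(\<Sum>y\<in>T. w y * G i y) = 0" if "i \<in> I - {j}" for i
      using eq T(4) that unfolding sum_G by simp
    have "0 = (\<Sum>y\<in>T. w y * L y)" using T(2) by (intro sum.neutral[symmetric]) auto
    also have "\<dots> = (\<Sum>i\<in>I. l i * (\<Sum>y\<in>T. w y * G i y))"
      unfolding L_def sum_distrib_left by (subst sum.swap) (simp add: mult_ac)
    also have "\<dots> = l j * (\<Sum>y\<in>T. w y * G j y)"
      using j zero psubset.hyps(1) by (subst sum.remove[of _ j]) auto
    finally have "(\<Sum>y\<in>T. w y * G j y) = 0" using j by simp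
    then have "(\<Sum>y\<in>T. w y * F j y) = integral\<^sup>L M (F j)" unfolding sum_G T(4) by simp
    with eq have "\<forall>i\<in>I. (\<Sum>y\<in>T. w y * F i y) = integral\<^sup>L M (F i)" by blast
    with T show ?thesis by (intro exI[of _ T] exI[of _ w]) auto
  qed
qed

section \<open>Reduction of the support\<close>

lemma homogeneous_system_nontrivial:
  fixes H :: "'i \<Rightarrow> 'a \<Rightarrow> real"
  assumes "finite I" and "finite T" and "card I < card T"
  shows "\<exists>b. (\<exists>y\<in>T. b y \<noteq> 0) \<and> (\<forall>i\<in>I. (\<Sum>y\<in>T. b y * H i y) = 0)"
  using assms
proof (induction I arbitrary: T H rule: finite_induct)
  case empty
  then show ?case by (intro exI[of _ "\<lambda>_. 1"]) (auto simp: card_gt_0_iff)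
next
  case (insert i I T H)
  show ?case
  proof (cases "\<forall>y\<in>T. H i y = 0")
    case True
    have "card I < card T" using insert.prems insert.hyps by simp
    from insert.IH[OF insert.prems(1) this, of H] True show ?thesis by auto
  next
    case False
    \<comment> \<open>Gaussian elimination: z is the pivot of row i, the remaining rows are reduced
      by it, and \<beta> restores row i.\<close>
    then obtain z where z: "z \<in> T" "H i z \<noteq> 0" by blast
    define T' where "T' = T - {z}"
    have T: "finite T'" "card I < card T'" "z \<notin> T'" "T = insert z T'"
      using insert.prems insert.hyps z unfolding T'_def by auto
    obtain b where b: "\<exists>y\<in>T'. b y \<noteq> 0"
      and eq: "\<forall>j\<in>I. (\<Sum>y\<in>T'. b y * (H j y - H j z * H i y / H i z)) = 0"
      using insert.IH[OF T(1,2), of "\<lambda>j y. H j y - H j z * H i y / H i z"] by (elim exE conjE)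
    define \<beta> where "\<beta> = - (\<Sum>y\<in>T'. b y * H i y) / H i z"
    have sum_upd: "(\<Sum>y\<in>T. (b(z := \<beta>)) y * H j y) = \<beta> * H j z + (\<Sum>y\<in>T'. b y * H j y)" for j
      unfolding T(4) using T(1,3) by (auto intro!: sum.cong)
    have "(\<Sum>y\<in>T. (b(z := \<beta>)) y * H j y) = 0" if "j \<in> I" for j
    proof -
      have "0 = (\<Sum>y\<in>T'. b y * (H j y - H j z * H i y / H i z))" using eq that by simp
      also have "\<dots> = (\<Sum>y\<in>T'. b y * H j y) - H j z / H i z * (\<Sum>y\<in>T'. b y * H i y)"
        by (simp add: right_diff_distrib sum_subtractf sum_distrib_left mult_ac)
      finally show ?thesis unfolding sum_upd unfolding \<beta>_def by (simp add: field_simps)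
    qed
    moreover have "(\<Sum>y\<in>T. (b(z := \<beta>)) y * H i y) = 0"
      unfolding sum_upd unfolding \<beta>_def using z by simp
    moreover have "\<exists>y\<in>T. (b(z := \<beta>)) y \<noteq> 0"
    proof -
      obtain y where "y \<in> T'" "b y \<noteq> 0" using b by blast
      then show ?thesis using T(3) unfolding T(4) by (intro bexI[of _ y]) auto
    qed
    ultimately show ?thesis by blast
  qed
qed

text \<open>A step of the simplex method: moving the weights along a kernel vector of the moment matrix,
  in the direction in which the objective \<open>g\<close> does not decrease, until one of them vanishes.\<close>

lemma reduce_support:
  fixes F :: "nat \<Rightarrow> 'a \<Rightarrow> real" and g w :: "'a \<Rightarrow> real"
  assumes T: "finite T" "n + 1 < card T" and w: "\<forall>y\<in>T. 0 < w y" "sum w T = 1"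
  shows "\<exists>T' w'. T' \<subset> T \<and> (\<forall>y\<in>T'. 0 < w' y) \<and> sum w' T' = 1
     \<and> (\<forall>k\<in>{1..n}. (\<Sum>y\<in>T'. w' y * F k y) = (\<Sum>y\<in>T. w y * F k y))
     \<and> (\<Sum>y\<in>T. w y * g y) \<le> (\<Sum>y\<in>T'. w' y * g y)"
proof -
  \<comment> \<open>The free slot 0 carries the constant 1, so that the kernel vector also preserves
    the total mass. These are n + 1 equations for more than n + 1 weights.\<close>
  obtain b0 where b0: "\<exists>y\<in>T. b0 y \<noteq> 0"
    and b0F: "\<forall>k\<in>{0..n}. (\<Sum>y\<in>T. b0 y * (F(0 := \<lambda>_. 1)) k y) = 0"
    using homogeneous_system_nontrivial[of "{0..n}" T "F(0 := \<lambda>_. 1)"] T by auto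
  define \<epsilon> :: real where "\<epsilon> = (if 0 \<le> (\<Sum>y\<in>T. b0 y * g y) then 1 else - 1)"
  define b where "b y = \<epsilon> * b0 y" for y
  have \<epsilon>: "\<epsilon> \<noteq> 0" unfolding \<epsilon>_def by simp
  have bF: "(\<Sum>y\<in>T. b y * F k y) = 0" if "k \<in> {1..n}" for k
    using b0F[rule_format, of k] that unfolding b_def by (simp add: sum_distrib_left[symmetric] mult.assoc)
  have b1: "(\<Sum>y\<in>T. b y) = 0"
    using b0F[rule_format, of 0] unfolding b_def by (simp add: sum_distrib_left[symmetric])
  have bg: "0 \<le> (\<Sum>y\<in>T. b y * g y)"
    unfolding b_def mult.assoc sum_distrib_left[symmetric] \<epsilon>_def by (simp split: if_splits)
  have "\<exists>y\<in>T. b y < 0"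
  proof (rule ccontr)
    assume "\<not> (\<exists>y\<in>T. b y < 0)"
    then have "\<forall>y\<in>T. b y = 0" using b1 T(1) by (subst (asm) sum_nonneg_eq_0_iff) (auto simp: not_less)
    then show False using b0 \<epsilon> unfolding b_def by simp
  qed
  define N where "N = {y\<in>T. b y < 0}"
  \<comment> \<open>The ratio test: the largest step that keeps all weights nonnegative. The
    minimiser z loses its weight.\<close>
  define t where "t = Min ((\<lambda>y. w y / - b y) ` N)"
  have N: "finite N" "N \<noteq> {}" using \<open>\<exists>y\<in>T. b y < 0\<close> T unfolding N_def by auto
  then have "t \<in> (\<lambda>y. w y / - b y) ` N" unfolding t_def by (intro Min_in) auto
  then obtain z where z: "z \<in> N" "t = w z / - b z" by blast
  have t_le: "t \<le> w y / - b y" if "y \<in> N" for y unfolding t_def using N that by (intro Min_le) auto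
  have t0: "0 < t" unfolding z(2) using z(1) w unfolding N_def by (intro divide_pos_pos) auto
  define w' where "w' y = w y + t * b y" for y
  have w': "0 \<le> w' y" if "y \<in> T" for y
  proof (cases "b y < 0")
    case True
    then show ?thesis using t_le[of y] that unfolding N_def w'_def by (simp add: field_simps)
  next
    case False
    then show ?thesis using w that t0 unfolding w'_def by (simp add: add_nonneg_nonneg less_imp_le)
  qed
  define T' where "T' = {y\<in>T. 0 < w' y}"
  have sum_T': "(\<Sum>y\<in>T'. w' y * h y) = (\<Sum>y\<in>T. w y * h y) + t * (\<Sum>y\<in>T. b y * h y)" for h
  proof -
    have "(\<Sum>y\<in>T'. w' y * h y) = (\<Sum>y\<in>T. w' y * h y)"
      using T(1) w' unfolding T'_def by (intro sum.mono_neutral_left) force+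
    then show ?thesis unfolding w'_def by (simp add: sum_distrib_left sum.distrib[symmetric] algebra_simps)
  qed
  have "z \<notin> T'" using z unfolding T'_def w'_def N_def by (simp add: field_simps)
  then have "T' \<subset> T" using z unfolding T'_def N_def by blast
  moreover have "sum w' T' = 1" using sum_T'[of "\<lambda>_. 1"] b1 w by simp
  moreover have "\<forall>k\<in>{1..n}. (\<Sum>y\<in>T'. w' y * F k y) = (\<Sum>y\<in>T. w y * F k y)"
    using bF unfolding sum_T' by simp
  moreover have "(\<Sum>y\<in>T. w y * g y) \<le> (\<Sum>y\<in>T'. w' y * g y)"
    unfolding sum_T' using t0 bg by simp
  ultimately show ?thesis unfolding T'_def by (intro exI[of _ "{y\<in>T. 0 < w' y}"] exI[of _ w']) auto
qed

lemma reduce_support_iterated: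
  fixes F :: "nat \<Rightarrow> 'a \<Rightarrow> real" and g w :: "'a \<Rightarrow> real"
  assumes "finite T" and "\<forall>y\<in>T. 0 < w y" "sum w T = 1"
  shows "\<exists>T' w'. T' \<subseteq> T \<and> card T' \<le> n + 1 \<and> (\<forall>y\<in>T'. 0 < w' y) \<and> sum w' T' = 1
     \<and> (\<forall>k\<in>{1..n}. (\<Sum>y\<in>T'. w' y * F k y) = (\<Sum>y\<in>T. w y * F k y))
     \<and> (\<Sum>y\<in>T. w y * g y) \<le> (\<Sum>y\<in>T'. w' y * g y)"
  using assms
proof (induction T arbitrary: w rule: finite_psubset_induct)
  case (psubset T)
  show ?case
  proof (cases "card T \<le> n + 1")
    case True
    then show ?thesis using psubset.prems by (intro exI[of _ T] exI[of _ w]) auto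
  next
    case False
    then obtain T1 w1 where 1: "T1 \<subset> T" "\<forall>y\<in>T1. 0 < w1 y" "sum w1 T1 = 1"
      "\<forall>k\<in>{1..n}. (\<Sum>y\<in>T1. w1 y * F k y) = (\<Sum>y\<in>T. w y * F k y)"
      "(\<Sum>y\<in>T. w y * g y) \<le> (\<Sum>y\<in>T1. w1 y * g y)"
      using reduce_support[OF psubset.hyps(1) _ psubset.prems, of n F g] by (auto simp: not_le)
    obtain T2 w2 where 2: "T2 \<subseteq> T1" "card T2 \<le> n + 1" "\<forall>y\<in>T2. 0 < w2 y" "sum w2 T2 = 1"
      "\<forall>k\<in>{1..n}. (\<Sum>y\<in>T2. w2 y * F k y) = (\<Sum>y\<in>T1. w1 y * F k y)"
      "(\<Sum>y\<in>T1. w1 y * g y) \<le> (\<Sum>y\<in>T2. w2 y * g y)"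
      using psubset.IH[OF 1(1-3)] by (elim exE conjE)
    show ?thesis using 1 2 by (intro exI[of _ T2] exI[of _ w2]) auto
  qed
qed

text \<open>The function g plays two roles: in the exact representation it occupies slot 0 as one
  more moment, and in the support reduction it is the objective.\<close>

lemma (in prob_space) discrete_moments:
  fixes F :: "nat \<Rightarrow> 'a \<Rightarrow> real" and g :: "'a \<Rightarrow> real"
  assumes S: "AE y in M. y \<in> S" and F: "\<forall>k\<in>{1..n}. integrable M (F k)" and g: "integrable M g"
  shows "\<exists>a y. (\<forall>i\<in>{1..n+1}. 0 \<le> a i \<and> a i \<le> 1 \<and> y i \<in> S) \<and> sum a {1..n+1} = 1
     \<and> (\<forall>k\<in>{1..n}. (\<Sum>i\<in>{1..n+1}. a i * F k (y i)) = integral\<^sup>L M (F k))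
     \<and> integral\<^sup>L M g \<le> (\<Sum>i\<in>{1..n+1}. a i * g (y i))"
proof -
  have "integrable M ((F(0 := g)) k)" if "k \<in> {0..n}" for k
    using F g that by (cases "k = 0") auto
  then obtain T0 w0 where T0: "finite T0" "T0 \<subseteq> S" "\<forall>y\<in>T0. 0 < w0 y" "sum w0 T0 = 1"
    and m0: "\<forall>k\<in>{0..n}. (\<Sum>y\<in>T0. w0 y * (F(0 := g)) k y) = integral\<^sup>L M ((F(0 := g)) k)"
    using finite_moment_representation[OF _ S, of "{0..n}" "F(0 := g)"] by auto
  obtain T w where T: "T \<subseteq> T0" "card T \<le> n + 1" "\<forall>y\<in>T. 0 < w y" "sum w T = 1"
    and mF: "\<forall>k\<in>{1..n}. (\<Sum>y\<in>T. w y * F k y) = (\<Sum>y\<in>T0. w0 y * F k y)"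
    and mg: "(\<Sum>y\<in>T0. w0 y * g y) \<le> (\<Sum>y\<in>T. w y * g y)"
    using reduce_support_iterated[OF T0(1,3,4), of n F g] by (elim exE conjE)
  have fT: "finite T" using T(1) T0(1) by (rule finite_subset)
  have "T \<noteq> {}" using T(4) by auto
  then obtain z where z: "z \<in> T" by blast
  obtain e where e: "bij_betw e {1..card T} T"
    using ex_bij_betw_nat_finite_1[OF fT] by blast
  \<comment> \<open>Spare places get weight 0 and a point z of the support, since every entry of the
    tuple must lie in S.\<close>
  define a where "a i = (if i \<le> card T then w (e i) else 0)" for i
  define y where "y i = (if i \<le> card T then e i else z)" for i
  have sum_eq: "(\<Sum>i\<in>{1..n+1}. a i * h (y i)) = (\<Sum>y\<in>T. w y * h y)" for h :: "'a \<Rightarrow> real"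
  proof -
    have "(\<Sum>i\<in>{1..n+1}. a i * h (y i)) = (\<Sum>i\<in>{1..card T}. w (e i) * h (e i))"
      using T(2) unfolding a_def y_def by (intro sum.mono_neutral_cong_right) auto
    also have "\<dots> = (\<Sum>y\<in>T. w y * h y)" by (rule sum.reindex_bij_betw[OF e])
    finally show ?thesis .
  qed
  have sum_a: "sum a {1..n+1} = 1" using sum_eq[of "\<lambda>_. 1"] T(4) by simp
  have a0: "0 \<le> a i" if "i \<in> {1..n+1}" for i
    using T(3) bij_betwE[OF e] that unfolding a_def by (auto simp: less_imp_le)
  have "a i \<le> 1" if "i \<in> {1..n+1}" for i
    using member_le_sum[of i "{1..n+1}" a] a0 that sum_a by auto
  moreover have "y i \<in> S" if "i \<in> {1..n+1}" for i
  proof -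
    have "y i \<in> T" using bij_betwE[OF e] z that unfolding y_def by auto
    then show ?thesis using T(1) T0(2) by blast
  qed
  moreover have "\<forall>k\<in>{1..n}. (\<Sum>i\<in>{1..n+1}. a i * F k (y i)) = integral\<^sup>L M (F k)"
  proof
    fix k assume k: "k \<in> {1..n}"
    then have "(\<Sum>y\<in>T0. w0 y * F k y) = integral\<^sup>L M (F k)" using m0[rule_format, of k] by simp
    then show "(\<Sum>i\<in>{1..n+1}. a i * F k (y i)) = integral\<^sup>L M (F k)"
      using mF k unfolding sum_eq by simp
  qed
  moreover have "integral\<^sup>L M g \<le> (\<Sum>i\<in>{1..n+1}. a i * g (y i))"
    using m0[rule_format, of 0] mg unfolding sum_eq by simp
  ultimately show ?thesis using a0 sum_a by (intro exI[of _ a] exI[of _ y]) auto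
qed

section \<open>Borel spaces\<close>

text \<open>The property of a target space that the selection theorem consumes. It passes to
  products, so it reaches \<open>tuples\<close> from the factors.\<close>

definition baire_image :: "'a measure \<Rightarrow> bool" where
  "baire_image N \<longleftrightarrow> (\<exists>s\<in>baire \<rightarrow>\<^sub>M N. space N \<subseteq> range s)"

lemma measurable_baire_reindex: "(\<lambda>\<sigma> k. \<sigma> (g k)) \<in> baire \<rightarrow>\<^sub>M baire"
  by (rule measurable_abs_UNIV, rule measurable_component_singleton) simp

lemma baire_image_PiM:
  fixes I :: "nat set"
  assumes "baire_image N"
  shows "baire_image (PiM I (\<lambda>_. N))"
proof -
  obtain s where s: "s \<in> baire \<rightarrow>\<^sub>M N" "space N \<subseteq> range s"
    using assms unfolding baire_image_def by blast
  define S where "S \<sigma> = (\<lambda>i\<in>I. s (\<lambda>k. \<sigma> (prod_encode (i, k))))" for \<sigma>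
  have "S \<in> baire \<rightarrow>\<^sub>M PiM I (\<lambda>_. N)"
    unfolding S_def by (intro measurable_restrict measurable_compose[OF measurable_baire_reindex s(1)])
  moreover have "space (PiM I (\<lambda>_. N)) \<subseteq> range S"
  proof
    fix y assume y: "y \<in> space (PiM I (\<lambda>_. N))"
    then have "\<forall>i. \<exists>\<tau>. i \<in> I \<longrightarrow> y i = s \<tau>" using s(2) by (fastforce simp: space_PiM)
    then obtain t where t: "\<forall>i. i \<in> I \<longrightarrow> y i = s (t i)" by (rule choice[THEN exE])
    define \<sigma> where "\<sigma> m = t (fst (prod_decode m)) (snd (prod_decode m))" for m
    have "y = S \<sigma>"
      using y t unfolding S_def \<sigma>_def by (auto simp: space_PiM PiE_def extensional_def fun_eq_iff)
    then show "y \<in> range S" by blast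
  qed
  ultimately show ?thesis unfolding baire_image_def by blast
qed

lemma baire_image_pair:
  assumes "baire_image N" and "baire_image N'"
  shows "baire_image (N \<Otimes>\<^sub>M N')"
proof -
  obtain s where s: "s \<in> baire \<rightarrow>\<^sub>M N" "space N \<subseteq> range s"
    using assms(1) unfolding baire_image_def by blast
  obtain s' where s': "s' \<in> baire \<rightarrow>\<^sub>M N'" "space N' \<subseteq> range s'"
    using assms(2) unfolding baire_image_def by blast
  define S where "S \<sigma> = (s (\<lambda>k. \<sigma> (2 * k)), s' (\<lambda>k. \<sigma> (2 * k + 1)))" for \<sigma>
  have "S \<in> baire \<rightarrow>\<^sub>M N \<Otimes>\<^sub>M N'"
    unfolding S_def by (intro measurable_Pair measurable_compose[OF measurable_baire_reindex s(1)]
      measurable_compose[OF measurable_baire_reindex s'(1)])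
  moreover have "space (N \<Otimes>\<^sub>M N') \<subseteq> range S"
  proof
    fix p assume "p \<in> space (N \<Otimes>\<^sub>M N')"
    then have "fst p \<in> range s" "snd p \<in> range s'"
      using s(2) s'(2) by (auto simp: space_pair_measure)
    then obtain t t' where t: "p = (s t, s' t')" by (metis imageE prod.collapse)
    have "p = S (\<lambda>m. if even m then t (m div 2) else t' (m div 2))"
      unfolding S_def t by simp
    then show "p \<in> range S" by blast
  qed
  ultimately show ?thesis unfolding baire_image_def by blast
qed

text \<open>A sequence of indices is decoded as the limit of the corresponding points of a countable
  dense set; density and completeness make this a map onto the space.\<close>

lemma baire_image_polish: "baire_image (borel :: 'q::polish_space measure)"
proof -
  obtain D :: "'q set" where D: "countable D" "\<And>X. open X \<Longrightarrow> X \<noteq> {} \<Longrightarrow> \<exists>d\<in>D. d \<in> X"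
    using countable_dense_exists by blast
  have ne: "D \<noteq> {}" using D(2)[of UNIV] by auto
  define d where "d = from_nat_into D"
  have d: "\<exists>m. d m \<in> X" if "open X" "X \<noteq> {}" for X
    using D(2)[OF that] from_nat_into_surj[OF D(1)] unfolding d_def by metis
  \<comment> \<open>Sequences that are not Cauchy are replaced by a constant one, so that the limit
    exists everywhere and is measurable as a pointwise limit.\<close>
  define u where "u m \<sigma> = (if Cauchy (\<lambda>k. d (\<sigma> k)) then d (\<sigma> m) else d 0)" for m and \<sigma> :: "nat \<Rightarrow> nat"
  have dm: "(\<lambda>\<sigma>. d (\<sigma> m)) \<in> baire \<rightarrow>\<^sub>M borel" for m
    by (rule measurable_compose[of _ _ "count_space UNIV"]) (auto intro!: measurable_component_singleton)
  have u: "u m \<in> baire \<rightarrow>\<^sub>M borel" for m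
    unfolding u_def using dm by measurable
  define L where "L \<sigma> = lim (\<lambda>m. u m \<sigma>)" for \<sigma>
  have conv: "(\<lambda>m. u m \<sigma>) \<longlonglongrightarrow> L \<sigma>" for \<sigma>
  proof -
    have "Cauchy (\<lambda>m. u m \<sigma>)"
      unfolding u_def
      by (cases "Cauchy (\<lambda>k. d (\<sigma> k))") (simp_all add: convergent_Cauchy convergent_const)
    then show ?thesis unfolding L_def by (simp add: Cauchy_convergent_iff convergent_LIMSEQ_iff)
  qed
  have "L \<in> baire \<rightarrow>\<^sub>M borel"
    by (rule borel_measurable_LIMSEQ_metric[OF u conv])
  moreover have "UNIV \<subseteq> range L"
  proof
    fix y :: 'q
    have "\<forall>m. \<exists>k. d k \<in> ball y (1 / real (Suc m))" by (intro allI d) auto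
    then obtain \<sigma> where \<sigma>: "\<forall>m. d (\<sigma> m) \<in> ball y (1 / real (Suc m))" by (rule choice[THEN exE])
    have "(\<lambda>m. d (\<sigma> m)) \<longlonglongrightarrow> y"
      using \<sigma> by (intro metric_tendsto_imp_tendsto[OF LIMSEQ_inverse_real_of_nat])
        (auto simp: dist_commute inverse_eq_divide less_imp_le)
    moreover then have "u m \<sigma> = d (\<sigma> m)" for m
      unfolding u_def by (auto dest: LIMSEQ_imp_Cauchy)
    ultimately have "(\<lambda>m. u m \<sigma>) \<longlonglongrightarrow> y" by simp
    then have "L \<sigma> = y" using conv by (rule LIMSEQ_unique[rotated])
    then show "y \<in> range L" by blast
  qed
  ultimately show ?thesis unfolding baire_image_def by auto
qed

lemma baire_image_Borel_space:
  assumes "is_Borel_space TYPE('a::topological_space) TYPE('p::polish_space)"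
  shows "baire_image (borel :: 'a measure)"
proof -
  obtain B :: "'p set" and g h where B: "B \<in> sets borel" and gh: "homeomorphism (UNIV :: 'a set) B g h"
    using assms unfolding is_Borel_space_def homeomorphic_def by blast
  obtain s :: "_ \<Rightarrow> 'p" where s: "s \<in> baire \<rightarrow>\<^sub>M borel" "UNIV \<subseteq> range s"
    using baire_image_polish unfolding baire_image_def by auto
  \<comment> \<open>As B is Borel, h extends to a Borel map on the whole Polish space by a constant
    off B.\<close>
  define r where "r z = (if z \<in> B then h z else h (g undefined))" for z
  have "h \<in> restrict_space borel B \<rightarrow>\<^sub>M borel"
    using gh by (intro borel_measurable_continuous_on_restrict) (simp add: homeomorphism_def)
  then have "r \<in> borel \<rightarrow>\<^sub>M borel"
    using B unfolding r_def by (intro measurable_If_restrict_space_iff[THEN iffD2]) auto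
  then have "(\<lambda>\<sigma>. r (s \<sigma>)) \<in> baire \<rightarrow>\<^sub>M borel" using s(1) by (rule measurable_compose[rotated])
  moreover have "UNIV \<subseteq> range (\<lambda>\<sigma>. r (s \<sigma>))"
  proof
    fix y :: 'a
    obtain \<sigma> where "g y = s \<sigma>" using s(2) by blast
    moreover have "g y \<in> B" "h (g y) = y" using gh unfolding homeomorphism_def by auto
    ultimately have "r (s \<sigma>) = y" unfolding r_def by simp
    then show "y \<in> range (\<lambda>\<sigma>. r (s \<sigma>))" by blast
  qed
  ultimately show ?thesis unfolding baire_image_def by auto
qed

section \<open>Borel sets of products of Borel spaces\<close>

lemma Borel_space_countable_base:
  assumes "is_Borel_space TYPE('a::topological_space) TYPE('p::polish_space)"
  shows "\<exists>\<B> :: 'a set set. countable \<B> \<and> (\<forall>b\<in>\<B>. open b) \<and> (\<forall>U x. open U \<longrightarrow> x \<in> U \<longrightarrow> (\<exists>b\<in>\<B>. x \<in> b \<and> b \<subseteq> U))"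
proof -
  obtain B :: "'p set" and g h where gh: "homeomorphism (UNIV :: 'a set) B g h"
    using assms unfolding is_Borel_space_def homeomorphic_def by blast
  then have g: "continuous_on UNIV g" "\<And>x. g x \<in> B" and h: "continuous_on B h" and hg: "\<And>x. h (g x) = x"
    unfolding homeomorphism_def by auto
  obtain \<G> :: "'p set set" where G: "countable \<G>" "topological_basis \<G>"
    using ex_countable_basis by blast
  have "\<exists>b\<in>(\<lambda>b. g -` b) ` \<G>. x \<in> b \<and> b \<subseteq> U" if U: "open U" "x \<in> U" for U x
  proof -
    obtain W where W: "open W" "W \<inter> B = h -` U \<inter> B"
      using h U(1) unfolding continuous_on_open_invariant by blast
    have W_iff: "g z \<in> W \<longleftrightarrow> z \<in> U" for z
    proof -
      have "g z \<in> W \<inter> B \<longleftrightarrow> g z \<in> h -` U \<inter> B" unfolding W(2) ..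
      then show ?thesis using g(2)[of z] hg[of z] by simp
    qed
    have "g x \<in> W" using U(2) W_iff by blast
    then obtain b where "b \<in> \<G>" "g x \<in> b" "b \<subseteq> W" using topological_basisE[OF G(2) W(1)] by blast
    moreover have "g -` W \<subseteq> U" using W_iff by blast
    ultimately show ?thesis by blast
  qed
  moreover have "open (g -` b)" if "b \<in> \<G>" for b
    using g(1) topological_basis_open[OF G(2) that] by (simp add: continuous_on_open_vimage)
  ultimately show ?thesis using G(1) by (intro exI[of _ "(\<lambda>b. g -` b) ` \<G>"]) auto
qed

text \<open>By second countability an open set of the product is a countable union of basic open
  rectangles.\<close>

lemma sets_borel_pair_Borel_space:
  assumes "is_Borel_space TYPE('a::topological_space) TYPE('p::polish_space)"
    and "is_Borel_space TYPE('b::topological_space) TYPE('q::polish_space)"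
  shows "sets (borel :: ('a \<times> 'b) measure) \<subseteq> sets (borel \<Otimes>\<^sub>M borel)"
proof -
  from Borel_space_countable_base[OF assms(1)] obtain \<A> :: "'a set set"
    where A: "countable \<A>" "\<forall>b\<in>\<A>. open b"
      and baseA: "\<forall>U x. open U \<longrightarrow> x \<in> U \<longrightarrow> (\<exists>b\<in>\<A>. x \<in> b \<and> b \<subseteq> U)"
    by (elim exE conjE)
  from Borel_space_countable_base[OF assms(2)] obtain \<B> :: "'b set set"
    where B: "countable \<B>" "\<forall>b\<in>\<B>. open b"
      and baseB: "\<forall>U x. open U \<longrightarrow> x \<in> U \<longrightarrow> (\<exists>b\<in>\<B>. x \<in> b \<and> b \<subseteq> U)"
    by (elim exE conjE)
  have "W \<in> sets (borel \<Otimes>\<^sub>M borel)" if W: "open W" for W :: "('a \<times> 'b) set"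
  proof -
    define R where "R = {p \<in> \<A> \<times> \<B>. fst p \<times> snd p \<subseteq> W}"
    have "countable R" unfolding R_def using A(1) B(1) by (intro countable_Collect countable_SIGMA)
    have eq: "W = (\<Union>p\<in>R. fst p \<times> snd p)"
    proof (intro equalityI subsetI)
      fix z assume z: "z \<in> W"
      obtain U V where UV: "open U" "open V" "z \<in> U \<times> V" "U \<times> V \<subseteq> W"
        using W[unfolded open_prod_def, rule_format, OF z] by (elim exE conjE)
      then have "fst z \<in> U" "snd z \<in> V" by (simp_all add: mem_Times_iff)
      obtain a where "a \<in> \<A>" "fst z \<in> a" "a \<subseteq> U"
        using baseA[rule_format, OF UV(1) \<open>fst z \<in> U\<close>] by blast
      moreover obtain b where "b \<in> \<B>" "snd z \<in> b" "b \<subseteq> V"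
        using baseB[rule_format, OF UV(2) \<open>snd z \<in> V\<close>] by blast
      ultimately have "(a, b) \<in> R" "z \<in> a \<times> b" using UV(4) unfolding R_def by (auto simp: mem_Times_iff)
      then show "z \<in> (\<Union>p\<in>R. fst p \<times> snd p)" by force
    qed (auto simp: R_def)
    have "fst p \<times> snd p \<in> sets (borel \<Otimes>\<^sub>M borel)" if "p \<in> R" for p
      using that A(2) B(2) unfolding R_def by (intro pair_measureI) auto
    then show ?thesis unfolding eq using \<open>countable R\<close> by (intro sets.countable_UN') auto
  qed
  then have "sigma_sets (space (borel \<Otimes>\<^sub>M borel)) {W :: ('a \<times> 'b) set. open W} \<subseteq> sets (borel \<Otimes>\<^sub>M borel)"
    by (intro sets.sigma_sets_subset) auto
  then show ?thesis by (simp add: sets_borel space_pair_measure)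
qed

lemma measurable_borel_pair_Borel_space:
  assumes "is_Borel_space TYPE('a::topological_space) TYPE('p::polish_space)"
    and "is_Borel_space TYPE('b::topological_space) TYPE('q::polish_space)"
    and "f \<in> (borel :: ('a \<times> 'b) measure) \<rightarrow>\<^sub>M N"
  shows "f \<in> (borel :: 'a measure) \<Otimes>\<^sub>M (borel :: 'b measure) \<rightarrow>\<^sub>M N"
proof (rule measurableI)
  fix A assume "A \<in> sets N"
  then have "f -` A \<inter> space borel \<in> sets borel" using assms(3) by (rule measurable_sets[rotated])
  then show "f -` A \<inter> space (borel \<Otimes>\<^sub>M borel) \<in> sets (borel \<Otimes>\<^sub>M borel)"
    using sets_borel_pair_Borel_space[OF assms(1,2)] by (auto simp: space_pair_measure)
qed (use measurable_space[OF assms(3)] in simp)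

section \<open>Integrals of extended real functions\<close>

text \<open>Positive and negative parts are kept apart, which reduces the convention
  \<open>\<infinity> - \<infinity> = -\<infinity>\<close> to arithmetic of \<^typ>\<open>ennreal\<close>.\<close>

definition ediff :: "ennreal \<Rightarrow> ennreal \<Rightarrow> ereal" where
  "ediff a b = enn2ereal a \<ominus>\<^sub>l enn2ereal b"

lemma eint_eq_ediff:
  "eint M g = ediff (\<integral>\<^sup>+ x. e2ennreal (g x) \<partial>M) (\<integral>\<^sup>+ x. e2ennreal (- g x) \<partial>M)"
  unfolding eint_def ediff_def ..

lemma ediff_top [simp]: "ediff a \<top> = - \<infinity>"
  unfolding ediff_def ereal_lminus_def by simp

lemma ediff_eq_MInf_iff: "ediff a b = - \<infinity> \<longleftrightarrow> b = \<top>"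
  by (cases a; cases b) (auto simp: ediff_def ereal_lminus_def)

lemma ediff_ennreal:
  "0 \<le> a \<Longrightarrow> 0 \<le> b \<Longrightarrow> ediff (ennreal a) (ennreal b) = ereal (a - b)"
  unfolding ediff_def ereal_lminus_def by simp

lemma ediff_finite: "a < \<top> \<Longrightarrow> b < \<top> \<Longrightarrow> ediff a b = ereal (enn2real a - enn2real b)"
  by (cases a; cases b) (auto simp: ediff_ennreal)

lemma ediff_top_left: "b < \<top> \<Longrightarrow> ediff \<top> b = \<infinity>"
  by (cases b) (auto simp: ediff_def ereal_lminus_def)

lemma ediff_parts [simp]: "ediff (e2ennreal z) (e2ennreal (- z)) = z"
proof (cases z)
  case (real r)
  then show ?thesis
    by (cases "0 \<le> r") (auto simp: ediff_def ereal_lminus_def ennreal_neg zero_ennreal.rep_eq)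
qed (auto simp: ediff_def ereal_lminus_def e2ennreal_neg)

text \<open>Cross-addition. With d finite the equivalence survives infinite a, b and c, and its
  right-hand side, an inequality in \<open>ennreal\<close>, can be integrated term by term.\<close>

lemma ediff_le_iff:
  assumes "d < \<top>"
  shows "ediff a b \<le> ediff c d \<longleftrightarrow> a + d \<le> c + b"
proof (cases "b = \<top> \<or> a = \<top> \<or> c = \<top>")
  case True
  then show ?thesis
    using assms by (cases a; cases b; cases c; cases d) (auto simp: ediff_top_left ediff_ennreal ennreal_plus[symmetric] top_unique simp del: ennreal_plus)
next
  case False
  then show ?thesis
    using assms by (cases a; cases b; cases c; cases d)
      (auto simp: ediff_ennreal ennreal_plus[symmetric] simp del: ennreal_plus)
qed

lemma ediff_mono:
  assumes "a \<le> c" "d \<le> b"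
  shows "ediff a b \<le> ediff c d"
proof (cases "d = \<top>")
  case False
  then show ?thesis using assms by (subst ediff_le_iff) (auto simp: less_top add_mono)
qed (use assms in \<open>simp add: top_unique\<close>)

text \<open>Under this convention a nonnegative cost joins the negative part, even when cost and
  positive part are both infinite.\<close>

lemma ediff_lminus: "ediff a b \<ominus>\<^sub>l enn2ereal c = ediff a (b + c)"
proof (cases "b = \<top> \<or> c = \<top>")
  case False
  then show ?thesis
    by (cases a; cases b; cases c)
      (auto simp: ediff_top_left ediff_ennreal ennreal_plus[symmetric] ereal_lminus_def simp del: ennreal_plus)
qed (auto simp: ereal_lminus_def)

lemma ereal_mult_ediff:
  assumes "0 \<le> a"
  shows "ereal a * ediff p q = ediff (ennreal a * p) (ennreal a * q)"
proof (cases "a = 0")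
  case True
  then show ?thesis by (simp add: ediff_def ereal_lminus_def)
next
  case False
  then have a: "0 < a" using assms by simp
  show ?thesis
    by (cases p; cases q)
      (use a in \<open>auto simp: ediff_top_left ediff_ennreal ennreal_mult[symmetric] ennreal_mult_top ennreal_mult_less_top right_diff_distrib\<close>)
qed

text \<open>A single infinite negative part drives both sides to -\<infinity>; otherwise no summand
  is -\<infinity> and the ordinary sum splits into its parts.\<close>

lemma ereal_lsum_ediff:
  assumes "finite I"
  shows "ereal_lsum (\<lambda>i. ediff (p i) (q i)) I = ediff (sum p I) (sum q I)"
proof (cases "\<exists>i\<in>I. q i = \<top>")
  case True
  then have "sum q I = \<top>" using assms by simp
  then show ?thesis using True unfolding ereal_lsum_def by (auto simp: ediff_eq_MInf_iff)
next
  case False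
  have "(\<Sum>i\<in>I. ediff (p i) (q i)) = ediff (sum p I) (sum q I)"
    using assms False
  proof (induction I rule: finite_induct)
    case empty
    then show ?case by (simp add: ediff_def ereal_lminus_def)
  next
    case (insert i I)
    have "sum q I < \<top>" "q i < \<top>" using insert by (auto simp: less_top)
    then have "ediff (p i) (q i) + ediff (sum p I) (sum q I) = ediff (p i + sum p I) (q i + sum q I)"
      by (cases "p i"; cases "q i"; cases "sum p I"; cases "sum q I")
        (auto simp: ediff_top_left ediff_ennreal ennreal_plus[symmetric] simp del: ennreal_plus)
    then show ?case using insert by simp
  qed
  then show ?thesis using False unfolding ereal_lsum_def by (auto simp: ediff_eq_MInf_iff)
qed

lemma ereal_lsum_cong:
  assumes "\<And>i. i \<in> I \<Longrightarrow> g i = h i"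
  shows "ereal_lsum g I = ereal_lsum h I"
  using sum.cong[OF refl, of I g h] assms unfolding ereal_lsum_def by auto

lemma borel_measurable_ediff [measurable]:
  assumes [measurable]: "f \<in> borel_measurable M" "g \<in> borel_measurable M"
  shows "(\<lambda>x. ediff (f x) (g x)) \<in> borel_measurable M"
  unfolding ediff_def ereal_lminus_def by measurable

text \<open>The pointwise inequality is cross-added, integrated and turned back; finiteness of the
  integral of d justifies both conversions.\<close>

lemma ediff_nn_integral_mono:
  assumes [measurable]: "a \<in> borel_measurable M" "b \<in> borel_measurable M" "c \<in> borel_measurable M" "d \<in> borel_measurable M"
    and le: "AE x in M. ediff (a x) (b x) \<le> ediff (c x) (d x)"
    and fin: "(\<integral>\<^sup>+ x. d x \<partial>M) < \<top>"
  shows "ediff (\<integral>\<^sup>+ x. a x \<partial>M) (\<integral>\<^sup>+ x. b x \<partial>M) \<le> ediff (\<integral>\<^sup>+ x. c x \<partial>M) (\<integral>\<^sup>+ x. d x \<partial>M)"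
proof -
  have "AE x in M. d x \<noteq> \<top>" using nn_integral_PInf_AE[of d M] fin by (simp add: less_top)
  with le have "AE x in M. a x + d x \<le> c x + b x"
    by eventually_elim (auto simp: ediff_le_iff less_top)
  then have "(\<integral>\<^sup>+ x. a x + d x \<partial>M) \<le> (\<integral>\<^sup>+ x. c x + b x \<partial>M)" by (rule nn_integral_mono_AE)
  then show ?thesis using fin by (simp add: nn_integral_add ediff_le_iff)
qed

lemma eint_mono_AE:
  assumes "AE x in M. f x \<le> g x"
  shows "eint M f \<le> eint M g"
  unfolding eint_eq_ediff using assms
  by (intro ediff_mono nn_integral_mono_AE) (auto elim!: eventually_mono intro: e2ennreal_mono)

lemma eint_ereal:
  assumes "integrable M h"
  shows "eint M (\<lambda>x. ereal (h x)) = ereal (integral\<^sup>L M h)"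
proof -
  have "(\<integral>\<^sup>+ x. ennreal (h x) \<partial>M) < \<top>" "(\<integral>\<^sup>+ x. ennreal (- h x) \<partial>M) < \<top>"
    using integrableD(2,3)[OF assms] by (auto simp: less_top)
  then show ?thesis unfolding eint_eq_ediff by (simp add: ediff_finite real_lebesgue_integral_def[OF assms])
qed

section \<open>Discrete measures and moment constraints\<close>

text \<open>As the image of a weighted counting measure, the combination inherits integration and
  push-forward rules.\<close>

lemma dirac_comb_eq_distr:
  fixes y :: "nat \<Rightarrow> 'y::topological_space"
  assumes "finite I"
  shows "dirac_comb I a y = distr (point_measure I (\<lambda>i. ennreal (a i))) borel y" (is "_ = ?D")
proof -
  have "emeasure ?D B = (\<Sum>i\<in>I. ennreal (a i) * emeasure (return borel (y i)) B)" if B: "B \<in> sets borel" for B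
  proof -
    have "y \<in> point_measure I (\<lambda>i. ennreal (a i)) \<rightarrow>\<^sub>M borel"
      by (simp add: measurable_point_measure_eq1)
    then have "emeasure ?D B = (\<Sum>i\<in>y -` B \<inter> I. ennreal (a i))"
      using B assms by (simp add: emeasure_distr space_point_measure emeasure_point_measure_finite)
    also have "\<dots> = (\<Sum>i\<in>I. ennreal (a i) * emeasure (return borel (y i)) B)"
      using assms B by (intro sum.mono_neutral_cong_left) (auto simp: indicator_def split: if_splits)
    finally show ?thesis .
  qed
  moreover have "sigma_sets UNIV (sets borel) = sets (borel :: 'y measure)"
    using sets.sigma_sets_eq[of "borel :: 'y measure"] by simp
  ultimately have "dirac_comb I a y = measure_of UNIV (sets borel) (emeasure ?D)"
    unfolding dirac_comb_def by (intro measure_of_eq) auto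
  also have "\<dots> = ?D" using measure_of_of_measure[of ?D] by simp
  finally show ?thesis .
qed

lemma sets_dirac_comb [simp, measurable_cong]: "finite I \<Longrightarrow> sets (dirac_comb I a y) = sets borel"
  by (simp add: dirac_comb_eq_distr)

lemma dirac_comb_cong:
  assumes "\<And>i. i \<in> I \<Longrightarrow> a i = a' i \<and> y i = y' i"
  shows "dirac_comb I a y = dirac_comb I a' y'"
  unfolding dirac_comb_def using assms by (simp cong: sum.cong)

lemma nn_integral_dirac_comb:
  assumes "finite I" and "h \<in> borel_measurable borel"
  shows "(\<integral>\<^sup>+ z. h z \<partial>dirac_comb I a y) = (\<Sum>i\<in>I. ennreal (a i) * h (y i))"
  using assms
  by (simp add: dirac_comb_eq_distr nn_integral_distr measurable_point_measure_eq1
      nn_integral_point_measure_finite)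

lemma dirac_comb_prob_iff:
  assumes "finite I"
  shows "dirac_comb I a y \<in> prob_measures \<longleftrightarrow> (\<Sum>i\<in>I. ennreal (a i)) = 1"
proof -
  have "emeasure (dirac_comb I a y) (space (dirac_comb I a y)) = (\<Sum>i\<in>I. ennreal (a i))"
    using nn_integral_dirac_comb[OF assms, of "\<lambda>_. 1" a y] by simp
  then show ?thesis
    using assms by (auto simp: space_prob_algebra intro: prob_spaceI dest: prob_space.emeasure_space_1)
qed

lemma distr_dirac_comb:
  assumes "finite I" and "T \<in> borel \<rightarrow>\<^sub>M borel"
  shows "distr (dirac_comb I a y) borel T = dirac_comb I a (\<lambda>i. T (y i))"
  using assms by (simp add: dirac_comb_eq_distr distr_distr measurable_point_measure_eq1 comp_def)

lemma eint_dirac_comb: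
  assumes "finite I" and [measurable]: "g \<in> borel_measurable borel"
  shows "eint (dirac_comb I a y) g =
    ediff (\<Sum>i\<in>I. ennreal (a i) * e2ennreal (g (y i))) (\<Sum>i\<in>I. ennreal (a i) * e2ennreal (- g (y i)))"
  unfolding eint_eq_ediff by (simp add: nn_integral_dirac_comb assms(1))

lemma pred_moment_set:
  assumes k: "k \<in> M \<rightarrow>\<^sub>M prob_algebra borel"
    and fs: "\<And>i. i \<in> {1..n} \<Longrightarrow> fs i \<in> borel_measurable borel"
  shows "Measurable.pred M (\<lambda>x. k x \<in> moment_set n fs cs)"
proof -
  have nn: "(\<lambda>x. \<integral>\<^sup>+ y. h y \<partial>k x) \<in> borel_measurable M" if "h \<in> borel_measurable borel" for h
    using measurable_compose[OF measurable_prob_algebraD[OF k] nn_integral_measurable_subprob_algebra[OF that]] .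
  have "Measurable.pred M (\<lambda>x. \<forall>i\<in>{1..n}. (\<integral>\<^sup>+ y. e2ennreal \<bar>fs i y\<bar> \<partial>k x) < \<infinity> \<and>
      ediff (\<integral>\<^sup>+ y. e2ennreal (fs i y) \<partial>k x) (\<integral>\<^sup>+ y. e2ennreal (- fs i y) \<partial>k x) \<le> ereal (cs i))"
  proof (intro pred_intros_finite(3) pred_intros_logic(3))
    fix i assume "i \<in> {1..n}"
    note [measurable] = fs[OF this]
    note [measurable] = nn[of "\<lambda>y. e2ennreal \<bar>fs i y\<bar>"] nn[of "\<lambda>y. e2ennreal (fs i y)"] nn[of "\<lambda>y. e2ennreal (- fs i y)"]
    show "Measurable.pred M (\<lambda>x. (\<integral>\<^sup>+ y. e2ennreal \<bar>fs i y\<bar> \<partial>k x) < \<infinity>)" by measurable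
    show "Measurable.pred M (\<lambda>x. ediff (\<integral>\<^sup>+ y. e2ennreal (fs i y) \<partial>k x) (\<integral>\<^sup>+ y. e2ennreal (- fs i y) \<partial>k x) \<le> ereal (cs i))"
      by measurable
  qed simp
  moreover have "k x \<in> prob_measures" if "x \<in> space M" for x using measurable_space[OF k that] .
  ultimately show ?thesis
    unfolding moment_set_def eint_eq_ediff by (simp cong: measurable_cong)
qed

abbreviation tuples :: "nat \<Rightarrow> ((nat \<Rightarrow> real) \<times> (nat \<Rightarrow> 'y::topological_space)) measure" where
  "tuples n \<equiv> PiM {1..n+1} (\<lambda>_. borel) \<Otimes>\<^sub>M PiM {1..n+1} (\<lambda>_. borel)"

lemma mem_Theta_iff:
  "(a, y) \<in> Theta n \<M> \<longleftrightarrow> (a, y) \<in> space (tuples n) \<and> (\<forall>i\<in>{1..n+1}. 0 \<le> a i \<and> a i \<le> 1)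
     \<and> dirac_comb {1..n+1} a y \<in> \<M>"
  unfolding Theta_def by (auto simp: space_pair_measure space_PiM PiE_iff)

lemma measurable_component_fst:
  "i \<in> {1..n+1} \<Longrightarrow> (\<lambda>\<theta>. fst \<theta> i) \<in> tuples n \<rightarrow>\<^sub>M borel"
  by (rule measurable_compose[OF measurable_fst measurable_component_singleton])

lemma measurable_component_snd:
  "i \<in> {1..n+1} \<Longrightarrow> (\<lambda>\<theta>. snd \<theta> i) \<in> tuples n \<rightarrow>\<^sub>M borel"
  by (rule measurable_compose[OF measurable_snd measurable_component_singleton])

lemma dirac_comb_kernel:
  fixes y :: "'a \<Rightarrow> nat \<Rightarrow> 'y::topological_space"
  assumes a: "\<And>i. i \<in> I \<Longrightarrow> (\<lambda>x. a x i) \<in> borel_measurable M"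
    and y: "\<And>i. i \<in> I \<Longrightarrow> (\<lambda>x. y x i) \<in> M \<rightarrow>\<^sub>M borel"
    and I: "finite I" and sum: "\<And>x. x \<in> space M \<Longrightarrow> (\<Sum>i\<in>I. ennreal (a x i)) = 1"
  shows "(\<lambda>x. dirac_comb I (a x) (y x)) \<in> M \<rightarrow>\<^sub>M prob_algebra borel"
proof (rule measurable_prob_algebraI)
  have P: "dirac_comb I (a x) (y x) \<in> prob_measures" if "x \<in> space M" for x
    using sum[OF that] I by (simp add: dirac_comb_prob_iff)
  then show "prob_space (dirac_comb I (a x) (y x))" if "x \<in> space M" for x
    using that by (simp add: space_prob_algebra)
  show "(\<lambda>x. dirac_comb I (a x) (y x)) \<in> M \<rightarrow>\<^sub>M subprob_algebra borel"
  proof (rule measurable_subprob_algebra)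
    show "subprob_space (dirac_comb I (a x) (y x))" if "x \<in> space M" for x
      using P[OF that] by (simp add: space_prob_algebra prob_space_imp_subprob_space)
    fix B :: "'y set" assume [measurable]: "B \<in> sets borel"
    have "emeasure (dirac_comb I (a x) (y x)) B = (\<Sum>i\<in>I. ennreal (a x i) * indicator B (y x i))" for x
      using nn_integral_dirac_comb[OF I, of "indicator B" "a x" "y x"] I by simp
    moreover have "(\<lambda>x. \<Sum>i\<in>I. ennreal (a x i) * indicator B (y x i)) \<in> borel_measurable M"
    proof (rule borel_measurable_sum)
      fix i assume i: "i \<in> I"
      note [measurable] = a[OF i] y[OF i]
      show "(\<lambda>x. ennreal (a x i) * indicator B (y x i) :: ennreal) \<in> borel_measurable M" by measurable
    qed
    ultimately show "(\<lambda>x. emeasure (dirac_comb I (a x) (y x)) B) \<in> borel_measurable M" by simp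
  qed (use I in simp)
qed

lemma sets_Theta:
  fixes fs :: "nat \<Rightarrow> 'y::topological_space \<Rightarrow> ereal"
  assumes fs: "\<And>i. i \<in> {1..n} \<Longrightarrow> fs i \<in> borel_measurable borel"
  shows "Theta n (moment_set n fs cs) \<in> sets (tuples n)"
proof -
  \<comment> \<open>The combination is a probability kernel only where the weights sum to 1.
    \<open>Theta\<close> lies inside this set S, so its measurability is checked on the restricted
    space.\<close>
  define S :: "((nat \<Rightarrow> real) \<times> (nat \<Rightarrow> 'y)) set"
    where "S = {\<theta>\<in>space (tuples n). (\<forall>i\<in>{1..n+1}. 0 \<le> fst \<theta> i \<and> fst \<theta> i \<le> 1) \<and> (\<Sum>i\<in>{1..n+1}. ennreal (fst \<theta> i)) = 1}"
  note [measurable] = measurable_component_fst measurable_component_snd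
  have S[measurable]: "S \<in> sets (tuples n)" unfolding S_def by measurable
  have [measurable]: "(\<lambda>\<theta>. dirac_comb {1..n+1} (fst \<theta>) (snd \<theta>)) \<in> restrict_space (tuples n) S \<rightarrow>\<^sub>M prob_algebra borel"
    by (intro dirac_comb_kernel measurable_restrict_space1 measurable_component_fst measurable_component_snd)
      (auto simp: S_def space_restrict_space)
  have "{\<theta> \<in> space (restrict_space (tuples n) S). dirac_comb {1..n+1} (fst \<theta>) (snd \<theta>) \<in> moment_set n fs cs}
      \<in> sets (restrict_space (tuples n) S)"
    using pred_moment_set[of "\<lambda>\<theta>. dirac_comb {1..n+1} (fst \<theta>) (snd \<theta>)", OF _ fs] by measurable
  moreover have "{\<theta> \<in> space (restrict_space (tuples n) S). dirac_comb {1..n+1} (fst \<theta>) (snd \<theta>) \<in> moment_set n fs cs}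
      = Theta n (moment_set n fs cs)"
  proof -
    have "(\<Sum>i\<in>{1..n+1}. ennreal (a i)) = 1" if "dirac_comb {1..n+1} a y \<in> moment_set n fs cs" for a and y :: "nat \<Rightarrow> 'y"
      using that dirac_comb_prob_iff[of "{1..n+1}" a y] unfolding moment_set_def by auto
    then show ?thesis
      unfolding S_def space_restrict_space by (auto simp: mem_Theta_iff simp del: One_nat_def)
  qed
  ultimately show ?thesis using S by (simp add: sets_restrict_space_iff)
qed

text \<open>All conventions about infinite values are absorbed here; nonnegativity of the weights
  lets each factor move into both parts.\<close>

lemma comb_value_eq_ediff:
  assumes "\<And>i. i \<in> {1..n+1} \<Longrightarrow> 0 \<le> a i"
  shows "comb_value n \<tau> c f x (a, y) =
    ediff (\<Sum>i\<in>{1..n+1}. ennreal (a i) * e2ennreal (f (\<tau> x (y i))))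
      (\<Sum>i\<in>{1..n+1}. ennreal (a i) * (e2ennreal (- f (\<tau> x (y i))) + c (x, \<tau> x (y i))))"
proof -
  have "z \<ominus>\<^sub>l enn2ereal r = ediff (e2ennreal z) (e2ennreal (- z) + r)" for z r
    using ediff_lminus[of "e2ennreal z" "e2ennreal (- z)" r] by simp
  then have "comb_value n \<tau> c f x (a, y) = ereal_lsum (\<lambda>i. ediff (ennreal (a i) * e2ennreal (f (\<tau> x (y i))))
      (ennreal (a i) * (e2ennreal (- f (\<tau> x (y i))) + c (x, \<tau> x (y i))))) {1..n+1}"
    unfolding comb_value_def prod.case using assms by (intro ereal_lsum_cong) (simp only: ereal_mult_ediff)
  then show ?thesis by (simp add: ereal_lsum_ediff)
qed

lemma integrable_enn2real:
  assumes [measurable]: "q \<in> borel_measurable M" and fin: "(\<integral>\<^sup>+ x. q x \<partial>M) < \<top>"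
  shows "integrable M (\<lambda>x. enn2real (q x))"
    and "(\<integral> x. enn2real (q x) \<partial>M) = enn2real (\<integral>\<^sup>+ x. q x \<partial>M)"
proof -
  have "AE x in M. q x \<noteq> \<top>" using nn_integral_PInf_AE[of q M] fin by (simp add: less_top)
  then have "AE x in M. ennreal (enn2real (q x)) = q x" by eventually_elim (simp add: less_top)
  then have eq: "(\<integral>\<^sup>+ x. ennreal (enn2real (q x)) \<partial>M) = (\<integral>\<^sup>+ x. q x \<partial>M)" by (rule nn_integral_cong_AE)
  show "integrable M (\<lambda>x. enn2real (q x))"
    using eq fin by (intro integrableI_bounded) auto
  show "(\<integral> x. enn2real (q x) \<partial>M) = enn2real (\<integral>\<^sup>+ x. q x \<partial>M)"
    using eq by (subst integral_eq_nn_integral) auto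
qed

text \<open>Finite B rules out s = -\<infinity>; cross-addition then reduces the claim to the
  continuity of addition along suprema.\<close>

lemma ediff_SUP_le:
  assumes "\<And>N :: nat. ediff (u N) B \<le> s" and B: "B < \<top>"
  shows "ediff (SUP N. u N) B \<le> s"
proof -
  have "s \<noteq> - \<infinity>" using assms(1)[of 0] B ediff_eq_MInf_iff[of "u 0" B] by auto
  then have fin: "e2ennreal (- s) < \<top>" by (cases s) (auto simp: e2ennreal_neg)
  have iff: "ediff w B \<le> s \<longleftrightarrow> w + e2ennreal (- s) \<le> e2ennreal s + B" for w
    using ediff_le_iff[OF fin, of w B "e2ennreal s"] by simp
  have "(SUP N. u N) + e2ennreal (- s) = (SUP N. u N + e2ennreal (- s))"
    by (rule ennreal_SUP_add_left[symmetric]) simp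
  also have "\<dots> \<le> e2ennreal s + B" using assms(1) unfolding iff by (intro SUP_least) auto
  finally show ?thesis unfolding iff .
qed

lemma eint_cong_AE: "AE x in M. f x = g x \<Longrightarrow> eint M f = eint M g"
  by (intro antisym eint_mono_AE) (auto elim: eventually_mono)

lemma ereal_lsum_ereal: "ereal_lsum (\<lambda>i. ereal (r i)) I = ereal (sum r I)"
  unfolding ereal_lsum_def by simp

lemma ediff_weighted_sum:
  assumes "finite I" and "\<And>i. i \<in> I \<Longrightarrow> 0 \<le> a i" and "\<And>i. i \<in> I \<Longrightarrow> ediff (p i) (q i) = ereal (r i)"
  shows "ediff (\<Sum>i\<in>I. ennreal (a i) * p i) (\<Sum>i\<in>I. ennreal (a i) * q i) = ereal (\<Sum>i\<in>I. a i * r i)"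
proof -
  have "ereal_lsum (\<lambda>i. ediff (ennreal (a i) * p i) (ennreal (a i) * q i)) I = ereal_lsum (\<lambda>i. ereal (a i * r i)) I"
    using assms(2,3) by (intro ereal_lsum_cong) (simp add: ereal_mult_ediff[symmetric])
  then show ?thesis using assms(1) by (simp add: ereal_lsum_ediff ereal_lsum_ereal)
qed

text \<open>With p finite everywhere and both integrals finite, the task concerns integrable real
  functions and \<open>discrete_moments\<close> applies. The rest is translation between real and
  extended values.\<close>

lemma moment_value_le_SUP_bounded:
  fixes fs :: "nat \<Rightarrow> 'y::topological_space \<Rightarrow> ereal"
  assumes \<eta>: "\<eta> \<in> moment_set n fs cs"
    and fs: "\<And>i. i \<in> {1..n} \<Longrightarrow> fs i \<in> borel_measurable borel"
    and p: "p \<in> borel_measurable borel" "\<And>y. p y < \<top>" "(\<integral>\<^sup>+ y. p y \<partial>\<eta>) < \<top>"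
    and q: "q \<in> borel_measurable borel" "(\<integral>\<^sup>+ y. q y \<partial>\<eta>) < \<top>"
  shows "\<exists>(a, y) \<in> Theta n (moment_set n fs cs). ediff (\<integral>\<^sup>+ y. p y \<partial>\<eta>) (\<integral>\<^sup>+ y. q y \<partial>\<eta>)
     \<le> ediff (\<Sum>i\<in>{1..n+1}. ennreal (a i) * p (y i)) (\<Sum>i\<in>{1..n+1}. ennreal (a i) * q (y i))"
proof -
  have sets_\<eta>[measurable_cong]: "sets \<eta> = sets borel" and "prob_space \<eta>"
    and mom: "\<And>k. k \<in> {1..n} \<Longrightarrow> (\<integral>\<^sup>+ y. e2ennreal \<bar>fs k y\<bar> \<partial>\<eta>) < \<top>"
      "\<And>k. k \<in> {1..n} \<Longrightarrow> eint \<eta> (fs k) \<le> ereal (cs k)"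
    using \<eta> unfolding moment_set_def by (auto simp: space_prob_algebra)
  interpret prob_space \<eta> by fact
  have pm[measurable]: "p \<in> borel_measurable \<eta>" and qm[measurable]: "q \<in> borel_measurable \<eta>"
    using p(1) q(1) by measurable
  have fsm: "fs k \<in> borel_measurable \<eta>" if "k \<in> {1..n}" for k
    using fs[OF that] by measurable
  define F where "F k y = real_of_ereal (fs k y)" for k y
  define g where "g y = enn2real (p y) - enn2real (q y)" for y
  \<comment> \<open>Off this set some constraint function or q is infinite. As \<eta> gives S full
    measure, the support points can be required to lie in S, where real and extended values
    agree.\<close>
  define S where "S = {y. (\<forall>k\<in>{1..n}. \<bar>fs k y\<bar> \<noteq> \<infinity>) \<and> q y < \<top>}"
  have fin: "AE y in \<eta>. \<bar>fs k y\<bar> \<noteq> \<infinity>" if k: "k \<in> {1..n}" for k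
  proof -
    note [measurable] = fsm[OF k]
    have "AE y in \<eta>. e2ennreal \<bar>fs k y\<bar> \<noteq> \<top>"
      using nn_integral_PInf_AE[of "\<lambda>y. e2ennreal \<bar>fs k y\<bar>" \<eta>] mom(1)[OF k] by (simp add: less_top)
    then show ?thesis by eventually_elim auto
  qed
  then have "AE y in \<eta>. \<forall>k\<in>{1..n}. \<bar>fs k y\<bar> \<noteq> \<infinity>" by (simp add: AE_finite_all)
  moreover have "AE y in \<eta>. q y < \<top>"
    using nn_integral_PInf_AE[of q \<eta>] q(2) by (simp add: less_top)
  ultimately have S: "AE y in \<eta>. y \<in> S" unfolding S_def by eventually_elim simp
  have F: "integrable \<eta> (F k)" if k: "k \<in> {1..n}" for k
  proof -
    note [measurable] = fsm[OF k]
    have "AE y in \<eta>. ennreal (norm (F k y)) = e2ennreal \<bar>fs k y\<bar>"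
      using fin[OF k] unfolding F_def
    proof eventually_elim
      case (elim y)
      then show ?case by (cases "fs k y") auto
    qed
    then have "(\<integral>\<^sup>+ y. ennreal (norm (F k y)) \<partial>\<eta>) = (\<integral>\<^sup>+ y. e2ennreal \<bar>fs k y\<bar> \<partial>\<eta>)" by (rule nn_integral_cong_AE)
    then show ?thesis using mom(1)[OF k] unfolding F_def by (intro integrableI_bounded) auto
  qed
  have g: "integrable \<eta> g" and int_g: "integral\<^sup>L \<eta> g = enn2real (\<integral>\<^sup>+ y. p y \<partial>\<eta>) - enn2real (\<integral>\<^sup>+ y. q y \<partial>\<eta>)"
    unfolding g_def using integrable_enn2real[OF pm p(3)] integrable_enn2real[OF qm q(2)] by simp_all
  have "\<forall>k\<in>{1..n}. integrable \<eta> (F k)" using F by blast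
  from discrete_moments[OF S this g] obtain a y
    where ay: "\<forall>i\<in>{1..n+1}. 0 \<le> a i \<and> a i \<le> 1 \<and> y i \<in> S" and sum_a: "sum a {1..n+1} = 1"
      and aF: "\<forall>k\<in>{1..n}. (\<Sum>i\<in>{1..n+1}. a i * F k (y i)) = integral\<^sup>L \<eta> (F k)"
      and ag: "integral\<^sup>L \<eta> g \<le> (\<Sum>i\<in>{1..n+1}. a i * g (y i))"
    by (elim exE conjE)
  have "dirac_comb {1..n+1} a y \<in> moment_set n fs cs"
    unfolding moment_set_def
  proof (intro CollectI conjI ballI)
    have "(\<Sum>i\<in>{1..n+1}. ennreal (a i)) = ennreal (sum a {1..n+1})" using ay by (intro sum_ennreal) blast
    then show "dirac_comb {1..n+1} a y \<in> prob_measures" using sum_a by (simp add: dirac_comb_prob_iff)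
    fix k assume k: "k \<in> {1..n}"
    note [measurable] = fs[OF k]
    have fin_y: "\<bar>fs k (y i)\<bar> \<noteq> \<infinity>" if "i \<in> {1..n+1}" for i
    proof -
      have "y i \<in> S" using ay that by blast
      then show ?thesis using k unfolding S_def by simp
    qed
    have "(\<integral>\<^sup>+ z. e2ennreal \<bar>fs k z\<bar> \<partial>dirac_comb {1..n+1} a y) = (\<Sum>i\<in>{1..n+1}. ennreal (a i) * e2ennreal \<bar>fs k (y i)\<bar>)"
      by (rule nn_integral_dirac_comb) auto
    also have "\<dots> < \<infinity>"
    proof -
      have "ennreal (a i) * e2ennreal \<bar>fs k (y i)\<bar> < \<top>" if "i \<in> {1..n+1}" for i
        using fin_y[OF that] by (cases "fs k (y i)") (auto simp: ennreal_mult_less_top)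
      then show ?thesis by simp
    qed
    finally show "(\<integral>\<^sup>+ z. e2ennreal \<bar>fs k z\<bar> \<partial>dirac_comb {1..n+1} a y) < \<infinity>" .
    have "eint (dirac_comb {1..n+1} a y) (fs k) = ereal (\<Sum>i\<in>{1..n+1}. a i * F k (y i))"
      unfolding eint_dirac_comb[OF finite_atLeastAtMost fs[OF k]]
    proof (rule ediff_weighted_sum)
      show "ediff (e2ennreal (fs k (y i))) (e2ennreal (- fs k (y i))) = ereal (F k (y i))" if "i \<in> {1..n+1}" for i
        using fin_y[OF that] unfolding F_def by (simp add: ereal_real)
    qed (use ay in auto)
    also have "\<dots> = ereal (integral\<^sup>L \<eta> (F k))" using aF k by simp
    also have "\<dots> = eint \<eta> (\<lambda>y. ereal (F k y))" by (rule eint_ereal[OF F[OF k], symmetric])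
    also have "\<dots> = eint \<eta> (fs k)"
      using fin[OF k] unfolding F_def by (intro eint_cong_AE) (auto elim!: eventually_mono simp: ereal_real)
    also have "\<dots> \<le> ereal (cs k)" by (rule mom(2)[OF k])
    finally show "eint (dirac_comb {1..n+1} a y) (fs k) \<le> ereal (cs k)" .
  qed
  moreover define a' where "a' = restrict a {1..n+1}"
  moreover define y' where "y' = restrict y {1..n+1}"
  moreover have "dirac_comb {1..n+1} a' y' = dirac_comb {1..n+1} a y"
    unfolding a'_def y'_def by (rule dirac_comb_cong) simp
  ultimately have "(a', y') \<in> Theta n (moment_set n fs cs)"
    using ay by (auto simp: mem_Theta_iff space_pair_measure space_PiM simp del: One_nat_def)
  moreover have "ediff (\<integral>\<^sup>+ y. p y \<partial>\<eta>) (\<integral>\<^sup>+ y. q y \<partial>\<eta>)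
     \<le> ediff (\<Sum>i\<in>{1..n+1}. ennreal (a' i) * p (y' i)) (\<Sum>i\<in>{1..n+1}. ennreal (a' i) * q (y' i))"
  proof -
    have "ediff (\<integral>\<^sup>+ y. p y \<partial>\<eta>) (\<integral>\<^sup>+ y. q y \<partial>\<eta>) = ereal (integral\<^sup>L \<eta> g)"
      unfolding int_g by (rule ediff_finite[OF p(3) q(2)])
    also have "\<dots> \<le> ereal (\<Sum>i\<in>{1..n+1}. a' i * g (y' i))"
      using ag unfolding a'_def y'_def by simp
    also have "\<dots> = ediff (\<Sum>i\<in>{1..n+1}. ennreal (a' i) * p (y' i)) (\<Sum>i\<in>{1..n+1}. ennreal (a' i) * q (y' i))"
    proof (rule ediff_weighted_sum[symmetric])
      fix i assume "i \<in> {1..n+1}"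
      then show "0 \<le> a' i" "ediff (p (y' i)) (q (y' i)) = ereal (g (y' i))"
        using ay p(2) unfolding a'_def y'_def g_def S_def by (auto intro!: ediff_finite)
    qed simp
    finally show ?thesis .
  qed
  ultimately show ?thesis by blast
qed

text \<open>Truncating p from above gives the bounded case, and monotone convergence removes the
  truncation. The part q is left alone, its integral being finite.\<close>

lemma moment_value_le_SUP:
  fixes fs :: "nat \<Rightarrow> 'y::topological_space \<Rightarrow> ereal"
  assumes \<eta>: "\<eta> \<in> moment_set n fs cs"
    and fs: "\<And>i. i \<in> {1..n} \<Longrightarrow> fs i \<in> borel_measurable borel"
    and p: "p \<in> borel_measurable borel"
    and q: "q \<in> borel_measurable borel" "(\<integral>\<^sup>+ y. q y \<partial>\<eta>) < \<top>"
  shows "ediff (\<integral>\<^sup>+ y. p y \<partial>\<eta>) (\<integral>\<^sup>+ y. q y \<partial>\<eta>)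
     \<le> (SUP (a, y) \<in> Theta n (moment_set n fs cs).
          ediff (\<Sum>i\<in>{1..n+1}. ennreal (a i) * p (y i)) (\<Sum>i\<in>{1..n+1}. ennreal (a i) * q (y i)))" (is "_ \<le> ?s")
proof -
  have sets_\<eta>[measurable_cong]: "sets \<eta> = sets borel" and "prob_space \<eta>"
    using \<eta> unfolding moment_set_def by (auto simp: space_prob_algebra)
  interpret prob_space \<eta> by fact
  note [measurable] = p
  have "ediff (\<integral>\<^sup>+ y. min (p y) (of_nat N) \<partial>\<eta>) (\<integral>\<^sup>+ y. q y \<partial>\<eta>) \<le> ?s" for N :: nat
  proof -
    have "(\<integral>\<^sup>+ y. min (p y) (of_nat N) \<partial>\<eta>) \<le> (\<integral>\<^sup>+ y. of_nat N \<partial>\<eta>)" by (intro nn_integral_mono) simp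
    also have "\<dots> < \<top>" by (simp add: emeasure_space_1 of_nat_less_top)
    finally have fin: "(\<integral>\<^sup>+ y. min (p y) (of_nat N) \<partial>\<eta>) < \<top>" .
    have "\<exists>(a, y) \<in> Theta n (moment_set n fs cs). ediff (\<integral>\<^sup>+ y. min (p y) (of_nat N) \<partial>\<eta>) (\<integral>\<^sup>+ y. q y \<partial>\<eta>)
       \<le> ediff (\<Sum>i\<in>{1..n+1}. ennreal (a i) * min (p (y i)) (of_nat N)) (\<Sum>i\<in>{1..n+1}. ennreal (a i) * q (y i))"
      using fin by (intro moment_value_le_SUP_bounded[OF \<eta> fs _ _ _ q]) (auto simp: of_nat_less_top min_less_iff_disj)
    then obtain a y where ay: "(a, y) \<in> Theta n (moment_set n fs cs)"
      and le: "ediff (\<integral>\<^sup>+ y. min (p y) (of_nat N) \<partial>\<eta>) (\<integral>\<^sup>+ y. q y \<partial>\<eta>)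
       \<le> ediff (\<Sum>i\<in>{1..n+1}. ennreal (a i) * min (p (y i)) (of_nat N)) (\<Sum>i\<in>{1..n+1}. ennreal (a i) * q (y i))"
      by blast
    note le
    also have "\<dots> \<le> ediff (\<Sum>i\<in>{1..n+1}. ennreal (a i) * p (y i)) (\<Sum>i\<in>{1..n+1}. ennreal (a i) * q (y i))"
      by (intro ediff_mono sum_mono mult_left_mono) auto
    also have "\<dots> \<le> ?s" using ay by (intro SUP_upper2[OF ay]) simp
    finally show ?thesis .
  qed
  then have "ediff (SUP N. \<integral>\<^sup>+ y. min (p y) (of_nat N) \<partial>\<eta>) (\<integral>\<^sup>+ y. q y \<partial>\<eta>) \<le> ?s"
    using q(2) by (rule ediff_SUP_le)
  also have "(SUP N. \<integral>\<^sup>+ y. min (p y) (of_nat N) \<partial>\<eta>) = (\<integral>\<^sup>+ y. (SUP N. min (p y) (of_nat N)) \<partial>\<eta>)"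
    by (intro nn_integral_monotone_convergence_SUP[symmetric])
      (auto simp: incseq_def le_fun_def min.coboundedI2)
  also have "\<dots> = (\<integral>\<^sup>+ y. p y \<partial>\<eta>)"
    by (simp add: inf_min[symmetric] inf_SUP[symmetric] ennreal_SUP_of_nat_eq_top)
  finally show ?thesis .
qed

section \<open>The duality\<close>

text \<open>The Borel space hypotheses enter in two forms: as \<open>baire\<close>, and as
  measurability for the product \<sigma>-algebra on pairs.\<close>

locale moment_problem =
  fixes \<mu> :: "'x::topological_space measure"
    and n :: nat
    and fs :: "nat \<Rightarrow> 'y::topological_space \<Rightarrow> ereal"
    and cs :: "nat \<Rightarrow> real"
    and \<tau> :: "'x \<Rightarrow> 'y \<Rightarrow> 'y"
    and c :: "'x \<times> 'y \<Rightarrow> ennreal"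
    and \<kappa>0 :: "'x \<Rightarrow> 'y measure"
  assumes \<mu>: "\<mu> \<in> prob_measures"
    and baire: "baire_image (borel :: 'y measure)"
    and fs: "\<And>i. i \<in> {1..n} \<Longrightarrow> fs i \<in> borel_measurable borel"
    and bij: "\<And>x. bij (\<tau> x)"
    and \<tau>: "(\<lambda>(x, y). \<tau> x y) \<in> borel \<Otimes>\<^sub>M borel \<rightarrow>\<^sub>M borel"
    and inv_\<tau>: "(\<lambda>(x, y). inv (\<tau> x) y) \<in> borel \<Otimes>\<^sub>M borel \<rightarrow>\<^sub>M borel"
    and c: "c \<in> borel_measurable (borel \<Otimes>\<^sub>M borel)"
    and \<kappa>0: "\<kappa>0 \<in> borel \<rightarrow>\<^sub>M prob_algebra borel"
    and cost_\<kappa>0: "AE x in \<mu>. moment_cost \<tau> c (moment_set n fs cs) x (\<kappa>0 x) = 0"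
begin

abbreviation \<M> :: "'y measure set" where "\<M> \<equiv> moment_set n fs cs"
abbreviation cost :: "'x \<Rightarrow> 'y measure \<Rightarrow> ennreal" where "cost \<equiv> moment_cost \<tau> c \<M>"
abbreviation I :: "nat set" where "I \<equiv> {1..n+1}"

lemma sets_\<mu> [measurable_cong]: "sets \<mu> = sets borel" and prob_\<mu>: "prob_space \<mu>"
  using \<mu> by (auto simp: space_prob_algebra)

lemma \<tau>_section [measurable]: "\<tau> x \<in> borel \<rightarrow>\<^sub>M borel"
  using measurable_compose[OF measurable_Pair1' \<tau>, of x] by simp

lemma inv_\<tau>_section [measurable]: "inv (\<tau> x) \<in> borel \<rightarrow>\<^sub>M borel"
  using measurable_compose[OF measurable_Pair1' inv_\<tau>, of x] by simp

lemma c_section [measurable]: "(\<lambda>y. c (x, y)) \<in> borel_measurable borel"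
  using measurable_compose[OF measurable_Pair1' c, of x] by simp

lemma inv_\<tau>_cancel [simp]: "inv (\<tau> x) (\<tau> x y) = y" "\<tau> x (inv (\<tau> x) y) = y"
  using bij[of x] by (auto simp: bij_def surj_f_inv_f)

abbreviation lift :: "'x \<Rightarrow> (nat \<Rightarrow> real) \<times> (nat \<Rightarrow> 'y) \<Rightarrow> 'y measure" where
  "lift x \<theta> \<equiv> dirac_comb I (fst \<theta>) (\<lambda>i. \<tau> x (snd \<theta> i))"

lemma Theta_weights: "\<theta> \<in> Theta n \<M> \<Longrightarrow> i \<in> I \<Longrightarrow> 0 \<le> fst \<theta> i"
  by (cases \<theta>) (auto simp: mem_Theta_iff)

lemma lift_prob: "\<theta> \<in> Theta n \<M> \<Longrightarrow> lift x \<theta> \<in> prob_measures"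
  using dirac_comb_prob_iff[of I "fst \<theta>" "snd \<theta>"] dirac_comb_prob_iff[of I "fst \<theta>" "\<lambda>i. \<tau> x (snd \<theta> i)"]
  by (cases \<theta>) (auto simp: mem_Theta_iff moment_set_def)

text \<open>The inverse of \<open>\<tau> x\<close> carries the lifted measure back to the original
  combination, which lies in \<M>, so the cost is the integral of c.\<close>

lemma cost_lift:
  assumes "\<theta> \<in> Theta n \<M>"
  shows "cost x (lift x \<theta>) = (\<Sum>i\<in>I. ennreal (fst \<theta> i) * c (x, \<tau> x (snd \<theta> i)))"
proof -
  have "distr (lift x \<theta>) borel (inv (\<tau> x)) = dirac_comb I (fst \<theta>) (snd \<theta>)"
    by (subst distr_dirac_comb) auto
  also have "\<dots> \<in> \<M>" using assms by (cases \<theta>) (simp add: mem_Theta_iff)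
  finally show ?thesis unfolding moment_cost_def by (simp add: nn_integral_dirac_comb)
qed

lemma comb_value_eq_lift:
  assumes "\<theta> \<in> Theta n \<M>" and [measurable]: "f \<in> borel_measurable borel"
  shows "comb_value n \<tau> c f x \<theta> = ediff (\<integral>\<^sup>+ y. e2ennreal (f y) \<partial>lift x \<theta>)
    ((\<integral>\<^sup>+ y. e2ennreal (- f y) \<partial>lift x \<theta>) + cost x (lift x \<theta>))"
  using comb_value_eq_ediff[of n "fst \<theta>" \<tau> c f x "snd \<theta>"] Theta_weights[OF assms(1)]
  by (simp add: nn_integral_dirac_comb cost_lift[OF assms(1)] sum.distrib distrib_left del: sum.cl_ivl_Suc One_nat_def)

lemma C_transform_eq:
  assumes f[measurable]: "f \<in> borel_measurable borel"
  shows "C_transform cost f x = (SUP \<theta> \<in> Theta n \<M>. comb_value n \<tau> c f x \<theta>)"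
proof (rule antisym)
  show "(SUP \<theta> \<in> Theta n \<M>. comb_value n \<tau> c f x \<theta>) \<le> C_transform cost f x"
    unfolding C_transform_def
  proof (rule SUP_mono)
    fix \<theta> assume \<theta>: "\<theta> \<in> Theta n \<M>"
    show "\<exists>\<psi>\<in>prob_measures. comb_value n \<tau> c f x \<theta> \<le> eint \<psi> f \<ominus>\<^sub>l enn2ereal (cost x \<psi>)"
      using lift_prob[OF \<theta>, of x] comb_value_eq_lift[OF \<theta> f, of x]
      by (intro bexI[of _ "lift x \<theta>"]) (simp_all add: eint_eq_ediff ediff_lminus)
  qed
  show "C_transform cost f x \<le> (SUP \<theta> \<in> Theta n \<M>. comb_value n \<tau> c f x \<theta>)"
    unfolding C_transform_def
  proof (rule SUP_least)
    fix \<psi> :: "'y measure" assume "\<psi> \<in> prob_measures"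
    then have sets_\<psi>[measurable_cong, simp]: "sets \<psi> = sets borel" by (simp add: space_prob_algebra)
    define \<eta> where "\<eta> = distr \<psi> borel (inv (\<tau> x))"
    define q where "q y = e2ennreal (- f (\<tau> x y)) + c (x, \<tau> x y)" for y
    define p where "p y = e2ennreal (f (\<tau> x y))" for y
    have [measurable]: "(\<lambda>y. c (x, \<tau> x y)) \<in> borel_measurable borel"
      by (rule measurable_compose[OF \<tau>_section c_section])
    have pq[measurable]: "p \<in> borel_measurable borel" "q \<in> borel_measurable borel"
      unfolding p_def q_def by measurable
    have int_\<eta>: "(\<integral>\<^sup>+ y. h (\<tau> x y) \<partial>\<eta>) = (\<integral>\<^sup>+ y. h y \<partial>\<psi>)" if "h \<in> borel_measurable borel" for h
    proof -
      have [measurable]: "(\<lambda>y. h (\<tau> x y)) \<in> borel_measurable borel"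
        by (rule measurable_compose[OF \<tau>_section that])
      show ?thesis unfolding \<eta>_def by (subst nn_integral_distr) auto
    qed
    have eq: "eint \<psi> f \<ominus>\<^sub>l enn2ereal (cost x \<psi>) =
        ediff (\<integral>\<^sup>+ y. e2ennreal (f y) \<partial>\<psi>) ((\<integral>\<^sup>+ y. e2ennreal (- f y) \<partial>\<psi>) + cost x \<psi>)"
      by (simp add: eint_eq_ediff ediff_lminus)
    show "eint \<psi> f \<ominus>\<^sub>l enn2ereal (cost x \<psi>) \<le> (SUP \<theta> \<in> Theta n \<M>. comb_value n \<tau> c f x \<theta>)"
    \<comment> \<open>An infinite negative part gives the value -\<infinity>. A finite one forces a
      finite cost, which puts the pulled-back measure \<eta> into \<M>.\<close>
    proof (cases "(\<integral>\<^sup>+ y. e2ennreal (- f y) \<partial>\<psi>) + cost x \<psi> = \<top>")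
      case False
      then have \<eta>: "\<eta> \<in> \<M>" unfolding moment_cost_def \<eta>_def by (auto split: if_splits)
      have p_eq: "(\<integral>\<^sup>+ y. e2ennreal (f y) \<partial>\<psi>) = (\<integral>\<^sup>+ y. p y \<partial>\<eta>)"
        unfolding p_def using int_\<eta>[of "\<lambda>y. e2ennreal (f y)"] by simp
      have "(\<integral>\<^sup>+ y. e2ennreal (- f y) \<partial>\<psi>) + cost x \<psi> = (\<integral>\<^sup>+ y. e2ennreal (- f y) + c (x, y) \<partial>\<psi>)"
        using \<eta> unfolding moment_cost_def \<eta>_def by (simp add: nn_integral_add)
      also have "\<dots> = (\<integral>\<^sup>+ y. q y \<partial>\<eta>)"
        unfolding q_def using int_\<eta>[of "\<lambda>y. e2ennreal (- f y) + c (x, y)"] by simp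
      finally have q_eq: "(\<integral>\<^sup>+ y. e2ennreal (- f y) \<partial>\<psi>) + cost x \<psi> = (\<integral>\<^sup>+ y. q y \<partial>\<eta>)" .
      have "eint \<psi> f \<ominus>\<^sub>l enn2ereal (cost x \<psi>) = ediff (\<integral>\<^sup>+ y. p y \<partial>\<eta>) (\<integral>\<^sup>+ y. q y \<partial>\<eta>)"
        unfolding eq p_eq q_eq ..
      also have "\<dots> \<le> (SUP (a, y) \<in> Theta n \<M>.
          ediff (\<Sum>i\<in>I. ennreal (a i) * p (y i)) (\<Sum>i\<in>I. ennreal (a i) * q (y i)))"
        using False unfolding q_eq by (intro moment_value_le_SUP[OF \<eta> fs pq]) (auto simp: less_top)
      also have "\<dots> = (SUP \<theta> \<in> Theta n \<M>. comb_value n \<tau> c f x \<theta>)"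
      proof (rule SUP_cong[OF refl])
        fix \<theta> assume "\<theta> \<in> Theta n \<M>"
        then show "(case \<theta> of (a, y) \<Rightarrow> ediff (\<Sum>i\<in>I. ennreal (a i) * p (y i)) (\<Sum>i\<in>I. ennreal (a i) * q (y i)))
            = comb_value n \<tau> c f x \<theta>"
          using Theta_weights[of \<theta>] comb_value_eq_ediff[of n "fst \<theta>" \<tau> c f x "snd \<theta>"]
          unfolding p_def q_def by (cases \<theta>) simp
      qed
      finally show ?thesis .
    next
      case True
      show ?thesis unfolding eq True by simp
    qed
  qed
qed

end

section \<open>Integration of universally measurable functions\<close>

lemma subalgebra_univ_borel:
  assumes "\<nu> \<in> prob_measures"
  shows "subalgebra (completion \<nu>) univ_borel"
proof -
  have sets_\<nu>: "sets \<nu> = sets borel" using assms by (simp add: space_prob_algebra)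
  then have "space (completion \<nu>) = UNIV" using sets_eq_imp_space_eq[OF sets_\<nu>] by simp
  moreover have "sigma_sets UNIV {A. \<forall>\<nu> \<in> prob_measures. A \<in> sets (completion \<nu>)} \<subseteq> sets (completion \<nu>)"
    using sets.sigma_sets_subset[of "{A. \<forall>\<nu> \<in> prob_measures. A \<in> sets (completion \<nu>)}" "completion \<nu>"]
      assms calculation by auto
  ultimately show ?thesis unfolding subalgebra_def univ_borel_def by simp
qed

text \<open>The integral against \<nu> on the right is taken of a function that need not be Borel:
  the nonnegative integral is a supremum over simple functions and does not change under completion.
  Later estimates can thus stay with \<mu> itself.\<close>

lemma eint_univ_ext:
  assumes \<nu>: "\<nu> \<in> prob_measures" and [measurable]: "h \<in> borel_measurable univ_borel"
  shows "eint (univ_ext \<nu>) h = eint \<nu> h"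
  unfolding eint_eq_ediff univ_ext_def
  by (simp add: nn_integral_subalgebra2[OF subalgebra_univ_borel[OF \<nu>]] nn_integral_completion)

locale moment_problem_function = moment_problem \<mu> n fs cs \<tau> c \<kappa>0
  for \<mu> :: "'x::topological_space measure" and n fs cs \<tau> c
    and \<kappa>0 :: "'x \<Rightarrow> 'y::topological_space measure" +
  fixes f :: "'y \<Rightarrow> ereal"
  assumes f: "f \<in> calL \<mu> cost \<kappa>0"
begin

abbreviation comb :: "'x \<Rightarrow> (nat \<Rightarrow> real) \<times> (nat \<Rightarrow> 'y) \<Rightarrow> ereal" where
  "comb \<equiv> comb_value n \<tau> c f"

definition V :: "'x \<Rightarrow> ereal" where
  "V x = (SUP \<theta> \<in> Theta n \<M>. comb x \<theta>)"

lemma f_measurable [measurable]: "f \<in> borel_measurable borel"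
  using f unfolding calL_def by blast

text \<open>Every kernel k is compared with V through this bound, applied to \<open>k x\<close> for
  each x.\<close>

lemma V_upper:
  assumes "\<psi> \<in> prob_measures"
  shows "ediff (\<integral>\<^sup>+ y. e2ennreal (f y) \<partial>\<psi>) ((\<integral>\<^sup>+ y. e2ennreal (- f y) \<partial>\<psi>) + cost x \<psi>) \<le> V x"
  using SUP_upper[OF assms, of "\<lambda>\<psi>. eint \<psi> f \<ominus>\<^sub>l enn2ereal (cost x \<psi>)"] C_transform_eq[OF f_measurable, of x]
  unfolding V_def C_transform_def by (simp add: eint_eq_ediff ediff_lminus)

lemma sets_comb_greater:
  assumes r[measurable]: "r \<in> borel_measurable borel"
  shows "{z \<in> space (borel \<Otimes>\<^sub>M tuples n). snd z \<in> Theta n \<M> \<and> r (fst z) < comb (fst z) (snd z)}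
    \<in> sets (borel \<Otimes>\<^sub>M tuples n)"
proof -
  define p where "p z = (\<Sum>i\<in>I. ennreal (fst (snd z) i) * e2ennreal (f (\<tau> (fst z) (snd (snd z) i))))"
    for z :: "'x \<times> (nat \<Rightarrow> real) \<times> (nat \<Rightarrow> 'y)"
  define q where "q z = (\<Sum>i\<in>I. ennreal (fst (snd z) i) *
      (e2ennreal (- f (\<tau> (fst z) (snd (snd z) i))) + c (fst z, \<tau> (fst z) (snd (snd z) i))))"
    for z :: "'x \<times> (nat \<Rightarrow> real) \<times> (nat \<Rightarrow> 'y)"
  have [measurable]: "Theta n \<M> \<in> sets (tuples n)" by (rule sets_Theta) (rule fs)
  have w[measurable]: "(\<lambda>z. fst (snd z) i) \<in> borel \<Otimes>\<^sub>M tuples n \<rightarrow>\<^sub>M borel" if "i \<in> I" for i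
    by (rule measurable_compose[OF measurable_snd measurable_component_fst[OF that]])
  have y: "(\<lambda>z. snd (snd z) i) \<in> borel \<Otimes>\<^sub>M tuples n \<rightarrow>\<^sub>M borel" if "i \<in> I" for i
    by (rule measurable_compose[OF measurable_snd measurable_component_snd[OF that]])
  have ty[measurable]: "(\<lambda>z. \<tau> (fst z) (snd (snd z) i)) \<in> borel \<Otimes>\<^sub>M tuples n \<rightarrow>\<^sub>M borel" if "i \<in> I" for i
    using measurable_compose[OF measurable_Pair[OF measurable_fst y[OF that]] \<tau>] by simp
  have cy[measurable]: "(\<lambda>z. c (fst z, \<tau> (fst z) (snd (snd z) i))) \<in> borel_measurable (borel \<Otimes>\<^sub>M tuples n)"
    if "i \<in> I" for i
    by (rule measurable_compose[OF measurable_Pair[OF measurable_fst ty[OF that]] c])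
  have [measurable]: "p \<in> borel_measurable (borel \<Otimes>\<^sub>M tuples n)" "q \<in> borel_measurable (borel \<Otimes>\<^sub>M tuples n)"
    unfolding p_def q_def by (intro borel_measurable_sum; measurable)+
  have "{z \<in> space (borel \<Otimes>\<^sub>M tuples n). snd z \<in> Theta n \<M> \<and> r (fst z) < ediff (p z) (q z)}
    \<in> sets (borel \<Otimes>\<^sub>M tuples n)"
    by measurable
  \<comment> \<open>Nonnegative weights are guaranteed on \<open>Theta\<close> only, so the two
    expressions are identified just there.\<close>
  moreover have "comb (fst z) (snd z) = ediff (p z) (q z)" if "snd z \<in> Theta n \<M>" for z
    using comb_value_eq_ediff[of n "fst (snd z)" \<tau> c f "fst z" "snd (snd z)"] Theta_weights[OF that]
    unfolding p_def q_def by simp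
  ultimately show ?thesis by (simp cong: conj_cong)
qed

lemma baire_tuples: "baire_image (tuples n :: ((nat \<Rightarrow> real) \<times> (nat \<Rightarrow> 'y)) measure)"
  by (intro baire_image_pair baire_image_PiM baire_image_polish baire)

text \<open>The relation D has a point over x exactly where \<open>r x < V x\<close>. A constant r
  will yield measurability of V, and an r slightly below V a near-optimal selector.\<close>

lemma comb_selection:
  assumes \<nu>: "\<nu> \<in> prob_measures" and r: "r \<in> borel_measurable borel"
  obtains B Z h where "B \<in> sets borel" "Z \<in> null_sets \<nu>" "h \<in> borel \<rightarrow>\<^sub>M tuples n"
    "{x. r x < V x} \<subseteq> B \<union> Z" "\<And>x. x \<in> B \<Longrightarrow> h x \<in> Theta n \<M> \<and> r x < comb x (h x)"
proof -
  define D where "D = {z \<in> space (borel \<Otimes>\<^sub>M tuples n). snd z \<in> Theta n \<M> \<and> r (fst z) < comb (fst z) (snd z)}"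
  have sets_\<nu>[measurable_cong]: "sets \<nu> = sets borel" and "prob_space \<nu>"
    using \<nu> by (auto simp: space_prob_algebra)
  interpret prob_space \<nu> by fact
  have D: "D \<in> sets (\<nu> \<Otimes>\<^sub>M tuples n)"
    using sets_comb_greater[OF r] sets_pair_measure_cong[OF sets_\<nu> refl] unfolding D_def by blast
  obtain s where s: "s \<in> baire \<rightarrow>\<^sub>M tuples n" "space (tuples n :: ((nat \<Rightarrow> real) \<times> (nat \<Rightarrow> 'y)) measure) \<subseteq> range s"
    using baire_tuples unfolding baire_image_def by blast
  from measurable_selection[OF s D] obtain B Z h where B: "B \<in> sets \<nu>" and Z: "Z \<in> null_sets \<nu>" and h: "h \<in> \<nu> \<rightarrow>\<^sub>M tuples n"
    and cover: "fst ` D \<subseteq> B \<union> Z" and sel: "\<forall>x\<in>B. (x, h x) \<in> D"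
    by (elim bexE conjE)
  have "{x. r x < V x} \<subseteq> fst ` D"
  proof
    fix x assume "x \<in> {x. r x < V x}"
    then obtain \<theta> where \<theta>: "\<theta> \<in> Theta n \<M>" "r x < comb x \<theta>" unfolding V_def by (auto simp: less_SUP_iff)
    have "\<theta> \<in> space (tuples n)" using \<theta>(1) by (cases \<theta>) (simp add: mem_Theta_iff)
    then have "(x, \<theta>) \<in> D" using \<theta> unfolding D_def by (simp add: space_pair_measure)
    then show "x \<in> fst ` D" by (rule image_eqI[rotated]) simp
  qed
  with cover have "{x. r x < V x} \<subseteq> B \<union> Z" by (rule order_trans[rotated])
  moreover have "h x \<in> Theta n \<M> \<and> r x < comb x (h x)" if "x \<in> B" for x
    using sel that unfolding D_def by simp
  moreover have "B \<in> sets borel" using B sets_\<nu> by simp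
  moreover have "h \<in> borel \<rightarrow>\<^sub>M tuples n" using h measurable_cong_sets[OF sets_\<nu> refl] by blast
  ultimately show ?thesis using that Z by blast
qed

text \<open>For each \<nu> separately, a level set of V consists of a Borel set and part of a null
  set, both depending on \<nu>.\<close>

lemma V_measurable: "V \<in> borel_measurable univ_borel"
proof (rule borel_measurableI_greater)
  fix r :: ereal
  have "{x. r < V x} \<in> sets (completion \<nu>)" if \<nu>: "\<nu> \<in> prob_measures" for \<nu>
  proof -
    obtain B Z h where B: "B \<in> sets borel" and Z: "Z \<in> null_sets \<nu>" and cover: "{x. r < V x} \<subseteq> B \<union> Z"
      and sel: "\<And>x. x \<in> B \<Longrightarrow> h x \<in> Theta n \<M> \<and> r < comb x (h x)"
      using comb_selection[OF \<nu>, of "\<lambda>_. r"] by (metis borel_measurable_const)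
    have "r < V x" if "x \<in> B" for x
      using sel[OF that] unfolding V_def by (auto simp: less_SUP_iff)
    then have "{x. r < V x} = B \<union> ({x. r < V x} - B)" by blast
    moreover have "{x. r < V x} - B \<subseteq> Z" using cover by blast
    moreover have "B \<in> sets \<nu>" using B \<nu> by (simp add: space_prob_algebra)
    ultimately show ?thesis using Z by (intro sets_completionI)
  qed
  then have "{x. r < V x} \<in> sets univ_borel" unfolding univ_borel_def by auto
  moreover have "space univ_borel = (UNIV :: 'x set)" unfolding univ_borel_def by simp
  ultimately show "{x \<in> space univ_borel. r < V x} \<in> sets univ_borel" by simp
qed

section \<open>Integrals along kernels and integrable bounds for V\<close>

lemma cost_kernel_measurable:
  assumes k: "k \<in> borel \<rightarrow>\<^sub>M prob_algebra borel"
  shows "(\<lambda>x. cost x (k x)) \<in> borel_measurable borel"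
proof -
  have "(\<lambda>x. distr (k x) borel (inv (\<tau> x))) \<in> borel \<rightarrow>\<^sub>M prob_algebra borel"
    by (rule measurable_distr_prob_space2[OF k inv_\<tau>])
  from pred_moment_set[OF this fs]
  have [measurable]: "Measurable.pred borel (\<lambda>x. distr (k x) borel (inv (\<tau> x)) \<in> \<M>)" .
  have [measurable]: "(\<lambda>x. \<integral>\<^sup>+ y. c (x, y) \<partial>k x) \<in> borel_measurable borel"
    using c by (intro nn_integral_measurable_subprob_algebra2[OF _ measurable_prob_algebraD[OF k]]) simp
  show ?thesis unfolding moment_cost_def by measurable
qed

lemma kernel_nn_integral_measurable:
  assumes "k \<in> borel \<rightarrow>\<^sub>M prob_algebra borel" and "h \<in> borel_measurable borel"
  shows "(\<lambda>x. \<integral>\<^sup>+ y. h y \<partial>k x) \<in> borel_measurable borel"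
  using measurable_compose[OF measurable_prob_algebraD[OF assms(1)] nn_integral_measurable_subprob_algebra[OF assms(2)]] .

lemma bind_prob:
  assumes "k \<in> borel \<rightarrow>\<^sub>M prob_algebra borel"
  shows "\<mu> \<bind> k \<in> prob_measures"
  using prob_space_bind'[OF \<mu> assms] sets_bind'[OF \<mu> assms] by (simp add: space_prob_algebra)

lemma nn_integral_bind_kernel:
  assumes k: "k \<in> borel \<rightarrow>\<^sub>M prob_algebra borel" and "h \<in> borel_measurable borel"
  shows "(\<integral>\<^sup>+ y. h y \<partial>(\<mu> \<bind> k)) = (\<integral>\<^sup>+ x. \<integral>\<^sup>+ y. h y \<partial>k x \<partial>\<mu>)"
proof (rule nn_integral_bind[OF assms(2)])
  show "k \<in> \<mu> \<rightarrow>\<^sub>M subprob_algebra borel"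
    using measurable_prob_algebraD[OF k] measurable_cong_sets[OF sets_\<mu> refl] by blast
qed


lemma \<kappa>0_finite:
  shows "(\<integral>\<^sup>+ x. \<integral>\<^sup>+ y. e2ennreal (- f y) \<partial>\<kappa>0 x \<partial>\<mu>) < \<top>"
proof -
  have "eint (\<mu> \<bind> \<kappa>0) f \<noteq> - \<infinity>" using f unfolding calL_def by auto
  then have "(\<integral>\<^sup>+ y. e2ennreal (- f y) \<partial>(\<mu> \<bind> \<kappa>0)) < \<top>"
    unfolding eint_eq_ediff ediff_eq_MInf_iff by (simp add: less_top)
  then show ?thesis by (simp add: nn_integral_bind_kernel[OF \<kappa>0])
qed

text \<open>Almost everywhere V is at least the value of \<kappa>0, whose cost vanishes there; the
  positive part is integrable by the definition of \<open>calL\<close>. As V is measurable only for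
  the completion, its parts are replaced by Borel versions.\<close>

lemma V_parts:
  obtains vp vm where "vp \<in> borel_measurable borel" "vm \<in> borel_measurable borel"
    "AE x in \<mu>. V x = ediff (vp x) (vm x)"
    "(\<integral>\<^sup>+ x. vp x \<partial>\<mu>) < \<top>" "(\<integral>\<^sup>+ x. vm x \<partial>\<mu>) < \<top>"
    "eint \<mu> V = ediff (\<integral>\<^sup>+ x. vp x \<partial>\<mu>) (\<integral>\<^sup>+ x. vm x \<partial>\<mu>)"
proof -
  have Vc[measurable]: "V \<in> borel_measurable (completion \<mu>)"
    by (rule measurable_from_subalg[OF subalgebra_univ_borel[OF \<mu>] V_measurable])
  obtain vp where vp: "vp \<in> borel_measurable \<mu>" "AE x in \<mu>. e2ennreal (V x) = vp x"
    using completion_ex_borel_measurable[of "\<lambda>x. e2ennreal (V x)" \<mu>] by auto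
  obtain vm where vm: "vm \<in> borel_measurable \<mu>" "AE x in \<mu>. e2ennreal (- V x) = vm x"
    using completion_ex_borel_measurable[of "\<lambda>x. e2ennreal (- V x)" \<mu>] by auto
  have int_vp: "(\<integral>\<^sup>+ x. e2ennreal (V x) \<partial>\<mu>) = (\<integral>\<^sup>+ x. vp x \<partial>\<mu>)" by (rule nn_integral_cong_AE[OF vp(2)])
  have int_vm: "(\<integral>\<^sup>+ x. e2ennreal (- V x) \<partial>\<mu>) = (\<integral>\<^sup>+ x. vm x \<partial>\<mu>)" by (rule nn_integral_cong_AE[OF vm(2)])
  have V_eq: "AE x in \<mu>. V x = ediff (vp x) (vm x)"
    using vp(2) vm(2) by eventually_elim (metis ediff_parts)
  have eint_V: "eint \<mu> V = ediff (\<integral>\<^sup>+ x. vp x \<partial>\<mu>) (\<integral>\<^sup>+ x. vm x \<partial>\<mu>)"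
    unfolding eint_eq_ediff int_vp int_vm ..
  have [measurable]: "(\<lambda>x. \<integral>\<^sup>+ y. e2ennreal (- f y) \<partial>\<kappa>0 x) \<in> borel_measurable \<mu>"
    using kernel_nn_integral_measurable[OF \<kappa>0, of "\<lambda>y. e2ennreal (- f y)"] by measurable
  have "AE x in \<mu>. (\<integral>\<^sup>+ y. e2ennreal (- f y) \<partial>\<kappa>0 x) \<noteq> \<top>"
    using nn_integral_PInf_AE[of "\<lambda>x. \<integral>\<^sup>+ y. e2ennreal (- f y) \<partial>\<kappa>0 x" \<mu>] \<kappa>0_finite by (simp add: less_top)
  with cost_\<kappa>0 vm(2) have "AE x in \<mu>. vm x \<le> (\<integral>\<^sup>+ y. e2ennreal (- f y) \<partial>\<kappa>0 x)"
  proof eventually_elim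
    case (elim x)
    let ?m = "\<integral>\<^sup>+ y. e2ennreal (- f y) \<partial>\<kappa>0 x"
    have "\<kappa>0 x \<in> prob_measures" using measurable_space[OF \<kappa>0] by simp
    from V_upper[OF this, of x] elim
    have "ediff (\<integral>\<^sup>+ y. e2ennreal (f y) \<partial>\<kappa>0 x) ?m \<le> V x" by simp
    \<comment> \<open>Dropping the positive part of f leaves a lower bound by the negative part
      alone, which has a finite integral.\<close>
    then have "ediff 0 ?m \<le> V x" by (rule order_trans[rotated]) (intro ediff_mono; simp)
    moreover have "ediff 0 ?m = - enn2ereal ?m"
      using elim by (cases ?m) (auto simp: ediff_def ereal_lminus_def zero_ennreal.rep_eq)
    ultimately have "- V x \<le> enn2ereal ?m" by (simp add: ereal_uminus_le_reorder)
    then have "e2ennreal (- V x) \<le> ?m" using e2ennreal_mono by fastforce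
    then show ?case using elim by simp
  qed
  then have "(\<integral>\<^sup>+ x. vm x \<partial>\<mu>) \<le> (\<integral>\<^sup>+ x. \<integral>\<^sup>+ y. e2ennreal (- f y) \<partial>\<kappa>0 x \<partial>\<mu>)"
    by (rule nn_integral_mono_AE)
  then have fin_m: "(\<integral>\<^sup>+ x. vm x \<partial>\<mu>) < \<top>" using \<kappa>0_finite by (rule order.strict_trans1)
  have "C_transform cost f = V" by (rule ext) (simp add: C_transform_eq V_def)
  then have "eint \<mu> V < \<infinity>"
    using f eint_univ_ext[OF \<mu> V_measurable] unfolding calL_def by simp
  then have fin_p: "(\<integral>\<^sup>+ x. vp x \<partial>\<mu>) < \<top>"
    using ediff_top_left[OF fin_m] unfolding eint_V by (cases "(\<integral>\<^sup>+ x. vp x \<partial>\<mu>) = \<top>") (auto simp: less_top)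
  show ?thesis
    using that[of vp vm] vp(1) vm(1) measurable_cong_sets[OF sets_\<mu> refl] V_eq fin_p fin_m eint_V by blast
qed

lemma rho_le: "rho \<mu> cost f \<le> eint \<mu> V"
  unfolding rho_def
proof (rule SUP_least)
  fix \<nu> :: "'y measure" assume \<nu>: "\<nu> \<in> prob_measures"
  obtain vp vm where [measurable]: "vp \<in> borel_measurable borel" "vm \<in> borel_measurable borel"
    and V_eq: "AE x in \<mu>. V x = ediff (vp x) (vm x)"
    and fin: "(\<integral>\<^sup>+ x. vp x \<partial>\<mu>) < \<top>" "(\<integral>\<^sup>+ x. vm x \<partial>\<mu>) < \<top>"
    and eint_V: "eint \<mu> V = ediff (\<integral>\<^sup>+ x. vp x \<partial>\<mu>) (\<integral>\<^sup>+ x. vm x \<partial>\<mu>)"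
    by (rule V_parts)
  \<comment> \<open>The two sides of the claim after cross-addition, with the cost term left
    out.\<close>
  define a where "a = (\<integral>\<^sup>+ y. e2ennreal (f y) \<partial>\<nu>) + (\<integral>\<^sup>+ x. vm x \<partial>\<mu>)"
  define b where "b = (\<integral>\<^sup>+ x. vp x \<partial>\<mu>) + (\<integral>\<^sup>+ y. e2ennreal (- f y) \<partial>\<nu>)"
  have le: "a \<le> b + (\<integral>\<^sup>+ x. cost x (k x) \<partial>\<mu>)" if "k \<in> kernels_between \<mu> \<nu>" for k
  proof -
    have k: "k \<in> borel \<rightarrow>\<^sub>M prob_algebra borel" and bind: "\<mu> \<bind> k = \<nu>"
      using that unfolding kernels_between_def by auto
    note [measurable] = cost_kernel_measurable[OF k]
      kernel_nn_integral_measurable[OF k, of "\<lambda>y. e2ennreal (f y)"]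
      kernel_nn_integral_measurable[OF k, of "\<lambda>y. e2ennreal (- f y)"]
    have "AE x in \<mu>. ediff (\<integral>\<^sup>+ y. e2ennreal (f y) \<partial>k x) ((\<integral>\<^sup>+ y. e2ennreal (- f y) \<partial>k x) + cost x (k x))
        \<le> ediff (vp x) (vm x)"
      using V_eq
    proof eventually_elim
      case (elim x)
      have "k x \<in> prob_measures" using measurable_space[OF k] by simp
      from V_upper[OF this, of x] elim show ?case by simp
    qed
    then have "ediff (\<integral>\<^sup>+ x. \<integral>\<^sup>+ y. e2ennreal (f y) \<partial>k x \<partial>\<mu>)
        (\<integral>\<^sup>+ x. (\<integral>\<^sup>+ y. e2ennreal (- f y) \<partial>k x) + cost x (k x) \<partial>\<mu>)
        \<le> ediff (\<integral>\<^sup>+ x. vp x \<partial>\<mu>) (\<integral>\<^sup>+ x. vm x \<partial>\<mu>)"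
      using fin(2) by (intro ediff_nn_integral_mono) auto
    then show ?thesis
      unfolding ediff_le_iff[OF fin(2)] a_def b_def bind[symmetric]
      by (simp add: nn_integral_bind_kernel[OF k] nn_integral_add add.assoc)
  qed
  have "a \<le> b + (INF k \<in> kernels_between \<mu> \<nu>. \<integral>\<^sup>+ x. cost x (k x) \<partial>\<mu>)"
  \<comment> \<open>Subtracting a finite b isolates the cost, so that the bound for each kernel
    passes to the infimum.\<close>
  proof (cases "b = \<top>")
    case False
    have "a - b \<le> (INF k \<in> kernels_between \<mu> \<nu>. \<integral>\<^sup>+ x. cost x (k x) \<partial>\<mu>)"
      using le False by (intro INF_greatest) (simp add: ennreal_minus_le_iff)
    then show ?thesis using False by (simp add: ennreal_minus_le_iff)
  qed simp
  then show "eint \<nu> f \<ominus>\<^sub>l enn2ereal (INF k \<in> kernels_between \<mu> \<nu>. \<integral>\<^sup>+ x. cost x (k x) \<partial>\<mu>) \<le> eint \<mu> V"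
    unfolding eint_V eint_eq_ediff[of \<nu>] ediff_lminus ediff_le_iff[OF fin(2)] a_def b_def by (simp add: add.assoc)
qed

lemma lift_kernel:
  assumes \<phi>: "\<phi> \<in> borel \<rightarrow>\<^sub>M Theta_algebra n \<M>"
  shows "(\<lambda>x. lift x (\<phi> x)) \<in> borel \<rightarrow>\<^sub>M prob_algebra borel"
proof (rule dirac_comb_kernel)
  have \<phi>': "\<phi> \<in> borel \<rightarrow>\<^sub>M tuples n" and in_Theta: "\<And>x. \<phi> x \<in> Theta n \<M>"
    using \<phi> unfolding Theta_algebra_def measurable_restrict_space2_iff by auto
  fix i assume i: "i \<in> I"
  show "(\<lambda>x. fst (\<phi> x) i) \<in> borel_measurable borel"
    by (rule measurable_compose[OF \<phi>' measurable_component_fst[OF i]])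
  have "(\<lambda>x. snd (\<phi> x) i) \<in> borel \<rightarrow>\<^sub>M borel"
    by (rule measurable_compose[OF \<phi>' measurable_component_snd[OF i]])
  from measurable_compose[OF measurable_Pair[OF measurable_ident this] \<tau>]
  show "(\<lambda>x. \<tau> x (snd (\<phi> x) i)) \<in> borel \<rightarrow>\<^sub>M borel" by simp
next
  fix x
  have "\<phi> x \<in> Theta n \<M>" using \<phi> unfolding Theta_algebra_def measurable_restrict_space2_iff by auto
  from lift_prob[OF this, of x] show "(\<Sum>i\<in>I. ennreal (fst (\<phi> x) i)) = 1" by (simp add: dirac_comb_prob_iff)
qed simp

text \<open>The kernel competes for its own image measure \<open>\<mu> \<bind> k\<close>. Finiteness
  of the integrated negative part allows the pointwise bound to be integrated and then split into
  the parts that \<open>rho\<close> sees.\<close>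

lemma rho_ge_kernel:
  assumes k: "k \<in> borel \<rightarrow>\<^sub>M prob_algebra borel" and w: "integrable \<mu> w"
    and le: "AE x in \<mu>. ereal (w x) \<le> ediff (\<integral>\<^sup>+ y. e2ennreal (f y) \<partial>k x)
       ((\<integral>\<^sup>+ y. e2ennreal (- f y) \<partial>k x) + cost x (k x))"
    and fin: "(\<integral>\<^sup>+ x. (\<integral>\<^sup>+ y. e2ennreal (- f y) \<partial>k x) + cost x (k x) \<partial>\<mu>) < \<top>"
  shows "ereal (integral\<^sup>L \<mu> w) \<le> rho \<mu> cost f"
proof -
  note [measurable] = cost_kernel_measurable[OF k] borel_measurable_integrable[OF w]
    kernel_nn_integral_measurable[OF k, of "\<lambda>y. e2ennreal (f y)"]
    kernel_nn_integral_measurable[OF k, of "\<lambda>y. e2ennreal (- f y)"]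
  have "ereal (integral\<^sup>L \<mu> w) = ediff (\<integral>\<^sup>+ x. e2ennreal (ereal (w x)) \<partial>\<mu>) (\<integral>\<^sup>+ x. e2ennreal (- ereal (w x)) \<partial>\<mu>)"
    unfolding eint_ereal[OF w, symmetric] eint_eq_ediff ..
  also have "\<dots> \<le> ediff (\<integral>\<^sup>+ x. \<integral>\<^sup>+ y. e2ennreal (f y) \<partial>k x \<partial>\<mu>)
      (\<integral>\<^sup>+ x. (\<integral>\<^sup>+ y. e2ennreal (- f y) \<partial>k x) + cost x (k x) \<partial>\<mu>)"
    using le fin by (intro ediff_nn_integral_mono) (auto simp del: e2ennreal_ereal uminus_ereal.simps)
  also have "\<dots> = ediff (\<integral>\<^sup>+ y. e2ennreal (f y) \<partial>(\<mu> \<bind> k))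
      ((\<integral>\<^sup>+ y. e2ennreal (- f y) \<partial>(\<mu> \<bind> k)) + (\<integral>\<^sup>+ x. cost x (k x) \<partial>\<mu>))"
    by (simp add: nn_integral_bind_kernel[OF k] nn_integral_add)
  also have "\<dots> \<le> ediff (\<integral>\<^sup>+ y. e2ennreal (f y) \<partial>(\<mu> \<bind> k))
      ((\<integral>\<^sup>+ y. e2ennreal (- f y) \<partial>(\<mu> \<bind> k)) + (INF k' \<in> kernels_between \<mu> (\<mu> \<bind> k). \<integral>\<^sup>+ x. cost x (k' x) \<partial>\<mu>))"
    using k by (intro ediff_mono add_mono INF_lower) (auto simp: kernels_between_def)
  also have "\<dots> = eint (\<mu> \<bind> k) f \<ominus>\<^sub>l enn2ereal (INF k' \<in> kernels_between \<mu> (\<mu> \<bind> k). \<integral>\<^sup>+ x. cost x (k' x) \<partial>\<mu>)"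
    unfolding eint_eq_ediff ediff_lminus ..
  also have "\<dots> \<le> rho \<mu> cost f" unfolding rho_def by (rule SUP_upper[OF bind_prob[OF k]])
  finally show ?thesis .
qed


lemma V_integrable:
  obtains v where "v \<in> borel_measurable borel" "integrable \<mu> v" "AE x in \<mu>. V x = ereal (v x)"
    "eint \<mu> V = ereal (integral\<^sup>L \<mu> v)"
proof -
  obtain vp vm where [measurable]: "vp \<in> borel_measurable borel" "vm \<in> borel_measurable borel"
    and V_eq: "AE x in \<mu>. V x = ediff (vp x) (vm x)"
    and fin: "(\<integral>\<^sup>+ x. vp x \<partial>\<mu>) < \<top>" "(\<integral>\<^sup>+ x. vm x \<partial>\<mu>) < \<top>"
    and eint_V: "eint \<mu> V = ediff (\<integral>\<^sup>+ x. vp x \<partial>\<mu>) (\<integral>\<^sup>+ x. vm x \<partial>\<mu>)"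
    by (rule V_parts)
  define v where "v x = enn2real (vp x) - enn2real (vm x)" for x
  have "vp \<in> borel_measurable \<mu>" "vm \<in> borel_measurable \<mu>" by measurable
  note vp = integrable_enn2real[OF this(1) fin(1)] and vm = integrable_enn2real[OF this(2) fin(2)]
  have "AE x in \<mu>. vp x \<noteq> \<top>" "AE x in \<mu>. vm x \<noteq> \<top>"
    using nn_integral_PInf_AE[of vp \<mu>] nn_integral_PInf_AE[of vm \<mu>] fin by (simp_all add: less_top)
  with V_eq have "AE x in \<mu>. V x = ereal (v x)"
    by eventually_elim (simp add: ediff_finite v_def less_top)
  moreover have "integrable \<mu> v" "eint \<mu> V = ereal (integral\<^sup>L \<mu> v)"
    unfolding v_def eint_V ediff_finite[OF fin] using vp vm by simp_all
  moreover have "v \<in> borel_measurable borel" unfolding v_def by measurable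
  ultimately show ?thesis using that by blast
qed

text \<open>The value of the fallback kernel: its negative part is integrable by
  \<open>calL\<close>, its positive part because V dominates the value.\<close>

lemma \<kappa>0_integrable:
  obtains u where "integrable \<mu> u" "AE x in \<mu>. ereal (u x) =
      ediff (\<integral>\<^sup>+ y. e2ennreal (f y) \<partial>\<kappa>0 x) ((\<integral>\<^sup>+ y. e2ennreal (- f y) \<partial>\<kappa>0 x) + cost x (\<kappa>0 x))"
proof -
  obtain vp vm where [measurable]: "vp \<in> borel_measurable borel" "vm \<in> borel_measurable borel"
    and V_eq: "AE x in \<mu>. V x = ediff (vp x) (vm x)"
    and fin: "(\<integral>\<^sup>+ x. vp x \<partial>\<mu>) < \<top>" "(\<integral>\<^sup>+ x. vm x \<partial>\<mu>) < \<top>"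
    by (rule V_parts)
  define P where "P x = (\<integral>\<^sup>+ y. e2ennreal (f y) \<partial>\<kappa>0 x)" for x
  define Q where "Q x = (\<integral>\<^sup>+ y. e2ennreal (- f y) \<partial>\<kappa>0 x)" for x
  have [measurable]: "P \<in> borel_measurable borel" "Q \<in> borel_measurable borel"
    unfolding P_def Q_def by (intro kernel_nn_integral_measurable \<kappa>0; measurable)+
  have PQ: "P \<in> borel_measurable \<mu>" "Q \<in> borel_measurable \<mu>" by measurable
  have Q_fin: "(\<integral>\<^sup>+ x. Q x \<partial>\<mu>) < \<top>" unfolding Q_def by (rule \<kappa>0_finite)
  have "AE x in \<mu>. ediff (P x) (Q x) \<le> ediff (vp x) (vm x)"
    using V_eq cost_\<kappa>0
  proof eventually_elim
    case (elim x)
    have "\<kappa>0 x \<in> prob_measures" using measurable_space[OF \<kappa>0] by simp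
    from V_upper[OF this, of x] elim show ?case unfolding P_def Q_def by simp
  qed
  then have "ediff (\<integral>\<^sup>+ x. P x \<partial>\<mu>) (\<integral>\<^sup>+ x. Q x \<partial>\<mu>) \<le> ediff (\<integral>\<^sup>+ x. vp x \<partial>\<mu>) (\<integral>\<^sup>+ x. vm x \<partial>\<mu>)"
    using fin(2) by (intro ediff_nn_integral_mono) auto
  then have P_fin: "(\<integral>\<^sup>+ x. P x \<partial>\<mu>) < \<top>"
    using ediff_top_left[OF Q_fin] ediff_finite[OF fin]
    by (cases "(\<integral>\<^sup>+ x. P x \<partial>\<mu>) = \<top>") (auto simp: less_top)
  have "AE x in \<mu>. P x \<noteq> \<top>" "AE x in \<mu>. Q x \<noteq> \<top>"
    using nn_integral_PInf_AE[OF PQ(1)] nn_integral_PInf_AE[OF PQ(2)] P_fin Q_fin by (simp_all add: less_top)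
  with cost_\<kappa>0 have "AE x in \<mu>. ereal (enn2real (P x) - enn2real (Q x)) = ediff (P x) (Q x + cost x (\<kappa>0 x))"
    by eventually_elim (simp add: ediff_finite less_top)
  moreover have "integrable \<mu> (\<lambda>x. enn2real (P x) - enn2real (Q x))"
    using integrable_enn2real(1)[OF PQ(1) P_fin] integrable_enn2real(1)[OF PQ(2) Q_fin] by simp
  ultimately show ?thesis using that unfolding P_def Q_def by blast
qed

section \<open>Near-optimal selectors and the lower bound\<close>

lemma eps_selection:
  assumes v: "v \<in> borel_measurable borel" "AE x in \<mu>. V x = ereal (v x)" and \<epsilon>: "0 < \<epsilon>"
  obtains \<phi> where "\<phi> \<in> borel \<rightarrow>\<^sub>M Theta_algebra n \<M>" "AE x in \<mu>. ereal (v x - \<epsilon>) < comb x (\<phi> x)"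
proof -
  interpret prob_space \<mu> by (rule prob_\<mu>)
  have "(\<lambda>x. ereal (v x - \<epsilon>)) \<in> borel_measurable borel" using v(1) by measurable
  then obtain B Z h where B[measurable]: "B \<in> sets borel" and Z: "Z \<in> null_sets \<mu>" and h[measurable]: "h \<in> borel \<rightarrow>\<^sub>M tuples n"
    and cover: "{x. ereal (v x - \<epsilon>) < V x} \<subseteq> B \<union> Z"
    and sel: "\<And>x. x \<in> B \<Longrightarrow> h x \<in> Theta n \<M> \<and> ereal (v x - \<epsilon>) < comb x (h x)"
    by (rule comb_selection[OF \<mu>]) (rule that)
  have AE_B: "AE x in \<mu>. x \<in> B"
    using v(2) AE_not_in[OF Z]
  proof eventually_elim
    case (elim x)
    then have "ereal (v x - \<epsilon>) < V x" using \<epsilon> by simp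
    with elim cover show ?case by blast
  qed
  \<comment> \<open>The selector must take values in \<open>Theta\<close> everywhere. Its value at
    one point of B serves off B, and such a point exists because B has full measure.\<close>
  have "B \<noteq> {}"
  proof
    assume "B = {}"
    with AE_B have "AE x in \<mu>. False" by simp
    then show False by simp
  qed
  then obtain x0 where x0: "x0 \<in> B" by blast
  define \<phi> where "\<phi> x = (if x \<in> B then h x else h x0)" for x
  have "h x0 \<in> space (tuples n)" using measurable_space[OF h] by simp
  then have "\<phi> \<in> borel \<rightarrow>\<^sub>M tuples n"
    unfolding \<phi>_def using B by (intro measurable_If_set[OF h] measurable_const) auto
  moreover have "\<phi> x \<in> Theta n \<M>" for x using sel[of x] sel[OF x0] unfolding \<phi>_def by auto
  ultimately have "\<phi> \<in> borel \<rightarrow>\<^sub>M Theta_algebra n \<M>"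
    unfolding Theta_algebra_def measurable_restrict_space2_iff by auto
  moreover have "AE x in \<mu>. ereal (v x - \<epsilon>) < comb x (\<phi> x)"
    using AE_B by eventually_elim (simp add: \<phi>_def sel)
  ultimately show ?thesis using that by blast
qed

text \<open>The kernel of the selection may have infinite cost or integrate \<open>f\<close> to \<open>\<infinity> - \<infinity>\<close>.
  Using it only where its integrals are bounded by \<open>j\<close>, and \<open>\<kappa>0\<close> elsewhere, avoids this.\<close>

lemma rho_ge_selection:
  assumes v: "v \<in> borel_measurable borel" "integrable \<mu> v" "AE x in \<mu>. V x = ereal (v x)"
    and \<phi>: "\<phi> \<in> borel \<rightarrow>\<^sub>M Theta_algebra n \<M>" and v_le: "AE x in \<mu>. ereal (v x - \<epsilon>) < comb x (\<phi> x)"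
  shows "ereal (integral\<^sup>L \<mu> v - \<epsilon>) \<le> rho \<mu> cost f"
proof -
  interpret prob_space \<mu> by (rule prob_\<mu>)
  obtain u where u: "integrable \<mu> u" and u_eq: "AE x in \<mu>. ereal (u x) =
      ediff (\<integral>\<^sup>+ y. e2ennreal (f y) \<partial>\<kappa>0 x) ((\<integral>\<^sup>+ y. e2ennreal (- f y) \<partial>\<kappa>0 x) + cost x (\<kappa>0 x))"
    by (rule \<kappa>0_integrable)
  have \<phi>_Theta: "\<phi> x \<in> Theta n \<M>" for x
    using \<phi> unfolding Theta_algebra_def measurable_restrict_space2_iff by auto
  define K where "K x = lift x (\<phi> x)" for x
  have K: "K \<in> borel \<rightarrow>\<^sub>M prob_algebra borel" unfolding K_def by (rule lift_kernel[OF \<phi>])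
  define p where "p x = (\<integral>\<^sup>+ y. e2ennreal (f y) \<partial>K x)" for x
  define q where "q x = (\<integral>\<^sup>+ y. e2ennreal (- f y) \<partial>K x) + cost x (K x)" for x
  note [measurable] = v(1) borel_measurable_integrable[OF u] borel_measurable_integrable[OF v(2)]
    cost_kernel_measurable[OF K] kernel_nn_integral_measurable[OF K, of "\<lambda>y. e2ennreal (- f y)"]
    kernel_nn_integral_measurable[OF \<kappa>0, of "\<lambda>y. e2ennreal (- f y)"] cost_kernel_measurable[OF \<kappa>0]
  have [measurable]: "p \<in> borel_measurable borel" "q \<in> borel_measurable borel"
    unfolding p_def q_def using kernel_nn_integral_measurable[OF K, of "\<lambda>y. e2ennreal (f y)"] by measurable
  have comb_eq: "comb x (\<phi> x) = ediff (p x) (q x)" for x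
    unfolding p_def q_def K_def by (rule comb_value_eq_lift[OF \<phi>_Theta f_measurable])
  \<comment> \<open>The value at the selector lies between \<open>v x - \<epsilon>\<close> and V,
    both finite almost everywhere, which excludes infinite parts.\<close>
  have pq_fin: "AE x in \<mu>. p x < \<top> \<and> q x < \<top>"
    using v(3) v_le
  proof eventually_elim
    case (elim x)
    have "comb x (\<phi> x) \<le> V x" unfolding V_def by (rule SUP_upper[OF \<phi>_Theta])
    then have "ediff (p x) (q x) \<noteq> \<infinity>" "ediff (p x) (q x) \<noteq> - \<infinity>" using elim unfolding comb_eq by auto
    then show ?case
      using ediff_eq_MInf_iff[of "p x" "q x"] ediff_top_left[of "q x"]
      by (cases "q x = \<top>"; cases "p x = \<top>") (auto simp: less_top)
  qed
  define A where "A j = {x. p x \<le> of_nat j \<and> q x \<le> of_nat j}" for j :: nat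
  have A[measurable]: "A j \<in> sets borel" for j unfolding A_def by measurable
  define \<kappa> where "\<kappa> j x = (if x \<in> A j then K x else \<kappa>0 x)" for j x
  have \<kappa>: "\<kappa> j \<in> borel \<rightarrow>\<^sub>M prob_algebra borel" for j
    unfolding \<kappa>_def using K \<kappa>0 A by (intro measurable_If_set) auto
  \<comment> \<open>An almost everywhere minorant of the value of \<open>\<kappa> j\<close>,
    dominated uniformly in j by an integrable function. It converges to
    \<open>v - \<epsilon>\<close> because almost every x lies in \<open>A j\<close> for all large
    j.\<close>
  define w where "w j x = (if x \<in> A j then v x - \<epsilon> else u x)" for j x
  have dom: "integrable \<mu> (\<lambda>x. \<bar>v x\<bar> + \<bar>\<epsilon>\<bar> + \<bar>u x\<bar>)" using v(2) u by auto
  have w_meas: "w j \<in> borel_measurable \<mu>" for j unfolding w_def by measurable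
  have w_bound: "norm (w j x) \<le> \<bar>v x\<bar> + \<bar>\<epsilon>\<bar> + \<bar>u x\<bar>" for j x unfolding w_def by auto
  have w_int: "integrable \<mu> (w j)" for j
    by (rule Bochner_Integration.integrable_bound[OF dom w_meas]) (use w_bound in \<open>auto intro: order_trans\<close>)
  have le_rho: "ereal (integral\<^sup>L \<mu> (w j)) \<le> rho \<mu> cost f" for j
  proof (rule rho_ge_kernel[OF \<kappa> w_int])
    show "AE x in \<mu>. ereal (w j x) \<le> ediff (\<integral>\<^sup>+ y. e2ennreal (f y) \<partial>\<kappa> j x)
        ((\<integral>\<^sup>+ y. e2ennreal (- f y) \<partial>\<kappa> j x) + cost x (\<kappa> j x))"
      using v_le u_eq
    proof eventually_elim
      case (elim x)
      then show ?case unfolding w_def \<kappa>_def comb_eq p_def q_def by (auto intro: less_imp_le)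
    qed
    let ?q0 = "\<lambda>x. (\<integral>\<^sup>+ y. e2ennreal (- f y) \<partial>\<kappa>0 x) + cost x (\<kappa>0 x)"
    have "(\<integral>\<^sup>+ x. ?q0 x \<partial>\<mu>) = (\<integral>\<^sup>+ x. \<integral>\<^sup>+ y. e2ennreal (- f y) \<partial>\<kappa>0 x \<partial>\<mu>)"
      using cost_\<kappa>0 by (intro nn_integral_cong_AE) (auto elim!: eventually_mono)
    then have fin0: "(\<integral>\<^sup>+ x. ?q0 x \<partial>\<mu>) < \<top>" using \<kappa>0_finite by simp
    have "(\<integral>\<^sup>+ x. (\<integral>\<^sup>+ y. e2ennreal (- f y) \<partial>\<kappa> j x) + cost x (\<kappa> j x) \<partial>\<mu>) \<le> (\<integral>\<^sup>+ x. of_nat j + ?q0 x \<partial>\<mu>)"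
    proof (rule nn_integral_mono)
      fix x
      show "(\<integral>\<^sup>+ y. e2ennreal (- f y) \<partial>\<kappa> j x) + cost x (\<kappa> j x) \<le> of_nat j + ?q0 x"
      proof (cases "x \<in> A j")
        case True
        then have "q x \<le> of_nat j" unfolding A_def by blast
        then have "q x \<le> of_nat j + ?q0 x" by (rule order_trans) simp
        then show ?thesis using True unfolding \<kappa>_def q_def by simp
      qed (simp add: \<kappa>_def)
    qed
    also have "\<dots> < \<top>" using fin0 by (subst nn_integral_add) (auto simp: emeasure_space_1 of_nat_less_top)
    finally show "(\<integral>\<^sup>+ x. (\<integral>\<^sup>+ y. e2ennreal (- f y) \<partial>\<kappa> j x) + cost x (\<kappa> j x) \<partial>\<mu>) < \<top>" .
  qed
  have "(\<lambda>j. integral\<^sup>L \<mu> (w j)) \<longlonglongrightarrow> integral\<^sup>L \<mu> (\<lambda>x. v x - \<epsilon>)"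
  proof (rule integral_dominated_convergence[OF _ w_meas dom])
    show "AE x in \<mu>. (\<lambda>j. w j x) \<longlonglongrightarrow> v x - \<epsilon>"
      using pq_fin
    proof eventually_elim
      case (elim x)
      then obtain j1 j2 :: nat where "p x < of_nat j1" "q x < of_nat j2"
        using ennreal_Ex_less_of_nat by blast
      then have "x \<in> A j" if "max j1 j2 \<le> j" for j
      proof -
        have "(of_nat j1 :: ennreal) \<le> of_nat j" "(of_nat j2 :: ennreal) \<le> of_nat j" using that by auto
        with \<open>p x < of_nat j1\<close> \<open>q x < of_nat j2\<close> have "p x \<le> of_nat j" "q x \<le> of_nat j"
          by (auto intro: order_trans less_imp_le)
        then show ?thesis unfolding A_def by blast
      qed
      then have "\<forall>\<^sub>F j in sequentially. w j x = v x - \<epsilon>"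
        unfolding w_def eventually_sequentially by (intro exI[of _ "max j1 j2"]) auto
      then show ?case by (rule tendsto_eventually)
    qed
  qed (use w_bound in auto)
  moreover have "integral\<^sup>L \<mu> (\<lambda>x. v x - \<epsilon>) = integral\<^sup>L \<mu> v - \<epsilon>" using v(2) by (simp add: prob_space)
  ultimately have "(\<lambda>j. ereal (integral\<^sup>L \<mu> (w j))) \<longlonglongrightarrow> ereal (integral\<^sup>L \<mu> v - \<epsilon>)" by simp
  then show ?thesis by (rule LIMSEQ_le_const2) (use le_rho in blast)
qed

text \<open>One selector serves both bounds: its value enters the supremum directly, and its
  truncated kernels bound \<open>rho\<close>. Finiteness of the integral of V lets \<epsilon> tend
  to 0.\<close>

lemma V_le_sup_and_rho:
  "eint \<mu> V \<le> (SUP \<phi> \<in> borel \<rightarrow>\<^sub>M Theta_algebra n \<M>. eint \<mu> (\<lambda>x. comb x (\<phi> x)))" (is "_ \<le> ?s")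
  "eint \<mu> V \<le> rho \<mu> cost f"
proof -
  interpret prob_space \<mu> by (rule prob_\<mu>)
  obtain v where v: "v \<in> borel_measurable borel" "integrable \<mu> v" "AE x in \<mu>. V x = ereal (v x)"
    and eint_V: "eint \<mu> V = ereal (integral\<^sup>L \<mu> v)"
    by (rule V_integrable)
  have *: "ereal (integral\<^sup>L \<mu> v - \<epsilon>) \<le> ?s \<and> ereal (integral\<^sup>L \<mu> v - \<epsilon>) \<le> rho \<mu> cost f" if \<epsilon>: "0 < \<epsilon>" for \<epsilon> :: real
  proof -
    obtain \<phi> where \<phi>: "\<phi> \<in> borel \<rightarrow>\<^sub>M Theta_algebra n \<M>" and le: "AE x in \<mu>. ereal (v x - \<epsilon>) < comb x (\<phi> x)"
      by (rule eps_selection[OF v(1,3) \<epsilon>])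
    have "ereal (integral\<^sup>L \<mu> v - \<epsilon>) = eint \<mu> (\<lambda>x. ereal (v x - \<epsilon>))"
      using eint_ereal[of \<mu> "\<lambda>x. v x - \<epsilon>"] v(2) by (simp add: prob_space)
    also have "\<dots> \<le> eint \<mu> (\<lambda>x. comb x (\<phi> x))"
      using le by (intro eint_mono_AE) (auto elim!: eventually_mono intro: less_imp_le)
    also have "\<dots> \<le> ?s" by (rule SUP_upper[OF \<phi>])
    finally show ?thesis using rho_ge_selection[OF v \<phi> le] by blast
  qed
  have "eint \<mu> V \<le> s" if le: "\<And>\<epsilon>. 0 < \<epsilon> \<Longrightarrow> ereal (integral\<^sup>L \<mu> v - \<epsilon>) \<le> s" for s
  proof (rule ereal_le_epsilon2)
    fix \<epsilon> :: real assume "0 < \<epsilon>"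
    from le[OF this] show "eint \<mu> V \<le> s + ereal \<epsilon>" unfolding eint_V by (cases s) auto
  qed
  with * show "eint \<mu> V \<le> ?s" "eint \<mu> V \<le> rho \<mu> cost f" by simp_all
qed

lemma sup_le_V:
  "(SUP \<phi> \<in> borel \<rightarrow>\<^sub>M Theta_algebra n \<M>. eint \<mu> (\<lambda>x. comb x (\<phi> x))) \<le> eint \<mu> V"
proof (rule SUP_least, rule eint_mono_AE, rule AE_I2)
  fix \<phi> :: "'x \<Rightarrow> (nat \<Rightarrow> real) \<times> (nat \<Rightarrow> 'y)" and x
  assume "\<phi> \<in> borel \<rightarrow>\<^sub>M Theta_algebra n \<M>"
  then have "\<phi> x \<in> Theta n \<M>" unfolding Theta_algebra_def measurable_restrict_space2_iff by auto
  then show "comb x (\<phi> x) \<le> V x" unfolding V_def by (rule SUP_upper)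
qed

lemma duality:
  "rho \<mu> cost f = (SUP \<phi> \<in> borel \<rightarrow>\<^sub>M Theta_algebra n \<M>. eint \<mu> (\<lambda>x. comb x (\<phi> x)))"
  "rho \<mu> cost f = eint (univ_ext \<mu>) V"
  using rho_le V_le_sup_and_rho sup_le_V eint_univ_ext[OF \<mu> V_measurable] by (auto intro: antisym order_trans)

end

text \<open>The measurability conjunct gives the integral against \<open>univ_ext \<mu>\<close> its
  meaning.\<close>

theorem proposition3p6:
  fixes \<mu> :: "'x::topological_space measure"
    and n :: nat
    and fs :: "nat \<Rightarrow> 'y::topological_space \<Rightarrow> ereal"
    and cs :: "nat \<Rightarrow> real"
    and \<tau> :: "'x \<Rightarrow> 'y \<Rightarrow> 'y"
    and c :: "'x \<times> 'y \<Rightarrow> ennreal"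
    and \<kappa>0 :: "'x \<Rightarrow> 'y measure"
    and \<M> :: "'y measure set"
    and C :: "'x \<Rightarrow> 'y measure \<Rightarrow> ennreal"
  assumes "is_Borel_space TYPE('x) TYPE('p::polish_space)"
    and "is_Borel_space TYPE('y) TYPE('q::polish_space)"
    and "\<mu> \<in> prob_measures"
    and "\<And>i. i \<in> {1..n} \<Longrightarrow> fs i \<in> borel_measurable borel"
    and "\<M> = moment_set n fs cs"
    and "\<And>x. bij (\<tau> x)"
    and "(\<lambda>(x, y). \<tau> x y) \<in> borel \<rightarrow>\<^sub>M borel"
    and "(\<lambda>(x, y). inv (\<tau> x) y) \<in> borel \<rightarrow>\<^sub>M borel"
    and "c \<in> borel_measurable borel"
    and "C = moment_cost \<tau> c \<M>"
    and "\<kappa>0 \<in> borel \<rightarrow>\<^sub>M prob_algebra borel"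
    and "AE x in \<mu>. C x (\<kappa>0 x) = 0"
  shows "\<forall>f \<in> calL \<mu> C \<kappa>0.
      rho \<mu> C f
        = (SUP \<phi> \<in> borel \<rightarrow>\<^sub>M Theta_algebra n \<M>. eint \<mu> (\<lambda>x. comb_value n \<tau> c f x (\<phi> x)))
    \<and> (\<lambda>x. SUP \<theta> \<in> Theta n \<M>. comb_value n \<tau> c f x \<theta>) \<in> borel_measurable univ_borel
    \<and> rho \<mu> C f
        = eint (univ_ext \<mu>) (\<lambda>x. SUP \<theta> \<in> Theta n \<M>. comb_value n \<tau> c f x \<theta>)"
proof
  fix f assume f: "f \<in> calL \<mu> C \<kappa>0"
  \<comment> \<open>Measurability is assumed for the Borel sets of the product topology; second
    countability of both spaces transfers it to the product \<sigma>-algebra.\<close>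
  note pair = measurable_borel_pair_Borel_space[OF assms(1,2)]
  interpret moment_problem_function \<mu> n fs cs \<tau> c \<kappa>0 f
    using assms(3,4,6,11,12) f pair[OF assms(7)] pair[OF assms(8)] pair[OF assms(9)]
      baire_image_Borel_space[OF assms(2)]
    unfolding assms(5,10) by unfold_locales
  have "V = (\<lambda>x. SUP \<theta> \<in> Theta n \<M>. comb_value n \<tau> c f x \<theta>)"
    unfolding V_def assms(5) ..
  then show "rho \<mu> C f
        = (SUP \<phi> \<in> borel \<rightarrow>\<^sub>M Theta_algebra n \<M>. eint \<mu> (\<lambda>x. comb_value n \<tau> c f x (\<phi> x)))
    \<and> (\<lambda>x. SUP \<theta> \<in> Theta n \<M>. comb_value n \<tau> c f x \<theta>) \<in> borel_measurable univ_borel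
    \<and> rho \<mu> C f
        = eint (univ_ext \<mu>) (\<lambda>x. SUP \<theta> \<in> Theta n \<M>. comb_value n \<tau> c f x \<theta>)"
    using duality V_measurable unfolding assms(5,10) by simp
qed

end
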